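(* Let $\Omega^{AB}$ be a quantum channel from $A_0B_0$ to $A_1B_1$ with normalized Choi matrix $\omega^{AB}$. 1. (Generalization of conditional min-entropy) If $\Omega^{AB}$ is a replacement channel, i.e. $\Omega^{AB}(\rho^{A_0B_0})=\omega^{A_1B_1}$ for all density matrices $\rho^{A_0B_0}$, then $H^{\rm ext}_{\min}(B|A)_\Omega=H_{\min}(B_1|A_1)_\omega$. 2. (Independence) If $\Omega^{AB}=\Psi^A\otimes\Phi^B$ with $\Psi^A$ and $\Phi^B$ channels, then $H^{\rm ext}_{\min}(B|A)_\Omega=H^{\rm ext}_{\min}(B)_\Phi$; in particular it is independent of $\Psi^A$. 3. (Additivity) For every quantum channel $\Gamma^{A'B'}$ from $A_0'B_0'$ to $A_1'B_1'$, $$H^{\rm ext}_{\min}(BB'|AA')_{\Omega\otimes\Gamma}=H^{\rm ext}_{\min}(B|A)_\Omega+H^{\rm ext}_{\min}(B'|A')_\Gamma.$$ 4. (Monotonicity) For every superchannel $\Theta':\mathcal L^A\to\mathcal L^C$, $$H^{\rm ext}_{\min}(B|A)_{\Omega^{AB}}\le H^{\rm ext}_{\min}(B|C)_{(\Theta'\otimes\mathbb 1^B)[\Omega^{AB}]}.$$ 5. (Conditioning) For every tripartite quantum channel $\Omega^{ABC}$ from $A_0B_0C_0$ to $A_1B_1C_1$ and every density matrix $\gamma^{C_0}$, with the marginal channel $\Omega^{AB}(\rho^{A_0B_0})=\mathrm{Tr}_{C_1}[\Omega^{ABC}(\rho^{A_0B_0}\otimes\gamma^{C_0})]$, $$H^{\rm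 ext}_{\min}(B|AC)_{\Omega^{ABC}}\le H^{\rm ext}_{\min}(B|A)_{\Omega^{AB}}.$$ 6. (Bounds) $$H_{\min}(AB_1|B_0)_\omega-\log_2(d_{A})\ \le\ H^{\rm ext}_{\min}(B|A)_\Omega\ \le\ H_{\min}(B_1|A_1)_\omega,\qquad d_A=d_{A_0}d_{A_1}.$$
   Context: All Hilbert spaces are finite-dimensional; $d_S=\dim\mathcal H^S$. Each party $A$ has an input system $A_0$ and an output system $A_1$, and $A$ as a label of operators means the joint system $A_0A_1$. $\mathcal L^A$ is the space of linear maps $\mathcal B(\mathcal H^{A_0})\to\mathcal B(\mathcal H^{A_1})$; $\mathcal L^{AB}=\mathcal L^A\otimes\mathcal L^B$ is the space of linear maps $\mathcal B(\mathcal H^{A_0B_0})\to\mathcal B(\mathcal H^{A_1B_1})$. A (quantum) channel is a completely positive trace-preserving map. $\mathbb 1^C$ is the identity map on $\mathcal L^C$. For composite parties such as $AA'$, the input is $A_0A_0'$ and the output $A_1A_1'$. Superchannel: a linear map $\Theta:\mathcal L^A\to\mathcal L^B$ such that (i) for every party $C=(C_0,C_1)$, $\mathbb 1^C\otimes\Theta$ sends completely positive maps to completely positive maps, and (ii) $\Theta$ sends trace-preserving maps to trace-preserving maps. Deleting system labels from an operator denotes partial trace over the deleted systems; $u^S=I^S/d_S$. Normalized Choi matrix of $\Omega^{AB}$: $\omega^{AB}=\frac1{d_{A_0}d_{B_0}}(\mathrm{id}^{A_0B_0}\otimes\Omega^{\tilde A_0\tilde B_0\to A_1B_1})(\phi_+^{A_0\tilde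 A_0}\otimes\phi_+^{B_0\tilde B_0})$, where $\phi_+^{S\tilde S}=\sum_{i,j}|i\rangle\langle j|^S\otimes|i\rangle\langle j|^{\tilde S}$ and $\tilde S$ is a copy of $S$. Conditional min-entropy of a density matrix $\rho^{PQ}$: $H_{\min}(Q|P)_\rho=-\log_2\min\{\mathrm{Tr}[\sigma^P]:\sigma^P\otimes I^Q\ge\rho^{PQ}\}$; when applied to $\omega$, it is evaluated on the corresponding marginal of $\omega^{AB}$. Extended min-entropy of a channel $\Phi^B$ from $B_0$ to $B_1$: $H^{\rm ext}_{\min}(B)_\Phi=H_{\min}(B_1|B_0)_{J_\Phi/d_{B_0}}$, where $J_\Phi=\sum_{i,j}|i\rangle\langle j|^{B_0}\otimes\Phi(|i\rangle\langle j|)$. Extended conditional min-entropy of a bipartite channel: $$H^{\rm ext}_{\min}(B|A)_\Omega=-\log_2\min\big\{\mathrm{Tr}[\gamma^{AB_0}]:\ \gamma^{AB_0}\otimes I^{B_1}\ge\omega^{AB},\ \gamma^{A_0B_0}=u^{A_0}\otimes\gamma^{B_0}\big\},$$ the minimum being over Hermitian operators $\gamma^{AB_0}$ on $\mathcal H^{A_0A_1B_0}$. *)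

theory Defs
  imports "HOL-Analysis.Analysis"
begin

(*
  A system is given by a finite type 's labelling an orthonormal basis, so its Hilbert space is
  complex^'s, its dimension is CARD('s), and composite systems are product types.
  The order on type complex is the one of HOL-Library.Complex_Order: 0 \<le> z means that z is
  real and nonnegative.
*)

section \<open>Operators\<close>

type_synonym 's op = "((complex, 's) vec, 's) vec"

definition cscale :: "complex \<Rightarrow> 's::finite op \<Rightarrow> 's op" where
  "cscale c M = (\<chi> i j. c * M $ i $ j)"

(* the matrix unit |i><j| *)
definition munit :: "'s::finite \<Rightarrow> 's \<Rightarrow> 's op" where
  "munit i j = axis i (axis j 1)"

definition hermitian :: "'s::finite op \<Rightarrow> bool" where
  "hermitian M \<longleftrightarrow> (\<forall>i j. M $ i $ j = cnj (M $ j $ i))"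

(* <u, M v> *)
definition sesq :: "complex^'s \<Rightarrow> 's::finite op \<Rightarrow> complex^'s \<Rightarrow> complex" where
  "sesq u M v = (\<Sum>i\<in>UNIV. \<Sum>j\<in>UNIV. cnj (u $ i) * M $ i $ j * v $ j)"

definition psd :: "'s::finite op \<Rightarrow> bool" where
  "psd M \<longleftrightarrow> (\<forall>v. 0 \<le> sesq v M v)"

definition loewner_le :: "'s::finite op \<Rightarrow> 's op \<Rightarrow> bool"  (infix "\<preceq>" 50) where
  "M \<preceq> N \<longleftrightarrow> psd (N - M)"

definition density_matrix :: "'s::finite op \<Rightarrow> bool" where
  "density_matrix \<rho> \<longleftrightarrow> psd \<rho> \<and> trace \<rho> = 1"

definition kron :: "'s::finite op \<Rightarrow> 't::finite op \<Rightarrow> ('s \<times> 't) op"  (infixr "\<otimes>" 75) where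
  "M \<otimes> N = (\<chi> p q. M $ fst p $ fst q * N $ snd p $ snd q)"

definition max_mixed :: "'s::finite op" where
  "max_mixed = mat (1 / of_nat CARD('s))"

(* trace over the first, respectively the second, tensor factor *)
definition ptrace1 :: "('s::finite \<times> 't::finite) op \<Rightarrow> 't op" where
  "ptrace1 M = (\<chi> k l. \<Sum>i\<in>UNIV. M $ (i, k) $ (i, l))"

definition ptrace2 :: "('s::finite \<times> 't::finite) op \<Rightarrow> 's op" where
  "ptrace2 M = (\<chi> i j. \<Sum>k\<in>UNIV. M $ (i, k) $ (j, k))"

(* Only used with f a bijection that permutes tensor factors. *)
definition reindex :: "('t::finite \<Rightarrow> 's::finite) \<Rightarrow> 's op \<Rightarrow> 't op" where
  "reindex f M = (\<chi> i j. M $ f i $ f j)"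

section \<open>Channels\<close>

definition op_linear :: "('s::finite op \<Rightarrow> 't::finite op) \<Rightarrow> bool" where
  "op_linear \<Phi> \<longleftrightarrow> Vector_Spaces.linear cscale cscale \<Phi>"

lemma vector_space_cscale: "vector_space (cscale :: complex \<Rightarrow> 's::finite op \<Rightarrow> 's op)"
  by unfold_locales (simp_all add: cscale_def vec_eq_iff algebra_simps)

lemma op_linear_iff:
  "op_linear \<Phi> \<longleftrightarrow>
     (\<forall>X Y. \<Phi> (X + Y) = \<Phi> X + \<Phi> Y) \<and> (\<forall>c X. \<Phi> (cscale c X) = cscale c (\<Phi> X))"
  unfolding op_linear_def Vector_Spaces.linear_iff by (simp add: vector_space_cscale)

(*
  Ancillas of arbitrary finite dimension cannot be quantified over as types. An operator on
  C^I \<otimes> H, with I a finite set, is therefore given by its blocks X i j with i, j in I, i.e. it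
  is the sum of |i><j| \<otimes> X i j.
*)
definition block_psd :: "'i set \<Rightarrow> ('i \<Rightarrow> 'i \<Rightarrow> 's::finite op) \<Rightarrow> bool" where
  "block_psd I X \<longleftrightarrow> (\<forall>v. 0 \<le> (\<Sum>i\<in>I. \<Sum>j\<in>I. sesq (v i) (X i j) (v j)))"

definition completely_positive :: "('s::finite op \<Rightarrow> 't::finite op) \<Rightarrow> bool" where
  "completely_positive \<Phi> \<longleftrightarrow> op_linear \<Phi> \<and>
     (\<forall>(n::nat) X. block_psd {..<n} X \<longrightarrow> block_psd {..<n} (\<lambda>i j. \<Phi> (X i j)))"

definition trace_preserving :: "('s::finite op \<Rightarrow> 't::finite op) \<Rightarrow> bool" where
  "trace_preserving \<Phi> \<longleftrightarrow> (\<forall>X. trace (\<Phi> X) = trace X)"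

definition channel :: "('s::finite op \<Rightarrow> 't::finite op) \<Rightarrow> bool" where
  "channel \<Phi> \<longleftrightarrow> completely_positive \<Phi> \<and> trace_preserving \<Phi>"

definition reindex_map ::
  "('s2::finite \<Rightarrow> 's1::finite) \<Rightarrow> ('t2::finite \<Rightarrow> 't1::finite) \<Rightarrow> ('s1 op \<Rightarrow> 't1 op) \<Rightarrow> 's2 op \<Rightarrow> 't2 op"
  where
  "reindex_map f g \<Phi> = (\<lambda>X. reindex g (\<Phi> (reindex (inv f) X)))"

(* The linear extension of X \<otimes> Y \<mapsto> \<Phi> X \<otimes> \<Psi> Y. *)
definition tensor_map ::
  "('s1::finite op \<Rightarrow> 't1::finite op) \<Rightarrow> ('s2::finite op \<Rightarrow> 't2::finite op)
     \<Rightarrow> ('s1 \<times> 's2) op \<Rightarrow> ('t1 \<times> 't2) op" where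
  "tensor_map \<Phi> \<Psi> X =
     (\<Sum>i\<in>UNIV. \<Sum>j\<in>UNIV. \<Sum>k\<in>UNIV. \<Sum>l\<in>UNIV.
        cscale (X $ (i, k) $ (j, l)) (\<Phi> (munit i j) \<otimes> \<Psi> (munit k l)))"

(* For bipartite maps, grouped as A0 A0' B0 B0' \<rightarrow> A1 A1' B1 B1' with parties AA' and BB'. *)
definition bipartite_tensor ::
  "(('a0::finite \<times> 'b0::finite) op \<Rightarrow> ('a1::finite \<times> 'b1::finite) op)
    \<Rightarrow> (('c0::finite \<times> 'd0::finite) op \<Rightarrow> ('c1::finite \<times> 'd1::finite) op)
    \<Rightarrow> (('a0 \<times> 'c0) \<times> ('b0 \<times> 'd0)) op \<Rightarrow> (('a1 \<times> 'c1) \<times> ('b1 \<times> 'd1)) op" where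
  "bipartite_tensor \<Omega> \<Gamma> =
     reindex_map (\<lambda>((a, c), (b, d)). ((a, b), (c, d))) (\<lambda>((a, c), (b, d)). ((a, b), (c, d)))
       (tensor_map \<Omega> \<Gamma>)"

section \<open>Superchannels\<close>

(*
  Let E(i,j,k,l) be the map Y \<mapsto> Y_ij |k><l|. For a party C with input dimension m and output
  dimension n these form a basis of L^C (i, j < m and k, l < n), so an element of
  L^C \<otimes> L^A is uniquely the sum of E(i,j,k,l) \<otimes> N i j k l with N i j k l in L^A, and the
  identity on L^C tensored with \<Theta> applies \<Theta> to each N i j k l. On an operator with blocks
  X i j, this element yields the operator with blocks (\<Sum>i<m. \<Sum>j<m. N i j k l (X i j)).
  The next definition says that it is a completely positive map; r and s range over a further
  ancilla of dimension d.
*)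
definition family_completely_positive ::
  "nat \<Rightarrow> nat \<Rightarrow> (nat \<Rightarrow> nat \<Rightarrow> nat \<Rightarrow> nat \<Rightarrow> 's::finite op \<Rightarrow> 't::finite op) \<Rightarrow> bool" where
  "family_completely_positive m n N \<longleftrightarrow>
     (\<forall>i<m. \<forall>j<m. \<forall>k<n. \<forall>l<n. op_linear (N i j k l)) \<and>
     (\<forall>(d::nat) X. block_psd ({..<d} \<times> {..<m}) X \<longrightarrow>
        block_psd ({..<d} \<times> {..<n})
          (\<lambda>(r, k) (s, l). \<Sum>i<m. \<Sum>j<m. N i j k l (X (r, i) (s, j))))"

(* The values of \<Theta> on functions that are not linear maps are irrelevant. *)
definition supermap_linear ::
  "(('a0::finite op \<Rightarrow> 'a1::finite op) \<Rightarrow> ('b0::finite op \<Rightarrow> 'b1::finite op)) \<Rightarrow> bool" where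
  "supermap_linear \<Theta> \<longleftrightarrow>
     (\<forall>\<Phi>. op_linear \<Phi> \<longrightarrow> op_linear (\<Theta> \<Phi>)) \<and>
     (\<forall>\<Phi> \<Psi>. op_linear \<Phi> \<longrightarrow> op_linear \<Psi> \<longrightarrow>
        \<Theta> (\<lambda>X. \<Phi> X + \<Psi> X) = (\<lambda>X. \<Theta> \<Phi> X + \<Theta> \<Psi> X)) \<and>
     (\<forall>c \<Phi>. op_linear \<Phi> \<longrightarrow> \<Theta> (\<lambda>X. cscale c (\<Phi> X)) = (\<lambda>X. cscale c (\<Theta> \<Phi> X)))"

definition superchannel ::
  "(('a0::finite op \<Rightarrow> 'a1::finite op) \<Rightarrow> ('b0::finite op \<Rightarrow> 'b1::finite op)) \<Rightarrow> bool" where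
  "superchannel \<Theta> \<longleftrightarrow>
     supermap_linear \<Theta> \<and>
     (\<forall>m n N. family_completely_positive m n N \<longrightarrow>
        family_completely_positive m n (\<lambda>i j k l. \<Theta> (N i j k l))) \<and>
     (\<forall>\<Phi>. op_linear \<Phi> \<longrightarrow> trace_preserving \<Phi> \<longrightarrow> trace_preserving (\<Theta> \<Phi>))"

(* \<Theta> tensored with the identity on L^B, by the same expansion in a basis of L^B:
   X \<mapsto> <k| \<Omega> (X \<otimes> |i><j|) |l> is the coefficient of Y \<mapsto> Y_ij |k><l|. *)
definition component ::
  "(('a0::finite \<times> 'b0::finite) op \<Rightarrow> ('a1::finite \<times> 'b1::finite) op)
     \<Rightarrow> 'b0 \<Rightarrow> 'b0 \<Rightarrow> 'b1 \<Rightarrow> 'b1 \<Rightarrow> 'a0 op \<Rightarrow> 'a1 op" where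
  "component \<Omega> i j k l X = (\<chi> a a'. \<Omega> (X \<otimes> munit i j) $ (a, k) $ (a', l))"

definition super_tensor_id ::
  "(('a0::finite op \<Rightarrow> 'a1::finite op) \<Rightarrow> ('c0::finite op \<Rightarrow> 'c1::finite op))
     \<Rightarrow> (('a0 \<times> 'b0::finite) op \<Rightarrow> ('a1 \<times> 'b1::finite) op)
     \<Rightarrow> ('c0 \<times> 'b0) op \<Rightarrow> ('c1 \<times> 'b1) op" where
  "super_tensor_id \<Theta> \<Omega> Y =
     (\<chi> p q. (\<Sum>i\<in>UNIV. \<Sum>j\<in>UNIV.
        \<Theta> (component \<Omega> i j (snd p) (snd q)) (\<chi> c c'. Y $ (c, i) $ (c', j))) $ fst p $ fst q)"

section \<open>Entropies\<close>

(* Normalized Choi matrix, on (input, output). For a bipartite map the input type is 'a0 \<times> 'b0,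
   whose cardinality is the product of the dimensions and whose unnormalized maximally entangled
   operator is the tensor product of those of the two factors. *)
definition nchoi :: "('s::finite op \<Rightarrow> 't::finite op) \<Rightarrow> ('s \<times> 't) op" where
  "nchoi \<Phi> = cscale (1 / of_nat CARD('s))
     (\<Sum>i\<in>UNIV. \<Sum>j\<in>UNIV. munit i j \<otimes> \<Phi> (munit i j))"

(* H_min(Q|P) for an operator on (P, Q). On type real, LEAST is the minimum in the strict sense:
   it is unspecified unless the minimum is attained. *)
definition Hmin :: "('p::finite \<times> 'q::finite) op \<Rightarrow> real" where
  "Hmin \<rho> = - log 2 (LEAST t. \<exists>\<sigma> :: 'p op.
     hermitian \<sigma> \<and> \<rho> \<preceq> \<sigma> \<otimes> mat 1 \<and> t = Re (trace \<sigma>))"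

definition Hmin_ext1 :: "('b0::finite op \<Rightarrow> 'b1::finite op) \<Rightarrow> real" where
  "Hmin_ext1 \<Phi> = Hmin (nchoi \<Phi>)"

(* H_min^ext(B|A); \<gamma> is an operator on ((A0, A1), B0). *)
definition Hmin_ext ::
  "(('a0::finite \<times> 'b0::finite) op \<Rightarrow> ('a1::finite \<times> 'b1::finite) op) \<Rightarrow> real" where
  "Hmin_ext \<Omega> = - log 2 (LEAST t. \<exists>\<gamma> :: (('a0 \<times> 'a1) \<times> 'b0) op.
     hermitian \<gamma> \<and>
     reindex (\<lambda>(((a0, a1), b0), b1). ((a0, b0), (a1, b1))) (nchoi \<Omega>) \<preceq> \<gamma> \<otimes> mat 1 \<and>
     ptrace2 (reindex (\<lambda>((a0, b0), a1). ((a0, a1), b0)) \<gamma>) = max_mixed \<otimes> ptrace1 \<gamma> \<and>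
     t = Re (trace \<gamma>))"

end

theory Submission
  imports Defs
begin

text \<open>
  Both entropies are minus the logarithm of the value of a semidefinite program: minimise
  \<open>trace \<sigma>\<close> over \<open>\<sigma> \<in> V\<close> with \<open>\<rho> \<preceq> \<sigma> \<otimes> mat 1\<close>, where \<open>V\<close> is the space of all operators
  or that of operators with marginal \<open>u \<otimes> \<gamma>\<close>. All parts except superadditivity of the value come
  from positive maps that turn feasible points of one program into feasible points of
  another: partial traces for the upper bounds, tensoring with a state or with the identity
  for the lower ones, and, for a superchannel, its action on \<open>\<gamma>\<close> read as the Choi operator of
  a family of maps each of which multiplies the trace by a constant.
  For the remaining half of additivity, strong duality yields optimal dual variables. Dual
  feasibility means that the partial trace over \<open>B1\<close> is \<open>\<beta> \<otimes> mat 1\<close> with \<open>\<beta>\<close> having a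
  multiple of the identity as marginal, and this is stable under tensor products.
\<close>

section \<open>Entries and traces of operators\<close>

text \<open>\<open>LEAST\<close> on the reals carries information only when the minimum is attained,
  so inequalities between entropies need compactness of sublevel sets, while equalities can be had
  by matching the sets of objective values. The minimum must also be positive for its logarithm to
  be monotone and additive. No spectral theorem enters: Gram decompositions into rank-one terms
  supply the Schur product, the Kraus operators and the pairing of positive operators.
  Superadditivity calls for duality because a feasible point of the joint program need not be a
  tensor product. Superchannels are handled from their axioms, without a realisation by pre- and
  post-processing. The axioms control traces only on trace-preserving maps and positivity only on
  blocks indexed by natural numbers, whereas the slices of a feasible \<gamma> rescale the trace by
  a complex, possibly zero factor. The marginal constraint is exactly what makes such a factor
  exist. Quotients of dimensions arise because Choi operators are normalised by the input dimension,
  which changes whenever an input is replaced or closed with a state.\<close>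

lemma sum_UNIV_prod: "(\<Sum>p\<in>UNIV. f p) = (\<Sum>a\<in>UNIV. \<Sum>b\<in>UNIV. f (a, b))"
  for f :: "'a::finite \<times> 'b::finite \<Rightarrow> 'c::comm_monoid_add"
  by (simp add: UNIV_Times_UNIV[symmetric] sum.cartesian_product del: UNIV_Times_UNIV)

lemma kron_nth [simp]: "(M \<otimes> N) $ p $ q = M $ fst p $ fst q * N $ snd p $ snd q"
  by (simp add: kron_def)

lemma reindex_nth [simp]: "reindex f M $ i $ j = M $ f i $ f j"
  by (simp add: reindex_def)

lemma cscale_nth [simp]: "cscale c M $ i $ j = c * M $ i $ j"
  by (simp add: cscale_def)

lemma ptrace1_nth [simp]: "ptrace1 M $ k $ l = (\<Sum>i\<in>UNIV. M $ (i, k) $ (i, l))"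
  by (simp add: ptrace1_def)

lemma ptrace2_nth [simp]: "ptrace2 M $ i $ j = (\<Sum>k\<in>UNIV. M $ (i, k) $ (j, k))"
  by (simp add: ptrace2_def)

lemma munit_nth: "munit i j $ k $ l = of_bool (k = i \<and> l = j)"
  by (auto simp: munit_def axis_def)

lemma sum_munit: "(\<Sum>i\<in>UNIV. \<Sum>j\<in>UNIV. munit a b $ i $ j * f i j) = f a b"
proof -
  have "(\<Sum>i\<in>UNIV. \<Sum>j\<in>UNIV. munit a b $ i $ j * f i j)
      = (\<Sum>i\<in>UNIV. if i = a then (\<Sum>j\<in>UNIV. if j = b then f a b else 0) else 0)"
    by (intro sum.cong refl) (auto simp: munit_nth intro!: sum.cong sum.neutral)
  then show ?thesis by simp
qed

lemma sum_munit_flip: "(\<Sum>i\<in>UNIV. \<Sum>j\<in>UNIV. f i j * munit i j $ a $ b) = f a b"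
proof -
  have "f i j * munit i j $ a $ b = munit a b $ i $ j * f i j" for i j
    by (auto simp: munit_nth)
  then show ?thesis by (simp only: sum_munit)
qed

lemma mat_nth: "mat c $ i $ j = (if i = j then c else 0)"
  by (simp add: mat_def)

lemma op_eq_iff: "M = N \<longleftrightarrow> (\<forall>i j. M $ i $ j = N $ i $ j)" for M N :: "'s::finite op"
  by (auto simp: vec_eq_iff)

lemma trace_eq_sum: "trace M = (\<Sum>i\<in>UNIV. M $ i $ i)"
  by (simp add: trace_def)

lemma trace_mult_eq_sum: "trace (M ** N) = (\<Sum>i\<in>UNIV. \<Sum>j\<in>UNIV. M $ i $ j * N $ j $ i)"
  by (simp add: trace_def matrix_matrix_mult_def)

lemma trace_kron: "trace (M \<otimes> N) = trace M * trace N"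
  by (simp add: trace_eq_sum sum_UNIV_prod sum_product)

lemma trace_reindex: "bij f \<Longrightarrow> trace (reindex f M) = trace M"
  using sum.reindex_bij_betw[of f UNIV UNIV "\<lambda>i. M $ i $ i"] by (simp add: trace_eq_sum)

lemma trace_ptrace1: "trace (ptrace1 M) = trace M"
  by (simp add: trace_eq_sum sum_UNIV_prod) (rule sum.swap)

lemma trace_ptrace2: "trace (ptrace2 M) = trace M"
  by (simp add: trace_eq_sum sum_UNIV_prod)

lemma trace_cscale: "trace (cscale c M) = c * trace M"
  by (simp add: trace_eq_sum sum_distrib_left)

lemma trace_munit: "trace (munit i j) = of_bool (i = j)"
proof -
  have "trace (munit i j) = (\<Sum>k\<in>UNIV. if k = i then of_bool (i = j) else 0)"
    unfolding trace_eq_sum by (intro sum.cong) (auto simp: munit_nth)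
  then show ?thesis by simp
qed

lemma trace_mat: "trace (mat c :: 's::finite op) = of_nat CARD('s) * c"
  by (simp add: trace_eq_sum mat_nth)

section \<open>Positive semidefinite operators\<close>

lemma of_real_cmod_square: "(of_real (cmod z))\<^sup>2 = z * cnj z"
  by (simp flip: complex_norm_square)

lemma sesq_add_left: "sesq (u + v) M w = sesq u M w + sesq v M w"
  by (simp add: sesq_def algebra_simps sum.distrib)

lemma sesq_add_right: "sesq w M (u + v) = sesq w M u + sesq w M v"
  by (simp add: sesq_def algebra_simps sum.distrib)

lemma sesq_scale_left: "sesq (c *s u) M w = cnj c * sesq u M w"
  by (simp add: sesq_def algebra_simps sum_distrib_left)

lemma sesq_scale_right: "sesq w M (c *s u) = c * sesq w M u"
  by (simp add: sesq_def algebra_simps sum_distrib_left)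

lemma sesq_add: "sesq u (M + N) v = sesq u M v + sesq u N v"
  by (simp add: sesq_def algebra_simps sum.distrib)

lemma sesq_diff: "sesq u (M - N) v = sesq u M v - sesq u N v"
  by (simp add: sesq_def algebra_simps sum_subtractf)

lemma sesq_cscale: "sesq u (cscale c M) v = c * sesq u M v"
  by (simp add: sesq_def algebra_simps sum_distrib_left)

lemma sesq_sum: "sesq u (\<Sum>k\<in>K. M k) v = (\<Sum>k\<in>K. sesq u (M k) v)"
  by (induction K rule: infinite_finite_induct) (simp_all add: sesq_add, simp_all add: sesq_def)

lemma sesq_axis_left: "sesq (axis i x) M v = cnj x * (\<Sum>j\<in>UNIV. M $ i $ j * v $ j)"
proof -
  have "sesq (axis i x) M v
      = (\<Sum>k\<in>UNIV. if k = i then cnj x * (\<Sum>j\<in>UNIV. M $ i $ j * v $ j) else 0)"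
    unfolding sesq_def by (intro sum.cong refl) (auto simp: axis_def sum_distrib_left mult_ac)
  then show ?thesis by simp
qed

lemma sesq_axis: "sesq (axis i x) M (axis j y) = cnj x * M $ i $ j * y"
proof -
  have "(\<Sum>l\<in>UNIV. M $ i $ l * axis j y $ l) = (\<Sum>l\<in>UNIV. if l = j then M $ i $ j * y else 0)"
    by (intro sum.cong refl) (auto simp: axis_def)
  then show ?thesis by (simp add: sesq_axis_left)
qed

lemma psd_iff: "psd M \<longleftrightarrow> (\<forall>v. 0 \<le> Re (sesq v M v) \<and> Im (sesq v M v) = 0)"
  by (auto simp: psd_def less_eq_complex_def)

lemma psd_sesq_real: "psd M \<Longrightarrow> sesq v M v = of_real (Re (sesq v M v))"
  by (rule complex_eqI) (simp_all add: psd_iff)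

section \<open>The positive cone and maps that preserve it\<close>

lemma psd_0: "psd 0"
  by (simp add: psd_iff sesq_def)

lemma psd_add: "psd M \<Longrightarrow> psd N \<Longrightarrow> psd (M + N)"
  by (simp add: psd_iff sesq_add)

lemma psd_sum: "(\<And>k. k \<in> K \<Longrightarrow> psd (M k)) \<Longrightarrow> psd (\<Sum>k\<in>K. M k)"
  by (induction K rule: infinite_finite_induct) (auto intro: psd_add psd_0)

lemma psd_cscale: "0 \<le> c \<Longrightarrow> psd M \<Longrightarrow> psd (cscale (of_real c) M)"
  by (simp add: psd_iff sesq_cscale)

text \<open>\<open>f\<close> need not be injective: the form of the pulled-back operator at
  \<open>v\<close> is the form of \<open>M\<close> at the push-forward of \<open>v\<close>, whose
  coordinates are sums over the fibres of \<open>f\<close>. Slices, diagonal blocks and permutations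
  of tensor factors are thus covered by one positivity lemma.\<close>

lemma sesq_reindex:
  "sesq v (reindex f M) v = sesq (\<chi> p. \<Sum>i | f i = p. v $ i) M (\<chi> p. \<Sum>i | f i = p. v $ i)"
proof -
  have grp: "(\<Sum>p\<in>UNIV. (\<Sum>i | f i = p. G i p)) = (\<Sum>i\<in>UNIV. G i (f i))"
    for G :: "_ \<Rightarrow> _ \<Rightarrow> complex"
  proof -
    have "(\<Sum>i\<in>UNIV. G i (f i)) = (\<Sum>p\<in>UNIV. (\<Sum>i | i \<in> UNIV \<and> f i = p. G i (f i)))"
      by (rule sum.group[symmetric]) auto
    also have "\<dots> = (\<Sum>p\<in>UNIV. \<Sum>i | f i = p. G i p)"
      by (intro sum.cong) auto
    finally show ?thesis ..
  qed
  let ?w = "\<lambda>p. \<Sum>i | f i = p. v $ i"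
  have "(\<Sum>p\<in>UNIV. \<Sum>q\<in>UNIV. cnj (?w p) * M $ p $ q * ?w q)
     = (\<Sum>p\<in>UNIV. \<Sum>i | f i = p. \<Sum>q\<in>UNIV. \<Sum>j | f j = q. cnj (v $ i) * M $ p $ q * v $ j)"
  proof (rule sum.cong[OF refl])
    fix p
    have "(\<Sum>q\<in>UNIV. cnj (?w p) * M $ p $ q * ?w q)
        = (\<Sum>q\<in>UNIV. \<Sum>i | f i = p. \<Sum>j | f j = q. cnj (v $ i) * M $ p $ q * v $ j)"
      unfolding cnj_sum sum_distrib_right by (simp only: sum_distrib_left)
    also have "\<dots> = (\<Sum>i | f i = p. \<Sum>q\<in>UNIV. \<Sum>j | f j = q. cnj (v $ i) * M $ p $ q * v $ j)"
      by (rule sum.swap)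
    finally show "(\<Sum>q\<in>UNIV. cnj (?w p) * M $ p $ q * ?w q) = \<dots>" .
  qed
  also have "\<dots> = (\<Sum>i\<in>UNIV. \<Sum>j\<in>UNIV. cnj (v $ i) * M $ f i $ f j * v $ j)"
    by (simp add: grp)
  finally show ?thesis by (simp add: sesq_def)
qed

lemma psd_reindex: "psd M \<Longrightarrow> psd (reindex f M)"
  by (simp add: psd_iff sesq_reindex)

text \<open>The partial trace is the sum of the diagonal blocks, and each block is a
  reindexing.\<close>

lemma psd_ptrace1: "psd M \<Longrightarrow> psd (ptrace1 M)"
proof -
  assume "psd M"
  moreover have "ptrace1 M = (\<Sum>i\<in>UNIV. reindex (Pair i) M)"
    by (simp add: op_eq_iff)
  ultimately show ?thesis by (simp add: psd_sum psd_reindex)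
qed

lemma psd_diagonal_congruence:
  assumes "psd M"
  shows "psd (\<chi> i j. c i * M $ i $ j * cnj (c j))"
proof -
  have "sesq v (\<chi> i j. c i * M $ i $ j * cnj (c j)) v
      = sesq (\<chi> i. cnj (c i) * v $ i) M (\<chi> i. cnj (c i) * v $ i)" for v
    by (simp add: sesq_def mult_ac)
  with assms show ?thesis by (simp add: psd_def)
qed

text \<open>The form at \<open>v\<close> is the form of \<open>H\<close> at a vector that is
  constant along the second factor. This contracts two indices without setting them equal, as is
  needed when a state is fed into a channel.\<close>

lemma psd_block_sum:
  assumes "psd H"
  shows "psd (\<chi> i j. \<Sum>p\<in>UNIV. \<Sum>q\<in>UNIV. H $ (i, p) $ (j, q))"
proof -
  have "sesq v (\<chi> i j. \<Sum>p\<in>UNIV. \<Sum>q\<in>UNIV. H $ (i, p) $ (j, q)) v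
      = sesq (\<chi> p. v $ fst p) H (\<chi> p. v $ fst p)" for v
    by (simp add: sesq_def sum_UNIV_prod sum_distrib_left sum_distrib_right)
      (intro sum.cong refl, subst sum.swap, rule refl)
  with assms show ?thesis by (simp add: psd_def)
qed

section \<open>Hermiticity, Cauchy-Schwarz and bounds on entries\<close>

lemma psd_imp_hermitian: "psd M \<Longrightarrow> hermitian M"
  unfolding hermitian_def
proof (intro allI)
  fix i j assume M: "psd M"
  \<comment> \<open>Taking \<open>c\<close> to be 1 and then the imaginary unit separates the
    imaginary and real parts of the off-diagonal entries.\<close>
  have q: "Im (sesq (axis i 1 + axis j c) M (axis i 1 + axis j c)) = 0" for c
    using M by (simp add: psd_iff)
  have d: "Im (M $ k $ k) = 0" for k
    using M[unfolded psd_iff, rule_format, of "axis k 1"] by (simp add: sesq_axis)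
  show "M $ i $ j = cnj (M $ j $ i)"
    using q[of 1] q[of \<i>] by (simp add: sesq_add_left sesq_add_right sesq_axis complex_eq_iff d)
qed

lemma sesq_hermitian: "hermitian M \<Longrightarrow> sesq v M u = cnj (sesq u M v)"
proof -
  assume h: "hermitian M"
  have "sesq v M u = (\<Sum>i\<in>UNIV. \<Sum>j\<in>UNIV. cnj (v $ j) * M $ j $ i * u $ i)"
    unfolding sesq_def by (rule sum.swap)
  also have "\<dots> = (\<Sum>i\<in>UNIV. \<Sum>j\<in>UNIV. cnj (cnj (u $ i) * M $ i $ j * v $ j))"
    using h unfolding hermitian_def
    by (intro sum.cong refl) (metis (no_types, lifting) complex_cnj_cnj complex_cnj_mult mult.assoc mult.commute)
  finally show ?thesis by (simp add: sesq_def)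
qed

text \<open>The form is nonnegative along the vectors \<open>u - t * S * x\<close> with real t. The
  factor \<open>S\<close> makes both cross terms equal to \<open>- t * |S|^2\<close>, which leaves a
  real quadratic polynomial in t.\<close>

lemma psd_Cauchy_Schwarz:
  assumes "psd M"
  shows "(cmod (sesq x M u))\<^sup>2 \<le> Re (sesq x M x) * Re (sesq u M u)"
proof -
  define S where "S = sesq x M u"
  define Q where "Q v = Re (sesq v M v)" for v
  have Q: "sesq v M v = of_real (Q v)" "Q v \<ge> 0" for v
    using assms psd_sesq_real[OF assms, of v] by (simp_all add: psd_iff Q_def)
  have S': "sesq u M x = cnj S"
    unfolding S_def by (rule sesq_hermitian) (rule psd_imp_hermitian, fact)
  have key: "0 \<le> Q u - 2 * t * (cmod S)\<^sup>2 + t\<^sup>2 * (cmod S)\<^sup>2 * Q x" for t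
  proof -
    let ?l = "- (of_real t * S)"
    have "sesq (u + ?l *s x) M (u + ?l *s x)
        = of_real (Q u) + ?l * cnj S + cnj ?l * S + cnj ?l * ?l * of_real (Q x)"
      unfolding sesq_add_left sesq_add_right sesq_scale_left sesq_scale_right Q S' S_def[symmetric]
      by (simp add: algebra_simps)
    also have "\<dots> = of_real (Q u - 2 * t * (cmod S)\<^sup>2 + t\<^sup>2 * (cmod S)\<^sup>2 * Q x)"
      by (simp add: of_real_cmod_square) (simp add: power2_eq_square algebra_simps)
    finally show ?thesis using Q(2)[of "u + ?l *s x"] by (simp add: Q_def)
  qed
  show ?thesis
  proof (cases "Q x = 0")
    case False
    with key[of "1 / Q x"] Q(2)[of x] show ?thesis
      by (simp add: field_simps power2_eq_square flip: Q_def S_def)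
  next
    case True
    have "cmod S = 0"
    proof (rule ccontr)
      assume "cmod S \<noteq> 0"
      \<comment> \<open>With \<open>Q x = 0\<close> the polynomial is affine in t, and this value of
        t makes it equal to -1.\<close>
      then show False
        using key[of "(Q u + 1) / (2 * (cmod S)\<^sup>2)"] True by (simp add: field_simps)
    qed
    with True show ?thesis by (simp flip: Q_def S_def)
  qed
qed

lemma psd_diag_nonneg: "psd M \<Longrightarrow> 0 \<le> Re (M $ i $ i)"
  using psd_iff[of M] by (auto simp: sesq_axis dest: spec[of _ "axis i 1"])

lemma psd_diag_real: "psd M \<Longrightarrow> M $ i $ i = of_real (Re (M $ i $ i))"
  using psd_sesq_real[of M "axis i 1"] by (simp add: sesq_axis)

lemma psd_entry_bound:
  assumes "psd M" shows "(cmod (M $ i $ j))\<^sup>2 \<le> Re (M $ i $ i) * Re (M $ j $ j)"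
  using psd_Cauchy_Schwarz[OF assms, of "axis i 1" "axis j 1"] by (simp add: sesq_axis)

lemma psd_trace_nonneg: "psd M \<Longrightarrow> 0 \<le> Re (trace M)"
  by (simp add: trace_eq_sum sum_nonneg psd_diag_nonneg)

text \<open>The minors of size two bound an entry by diagonal entries, each of which is at most the
  trace. Sublevel sets of the trace are therefore bounded, and a positive operator of trace zero
  vanishes.\<close>

lemma psd_entry_le_trace:
  assumes "psd M" shows "cmod (M $ i $ j) \<le> Re (trace M)"
proof -
  have d: "Re (M $ k $ k) \<le> Re (trace M)" for k
    unfolding trace_eq_sum Re_sum
    by (rule member_le_sum) (auto simp: psd_diag_nonneg assms)
  have "(cmod (M $ i $ j))\<^sup>2 \<le> Re (M $ i $ i) * Re (M $ j $ j)"
    by (rule psd_entry_bound) fact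
  also have "\<dots> \<le> Re (trace M) * Re (trace M)"
    using d assms by (intro mult_mono) (auto simp: psd_diag_nonneg psd_trace_nonneg)
  finally show ?thesis
    using psd_trace_nonneg[OF assms] by (simp add: power2_le_iff_abs_le flip: power2_eq_square)
qed

text \<open>Cholesky elimination: subtracting the outer product of column \<open>x\<close>, divided by
  the pivot, clears row and column \<open>x\<close> and keeps positivity by Cauchy-Schwarz.\<close>

lemma psd_gram:
  assumes "psd M"
  shows "\<exists>(n::nat) w. \<forall>i j. M $ i $ j = (\<Sum>k<n. w k $ i * cnj (w k $ j))"
proof -
  \<comment> \<open>The induction runs over a set \<open>S\<close> outside which the diagonal of
    \<open>M\<close> vanishes; clearing one pivot removes one element.\<close>
  have "finite S \<Longrightarrow> psd M \<Longrightarrow> \<forall>i. i \<notin> S \<longrightarrow> M $ i $ i = 0 \<Longrightarrow>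
      \<exists>(n::nat) w. \<forall>i j. M $ i $ j = (\<Sum>k<n. w k $ i * cnj (w k $ j))" for S
  proof (induction S arbitrary: M rule: finite_induct)
    case empty
    then have "M $ i $ j = 0" for i j
      using psd_entry_bound[of M i j] by simp
    then show ?case by (intro exI[of _ 0]) simp
  next
    case (insert x S)
    show ?case
    proof (cases "M $ x $ x = 0")
      case True
      then have "\<forall>i. i \<notin> S \<longrightarrow> M $ i $ i = 0"
        using insert.prems(2) by (metis insert_iff)
      then show ?thesis by (rule insert.IH[OF insert.prems(1)])
    next
      case False
      define c where "c = Re (M $ x $ x)"
      have c: "M $ x $ x = of_real c" "c > 0"
        using psd_diag_real[OF insert.prems(1), of x] psd_diag_nonneg[OF insert.prems(1), of x] False
        unfolding c_def by (auto simp: order.order_iff_strict)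
      define w :: "complex^'a" where "w = (\<chi> i. M $ i $ x / of_real (sqrt c))"
      have herm: "M $ i $ j = cnj (M $ j $ i)" for i j
        using psd_imp_hermitian[OF insert.prems(1)] unfolding hermitian_def by blast
      have w: "w $ i * cnj (w $ j) = M $ i $ x * M $ x $ j / of_real c" for i j
        using c(2) herm[of x j] by (simp add: w_def flip: of_real_mult)
      define N where "N = (\<chi> i j. M $ i $ j - w $ i * cnj (w $ j))"
      have "psd N"
      proof -
        have "sesq v N v = of_real (Re (sesq v M v) - (cmod (sesq (axis x 1) M v))\<^sup>2 / c)" for v
        proof -
          define s where "s = sesq (axis x 1) M v"
          have s': "(\<Sum>i\<in>UNIV. cnj (v $ i) * M $ i $ x) = cnj s"
            using herm[of _ x] by (simp add: s_def sesq_axis_left mult.commute)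
          have "sesq v N v = sesq v M v - (\<Sum>i\<in>UNIV. \<Sum>j\<in>UNIV.
                (cnj (v $ i) * M $ i $ x) * (M $ x $ j * v $ j)) / of_real c"
            by (simp add: sesq_def N_def w algebra_simps sum_subtractf sum_divide_distrib)
          also have "\<dots> = sesq v M v - cnj s * s / of_real c"
            by (simp add: s' flip: sum_product) (simp add: s_def sesq_axis_left)
          also have "sesq v M v = of_real (Re (sesq v M v))"
            by (rule psd_sesq_real) fact
          finally show ?thesis
            by (simp add: of_real_cmod_square mult.commute flip: s_def)
        qed
        moreover have "(cmod (sesq (axis x 1) M v))\<^sup>2 \<le> c * Re (sesq v M v)" for v
          using psd_Cauchy_Schwarz[OF insert.prems(1), of "axis x 1" v]
          by (simp add: sesq_axis c_def)
        ultimately show ?thesis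
          using c(2) unfolding psd_iff by (simp only: Re_complex_of_real Im_complex_of_real) (simp add: field_simps)
      qed
      moreover have "\<forall>i. i \<notin> S \<longrightarrow> N $ i $ i = 0"
      proof (intro allI impI)
        fix i assume "i \<notin> S"
        show "N $ i $ i = 0"
        proof (cases "i = x")
          case True
          then show ?thesis using c by (simp add: N_def w)
        next
          case False
          with \<open>i \<notin> S\<close> have "M $ i $ i = 0" using insert.prems(2) by simp
          moreover from this have "M $ i $ x = 0"
            using psd_entry_bound[OF insert.prems(1), of i x] by simp
          ultimately show ?thesis by (simp add: N_def w)
        qed
      qed
      ultimately obtain n :: nat and u
        where u: "\<And>i j. N $ i $ j = (\<Sum>k<n. u k $ i * cnj (u k $ j))"
        using insert.IH by blast
      have "M $ i $ j = (\<Sum>k<Suc n. (u(n := w)) k $ i * cnj ((u(n := w)) k $ j))" for i j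
        using u[of i j] by (simp add: N_def) (simp add: diff_eq_eq)
      then show ?thesis by blast
    qed
  qed
  from this[of UNIV] assms show ?thesis by simp
qed

text \<open>Schur product theorem: each rank-one term of \<open>N\<close> acts on a reindexing of
  \<open>M\<close> as a diagonal congruence. Separate maps \<open>f\<close> and \<open>g\<close>
  also cover a factor that touches only some of the tensor legs.\<close>

lemma psd_hadamard_reindex:
  assumes "psd M" "psd N"
  shows "psd (\<chi> i j. M $ f i $ f j * N $ g i $ g j)"
proof -
  obtain n :: nat and w where w: "\<And>i j. N $ i $ j = (\<Sum>k<n. w k $ i * cnj (w k $ j))"
    using psd_gram[OF assms(2)] by blast
  have "(\<chi> i j. M $ f i $ f j * N $ g i $ g j)
      = (\<Sum>k<n. \<chi> i j. w k $ g i * reindex f M $ i $ j * cnj (w k $ g j))"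
    by (simp add: op_eq_iff w sum_distrib_left mult_ac)
  then show ?thesis
    by (simp only:) (intro psd_sum psd_diagonal_congruence psd_reindex assms(1))
qed

lemma psd_kron: "psd M \<Longrightarrow> psd N \<Longrightarrow> psd (M \<otimes> N)"
  unfolding kron_def by (rule psd_hadamard_reindex)

text \<open>A Gram decomposition of \<open>N\<close> turns the trace into a sum of values of the
  form of \<open>M\<close>. Weak duality rests on this pairing.\<close>

lemma trace_mult_psd_nonneg:
  assumes "psd M" "psd N"
  shows "0 \<le> Re (trace (M ** N))" "Im (trace (M ** N)) = 0"
proof -
  obtain n :: nat and w where w: "\<And>i j. N $ i $ j = (\<Sum>k<n. w k $ i * cnj (w k $ j))"
    using psd_gram[OF assms(2)] by blast
  have "trace (M ** N)
      = (\<Sum>i\<in>UNIV. \<Sum>k<n. \<Sum>j\<in>UNIV. cnj (w k $ i) * M $ i $ j * w k $ j)"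
    unfolding trace_mult_eq_sum w sum_distrib_left
    by (rule sum.cong[OF refl], subst sum.swap) (simp add: mult_ac)
  also have "\<dots> = (\<Sum>k<n. sesq (w k) M (w k))"
    unfolding sesq_def by (rule sum.swap)
  finally have "trace (M ** N) = (\<Sum>k<n. sesq (w k) M (w k))" .
  with assms(1) show "0 \<le> Re (trace (M ** N))" "Im (trace (M ** N)) = 0"
    by (simp_all add: psd_iff sum_nonneg)
qed

lemma psd_mat: "0 \<le> c \<Longrightarrow> psd (mat (of_real c))"
proof -
  assume "0 \<le> c"
  have "sesq v (mat (of_real c)) v = of_real (\<Sum>i\<in>UNIV. c * (cmod (v $ i))\<^sup>2)" for v :: "complex^'a"
    by (simp add: sesq_def mat_nth if_distrib if_distribR of_real_cmod_square mult_ac cong: if_cong)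
  with \<open>0 \<le> c\<close> show ?thesis by (simp add: psd_iff sum_nonneg)
qed

section \<open>A family of semidefinite programs\<close>

definition adj :: "'s::finite op \<Rightarrow> 's op" where
  "adj M = (\<chi> i j. cnj (M $ j $ i))"

lemma adj_nth [simp]: "adj M $ i $ j = cnj (M $ j $ i)"
  by (simp add: adj_def)

text \<open>These are operator systems. Closure under \<open>adj\<close> keeps Hermitian parts
  inside \<open>V\<close>, and the identity provides feasible points.\<close>

definition op_space :: "'s::finite op set \<Rightarrow> bool" where
  "op_space V \<longleftrightarrow> mat 1 \<in> V \<and> (\<forall>M\<in>V. adj M \<in> V \<and> (\<forall>c. cscale c M \<in> V) \<and> (\<forall>N\<in>V. M + N \<in> V))"

definition feasible :: "'p::finite op set \<Rightarrow> ('p \<times> 'q::finite) op \<Rightarrow> 'p op set" where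
  "feasible V \<rho> = {\<sigma> \<in> V. hermitian \<sigma> \<and> \<rho> \<preceq> \<sigma> \<otimes> mat 1}"

definition minval :: "'p::finite op set \<Rightarrow> ('p \<times> 'q::finite) op \<Rightarrow> real" where
  "minval V \<rho> = (LEAST t. \<exists>\<sigma>\<in>feasible V \<rho>. t = Re (trace \<sigma>))"

lemma scaleR_eq_cscale: "r *\<^sub>R M = cscale (of_real r) M"
  unfolding op_eq_iff vector_scaleR_component cscale_nth by (simp add: scaleR_conv_of_real[where 'a = complex])

lemma op_space_subspace: "op_space V \<Longrightarrow> subspace V" for V :: "'s::finite op set"
proof (rule subspaceI)
  assume V: "op_space V"
  have "cscale 0 (mat 1 :: 's op) \<in> V" using V by (auto simp: op_space_def)
  moreover have "cscale 0 (mat 1 :: 's op) = 0" by (simp add: op_eq_iff)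
  ultimately show "0 \<in> V" by simp
qed (auto simp: op_space_def scaleR_eq_cscale)

lemma kron_add_left: "(M + N) \<otimes> K = M \<otimes> K + N \<otimes> K"
  by (simp add: op_eq_iff algebra_simps)

lemma kron_cscale_left: "cscale c M \<otimes> K = cscale c (M \<otimes> K)"
  by (simp add: op_eq_iff algebra_simps)

lemma reindex_slice: "reindex (\<lambda>p. (p, q)) (\<sigma> \<otimes> mat 1) = \<sigma>"
  by (simp add: op_eq_iff mat_nth)

text \<open>\<open>\<sigma> \<otimes> mat 1\<close> dominates the positive \<rho>, and each of its
  diagonal blocks over the second factor is \<sigma> itself; the block at \<open>undefined\<close>
  is taken.\<close>

lemma psd_of_kron_mat_1:
  fixes \<rho> :: "('p::finite \<times> 'q::finite) op"
  assumes "psd \<rho>" "psd (\<sigma> \<otimes> mat 1 - \<rho>)"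
  shows "psd \<sigma>"
proof -
  have "psd ((\<sigma> \<otimes> (mat 1 :: 'q op) - \<rho>) + \<rho>)"
    using assms by (intro psd_add)
  then have "psd (reindex (\<lambda>p. (p, undefined)) (\<sigma> \<otimes> (mat 1 :: 'q op)))"
    by (intro psd_reindex) simp
  then show ?thesis by (simp add: reindex_slice)
qed

lemma feasible_psd:
  fixes \<rho> :: "('p::finite \<times> 'q::finite) op"
  assumes "psd \<rho>" "\<sigma> \<in> feasible V \<rho>"
  shows "psd \<sigma>"
  using assms psd_of_kron_mat_1[of \<rho> \<sigma>] by (simp add: feasible_def loewner_le_def)

text \<open>This is the trace of the constraint. It keeps the optimal value away from zero, so that
  its logarithm is meaningful.\<close>

lemma feasible_trace:
  fixes \<rho> :: "('p::finite \<times> 'q::finite) op"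
  assumes "\<sigma> \<in> feasible V \<rho>"
  shows "Re (trace \<rho>) \<le> real CARD('q) * Re (trace \<sigma>)"
proof -
  have "0 \<le> Re (trace (\<sigma> \<otimes> (mat 1 :: 'q op) - \<rho>))"
    using assms by (intro psd_trace_nonneg) (simp add: feasible_def loewner_le_def)
  then show ?thesis by (simp add: trace_sub trace_kron trace_mat mult.commute)
qed

text \<open>By Cauchy-Schwarz the rank-one operator of a Gram vector is at most its squared norm
  times the identity, and the squared norms add up to the trace. Since multiples of the identity lie
  in every \<open>op_space\<close>, one feasible point serves all programs.\<close>

lemma psd_le_trace:
  assumes "psd M"
  shows "M \<preceq> mat (trace M)"
proof -
  obtain n :: nat and w where w: "\<And>i j. M $ i $ j = (\<Sum>k<n. w k $ i * cnj (w k $ j))"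
    using psd_gram[OF assms] by blast
  define T where "T = (\<Sum>k<n. \<Sum>i\<in>UNIV. (cmod (w k $ i))\<^sup>2)"
  have tr: "trace M = of_real T"
    unfolding T_def trace_eq_sum w by (subst sum.swap) (simp add: of_real_cmod_square)
  have "psd (mat (trace M) - M)" unfolding psd_iff
  proof
    fix v :: "complex^'a"
    let ?V = "\<Sum>i\<in>UNIV. (cmod (v $ i))\<^sup>2"
    have q: "sesq v M v = of_real (Re (sesq v M v))" by (rule psd_sesq_real) fact
    have "sesq v M v = (\<Sum>i\<in>UNIV. \<Sum>k<n. \<Sum>j\<in>UNIV. (cnj (v $ i) * w k $ i) * (cnj (w k $ j) * v $ j))"
      unfolding sesq_def w sum_distrib_left sum_distrib_right
      by (rule sum.cong[OF refl], subst sum.swap) (simp add: mult_ac)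
    also have "\<dots> = (\<Sum>k<n. (\<Sum>i\<in>UNIV. cnj (v $ i) * w k $ i) * (\<Sum>j\<in>UNIV. cnj (w k $ j) * v $ j))"
      unfolding sum_product by (rule sum.swap)
    also have "\<dots> = (\<Sum>k<n. of_real ((cmod (\<Sum>i\<in>UNIV. cnj (v $ i) * w k $ i))\<^sup>2))"
      by (simp add: complex_norm_square mult.commute del: of_real_power)
    finally have "Re (sesq v M v) = (\<Sum>k<n. (cmod (\<Sum>i\<in>UNIV. cnj (v $ i) * w k $ i))\<^sup>2)"
      by (simp del: of_real_power)
    also have "\<dots> \<le> (\<Sum>k<n. (\<Sum>i\<in>UNIV. (cmod (w k $ i))\<^sup>2) * ?V)"
    proof (rule sum_mono)
      fix k
      have "(cmod (\<Sum>i\<in>UNIV. cnj (v $ i) * w k $ i))\<^sup>2 \<le> (\<Sum>i\<in>UNIV. cmod (v $ i) * cmod (w k $ i))\<^sup>2"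
        by (intro power_mono sum_norm_le) (auto simp: norm_mult)
      also have "\<dots> \<le> ?V * (\<Sum>i\<in>UNIV. (cmod (w k $ i))\<^sup>2)"
        by (rule Cauchy_Schwarz_ineq_sum)
      finally show "(cmod (\<Sum>i\<in>UNIV. cnj (v $ i) * w k $ i))\<^sup>2 \<le> (\<Sum>i\<in>UNIV. (cmod (w k $ i))\<^sup>2) * ?V"
        by (simp add: mult.commute)
    qed
    also have "\<dots> = Re (trace M) * ?V" unfolding tr by (simp add: T_def sum_distrib_right)
    finally have le: "Re (sesq v M v) \<le> Re (trace M) * ?V" .
    have "sesq v (mat (trace M)) v = of_real (Re (trace M) * ?V)"
    proof -
      have "sesq v (mat (trace M)) v = (\<Sum>i\<in>UNIV. trace M * (v $ i * cnj (v $ i)))"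
        by (simp add: sesq_def mat_nth if_distrib if_distribR mult_ac cong: if_cong)
      also have "\<dots> = of_real (Re (trace M) * ?V)"
        unfolding tr by (simp add: of_real_cmod_square sum_distrib_left)
      finally show ?thesis .
    qed
    with q le show "0 \<le> Re (sesq v (mat (trace M) - M) v) \<and> Im (sesq v (mat (trace M) - M) v) = 0"
      by (metis (no_types, lifting) Im_complex_of_real Re_complex_of_real diff_ge_0_iff_ge
          minus_complex.sel(1) minus_complex.sel(2) diff_self sesq_diff)
  qed
  then show ?thesis by (simp add: loewner_le_def)
qed

lemma op_space_mat: "op_space V \<Longrightarrow> mat c \<in> V" for V :: "'s::finite op set"
proof -
  assume "op_space V"
  then have "cscale c (mat 1 :: 's op) \<in> V" by (auto simp: op_space_def)
  moreover have "cscale c (mat 1 :: 's op) = mat c" by (simp add: op_eq_iff mat_nth)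
  ultimately show ?thesis by simp
qed

lemma kron_mat_1: "mat c \<otimes> mat 1 = mat c"
  by (auto simp: op_eq_iff mat_nth prod_eq_iff)

lemma feasible_nonempty:
  assumes "psd \<rho>" "op_space V"
  shows "mat (trace \<rho>) \<in> feasible V \<rho>"
proof -
  have "Im (trace \<rho>) = 0"
    by (simp add: trace_eq_sum, subst psd_diag_real[OF assms(1)]) simp
  then have "hermitian (mat (trace \<rho>))"
    by (simp add: hermitian_def mat_nth complex_eq_iff)
  with psd_le_trace[OF assms(1)] show ?thesis
    by (simp add: feasible_def op_space_mat[OF assms(2)] kron_mat_1)
qed

lemma norm_op_le_sum: "norm M \<le> (\<Sum>i\<in>UNIV. \<Sum>j\<in>UNIV. cmod (M $ i $ j))"
proof -
  have "norm M \<le> (\<Sum>i\<in>UNIV. norm (M $ i))"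
    unfolding norm_vec_def[of M] by (rule L2_set_le_sum) simp
  also have "\<dots> \<le> (\<Sum>i\<in>UNIV. \<Sum>j\<in>UNIV. cmod (M $ i $ j))"
    by (intro sum_mono, subst norm_vec_def, rule L2_set_le_sum) simp
  finally show ?thesis .
qed

lemma closed_feasible:
  assumes "op_space V"
  shows "closed (feasible V \<rho>)"
proof -
  have "closed {\<sigma>. hermitian \<sigma>}"
    unfolding hermitian_def by (intro closed_Collect_all closed_Collect_eq continuous_intros)
  moreover have "closed {\<sigma>. \<rho> \<preceq> \<sigma> \<otimes> mat 1}"
    unfolding loewner_le_def psd_iff sesq_def vector_minus_component kron_nth
    by (intro closed_Collect_all closed_Collect_conj closed_Collect_eq closed_Collect_le continuous_intros)
  moreover have "feasible V \<rho> = V \<inter> {\<sigma>. hermitian \<sigma>} \<inter> {\<sigma>. \<rho> \<preceq> \<sigma> \<otimes> mat 1}"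
    by (auto simp: feasible_def)
  ultimately show ?thesis
    using closed_subspace[OF op_space_subspace[OF assms]] by (simp only:) (intro closed_Int)
qed

text \<open>Feasible points are positive, so a bound on the trace bounds all entries. The sublevel
  set of a known feasible point is therefore compact, and the continuous objective attains its
  minimum there.\<close>

lemma minval_attained:
  fixes \<rho> :: "('p::finite \<times> 'q::finite) op"
  assumes "psd \<rho>" "0 < Re (trace \<rho>)" "op_space V"
  obtains \<sigma> where "\<sigma> \<in> feasible V \<rho>" "Re (trace \<sigma>) = minval V \<rho>"
    "\<And>\<tau>. \<tau> \<in> feasible V \<rho> \<Longrightarrow> minval V \<rho> \<le> Re (trace \<tau>)" "0 < minval V \<rho>"
proof -
  define \<sigma>0 where "\<sigma>0 = (mat (trace \<rho>) :: 'p op)"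
  define T where "T = Re (trace \<sigma>0)"
  define F where "F = feasible V \<rho> \<inter> {\<sigma>. Re (trace \<sigma>) \<le> T}"
  have "\<sigma>0 \<in> F"
    using feasible_nonempty[OF assms(1,3)] by (simp add: F_def T_def \<sigma>0_def)
  have "closed F" unfolding F_def trace_def
    by (intro closed_Int closed_feasible assms closed_Collect_le continuous_intros)
  moreover have "bounded F"
  proof (rule boundedI)
    fix \<sigma> assume "\<sigma> \<in> F"
    then have "psd \<sigma>" "Re (trace \<sigma>) \<le> T"
      using feasible_psd[OF assms(1)] by (auto simp: F_def)
    then have "cmod (\<sigma> $ i $ j) \<le> T" for i j
      using psd_entry_le_trace[of \<sigma> i j] by simp
    then have "(\<Sum>i\<in>UNIV. \<Sum>j\<in>UNIV. cmod (\<sigma> $ i $ j)) \<le> (\<Sum>i\<in>(UNIV::'p set). \<Sum>j\<in>(UNIV::'p set). T)"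
      by (intro sum_mono)
    with norm_op_le_sum[of \<sigma>] show "norm \<sigma> \<le> (\<Sum>i\<in>(UNIV::'p set). \<Sum>j\<in>(UNIV::'p set). T)"
      by linarith
  qed
  ultimately have "compact F" by (simp add: compact_eq_bounded_closed)
  moreover have "continuous_on F (\<lambda>\<sigma>. Re (trace \<sigma>))"
    unfolding trace_def by (intro continuous_intros)
  ultimately obtain \<sigma> where \<sigma>: "\<sigma> \<in> F" "\<And>\<tau>. \<tau> \<in> F \<Longrightarrow> Re (trace \<sigma>) \<le> Re (trace \<tau>)"
    using continuous_attains_inf[of F "\<lambda>\<sigma>. Re (trace \<sigma>)"] \<open>\<sigma>0 \<in> F\<close> by blast
  have min: "Re (trace \<sigma>) \<le> Re (trace \<tau>)" if "\<tau> \<in> feasible V \<rho>" for \<tau>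
    using \<sigma> that by (cases "Re (trace \<tau>) \<le> T") (auto simp: F_def)
  have f: "\<sigma> \<in> feasible V \<rho>" using \<sigma> by (simp add: F_def)
  have "minval V \<rho> = Re (trace \<sigma>)"
    unfolding minval_def using f min by (intro Least_equality) auto
  moreover have "0 < Re (trace \<sigma>)"
    using feasible_trace[OF f] assms(2)
    by (smt (verit) of_nat_0_le_iff mult_nonneg_nonpos)
  ultimately show ?thesis using that[of \<sigma>] f min by simp
qed

section \<open>Strong duality\<close>

lemma inner_op: "A \<bullet> B = Re (\<Sum>i\<in>UNIV. \<Sum>j\<in>UNIV. cnj (A $ i $ j) * B $ i $ j)"
  for A B :: "'s::finite op"
  by (simp add: inner_vec_def inner_complex_def)

lemma inner_op_trace: "A \<bullet> B = Re (trace (adj A ** B))" for A B :: "'s::finite op"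
  unfolding inner_op trace_mult_eq_sum adj_nth by (subst sum.swap) (rule refl)

lemma inner_outer: "A \<bullet> (\<chi> i j. c * v $ i * cnj (v $ j)) = Re (c * sesq v (adj A) v)"
proof -
  have "(\<Sum>i\<in>UNIV. \<Sum>j\<in>UNIV. cnj (A $ i $ j) * (c * v $ i * cnj (v $ j))) = c * sesq v (adj A) v"
    unfolding sesq_def by (subst sum.swap) (simp add: sum_distrib_left mult_ac)
  then show ?thesis by (simp add: inner_op)
qed

lemma sesq_outer: "sesq u (\<chi> i j. c * v $ i * cnj (v $ j)) u
    = c * of_real ((cmod (\<Sum>i\<in>UNIV. cnj (u $ i) * v $ i))\<^sup>2)"
proof -
  have "sesq u (\<chi> i j. c * v $ i * cnj (v $ j)) u
     = c * ((\<Sum>i\<in>UNIV. cnj (u $ i) * v $ i) * (\<Sum>j\<in>UNIV. cnj (v $ j) * u $ j))"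
    by (simp add: sesq_def sum_product sum_distrib_left mult_ac)
  also have "(\<Sum>j\<in>UNIV. cnj (v $ j) * u $ j) = cnj (\<Sum>i\<in>UNIV. cnj (u $ i) * v $ i)"
    by (simp add: mult.commute)
  finally show ?thesis by (simp add: complex_norm_square del: of_real_power)
qed

lemma linear_bounded_above_zero:
  fixes x b s :: real
  assumes "\<And>r. s + r * x \<le> b"
  shows "x = 0"
proof (rule ccontr)
  assume "x \<noteq> 0"
  then show False using assms[of "(b - s + 1) / x"] by simp
qed

lemma linear_bounded_above_nonneg:
  fixes x b s :: real
  assumes "\<And>r. 0 \<le> r \<Longrightarrow> s - r * x \<le> b"
  shows "0 \<le> x"
proof (rule ccontr)
  assume "\<not> 0 \<le> x"
  then have "(\<bar>b - s\<bar> + 1) / (- x) * x = - (\<bar>b - s\<bar> + 1)" by (simp add: field_simps)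
  then show False using assms[of "(\<bar>b - s\<bar> + 1) / (- x)"] \<open>\<not> 0 \<le> x\<close>
    by (smt (verit) divide_nonneg_nonneg)
qed

text \<open>The dual solution is the normal of a hyperplane separating \<open>\<rho>\<close> from the convex set of
  operators whose Hermitian part is dominated by some \<open>\<sigma> \<otimes> mat 1\<close> with \<open>\<sigma> \<in> V\<close> of smaller
  trace. Passing to Hermitian parts makes the normal automatically Hermitian.\<close>

lemma strong_duality:
  fixes \<rho> :: "('p::finite \<times> 'q::finite) op"
  assumes "hermitian \<rho>" "op_space V" and t: "\<And>\<sigma>. \<sigma> \<in> feasible V \<rho> \<Longrightarrow> t \<le> Re (trace \<sigma>)"
  obtains \<alpha> where "psd \<alpha>" "\<And>\<sigma>. \<sigma> \<in> V \<Longrightarrow> trace (\<alpha> ** (\<sigma> \<otimes> mat 1)) = trace \<sigma>"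
    "t \<le> Re (trace (\<alpha> ** \<rho>))"
proof -
  have V: "mat c \<in> V" "M \<in> V \<Longrightarrow> adj M \<in> V" "M \<in> V \<Longrightarrow> cscale c M \<in> V"
    "M \<in> V \<Longrightarrow> N \<in> V \<Longrightarrow> M + N \<in> V" for c M N
    using assms(2) op_space_mat[OF assms(2)] by (auto simp: op_space_def)
  define C where "C = {X. \<exists>\<sigma>\<in>V. Re (trace \<sigma>) < t \<and>
    (\<forall>v. Re (sesq v X v) \<le> Re (sesq v (\<sigma> \<otimes> (mat 1 :: 'q op)) v))}"
  have CI: "X \<in> C" if "\<sigma> \<in> V" "Re (trace \<sigma>) < t"
    "\<And>v. Re (sesq v X v) \<le> Re (sesq v (\<sigma> \<otimes> (mat 1 :: 'q op)) v)" for X \<sigma>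
    using that by (auto simp: C_def)
  define n where "n = real CARD('p)"
  have "n > 0" by (simp add: n_def)
  have "convex C"
  proof (rule convexI)
    fix X Y and u v :: real
    assume "X \<in> C" "Y \<in> C" and uv: "0 \<le> u" "0 \<le> v" "u + v = 1"
    then obtain \<sigma> \<tau> where \<sigma>: "\<sigma> \<in> V" "Re (trace \<sigma>) < t"
        "\<And>w. Re (sesq w X w) \<le> Re (sesq w (\<sigma> \<otimes> (mat 1 :: 'q op)) w)"
      and \<tau>: "\<tau> \<in> V" "Re (trace \<tau>) < t"
        "\<And>w. Re (sesq w Y w) \<le> Re (sesq w (\<tau> \<otimes> (mat 1 :: 'q op)) w)"
      unfolding C_def by blast
    have "u * Re (trace \<sigma>) + v * Re (trace \<tau>) < t"
      using uv \<sigma>(2) \<tau>(2) by (intro convex_bound_lt)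
    then show "u *\<^sub>R X + v *\<^sub>R Y \<in> C"
      unfolding scaleR_eq_cscale using uv \<sigma> \<tau>
      by (intro CI[of "cscale (of_real u) \<sigma> + cscale (of_real v) \<tau>"])
        (auto simp: V trace_add trace_cscale kron_add_left kron_cscale_left sesq_add sesq_cscale
          intro!: add_mono mult_left_mono)
  qed
  moreover have matC: "mat (of_real r) \<otimes> mat 1 \<in> C" if "n * r < t" for r
    using that by (intro CI[of "mat (of_real r)"]) (auto simp: V trace_mat n_def)
  have "mat (of_real ((t - 1) / n)) \<otimes> mat 1 \<in> C"
    using \<open>n > 0\<close> by (intro matC) simp
  then have "C \<noteq> {}" by blast
  moreover have "\<rho> \<notin> C"
  proof
    assume "\<rho> \<in> C"
    then obtain \<sigma> where \<sigma>: "\<sigma> \<in> V" "Re (trace \<sigma>) < t"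
        "\<And>w. Re (sesq w \<rho> w) \<le> Re (sesq w (\<sigma> \<otimes> (mat 1 :: 'q op)) w)"
      unfolding C_def by blast
    \<comment> \<open>The Hermitian part of \<sigma> stays in \<open>V\<close> and keeps the real
      parts of form and trace, so it would be feasible with trace below \<open>t\<close>.\<close>
    define \<tau> where "\<tau> = cscale (1/2) (\<sigma> + adj \<sigma>)"
    have real_part: "sesq w (\<tau> \<otimes> mat 1) w = of_real (Re (sesq w (\<sigma> \<otimes> mat 1) w))"
      for w :: "complex^('p \<times> 'q)"
    proof -
      have "sesq w (adj \<sigma> \<otimes> mat 1) w = cnj (sesq w (\<sigma> \<otimes> mat 1) w)"
        unfolding sesq_def by (subst sum.swap) (auto simp: mat_nth mult_ac intro!: sum.cong)
      then show ?thesis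
        by (simp add: \<tau>_def kron_cscale_left kron_add_left sesq_cscale sesq_add complex_eq_iff)
    qed
    have "hermitian \<tau>" by (simp add: hermitian_def \<tau>_def)
    moreover have "\<tau> \<in> V" using \<sigma>(1) by (simp add: \<tau>_def V)
    moreover have "\<rho> \<preceq> \<tau> \<otimes> mat 1"
    proof -
      have "Im (sesq w \<rho> w) = 0" for w
        using sesq_hermitian[OF assms(1), of w w] by (simp add: complex_eq_iff)
      with \<sigma>(3) show ?thesis by (simp add: loewner_le_def psd_iff sesq_diff real_part)
    qed
    ultimately have "t \<le> Re (trace \<tau>)" by (intro t) (simp add: feasible_def)
    moreover have "Re (trace \<tau>) = Re (trace \<sigma>)"
      by (simp add: \<tau>_def trace_cscale trace_add) (simp add: trace_eq_sum)
    ultimately show False using \<sigma>(2) by simp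
  qed
  ultimately obtain a b where "a \<noteq> 0" and ab: "\<And>X. X \<in> C \<Longrightarrow> a \<bullet> X \<le> b" "b \<le> a \<bullet> \<rho>"
    using separating_hyperplane_sets[of C "{\<rho>}"] by auto
  then have sep: "\<And>X. X \<in> C \<Longrightarrow> a \<bullet> X \<le> a \<bullet> \<rho>" by (meson order_trans)
  define g where "g \<sigma> = a \<bullet> (\<sigma> \<otimes> (mat 1 :: 'q op))" for \<sigma>
  \<comment> \<open>Subtracting nonnegative multiples of an accretive \<open>P\<close> does not
    leave \<open>C\<close>, on which the functional is bounded above.\<close>
  have accretive: "0 \<le> a \<bullet> P" if "\<And>v. 0 \<le> Re (sesq v P v)" for P
  proof (rule linear_bounded_above_nonneg)
    fix r :: real assume "0 \<le> r"
    define M where "M = (mat (of_real ((t - 1) / n)) :: 'p op)"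
    have "M \<otimes> mat 1 - r *\<^sub>R P \<in> C"
      using that \<open>n > 0\<close> \<open>0 \<le> r\<close> unfolding scaleR_eq_cscale
      by (intro CI[of M]) (auto simp: M_def V trace_mat n_def sesq_diff sesq_cscale)
    from sep[OF this] show "a \<bullet> (M \<otimes> mat 1) - r * (a \<bullet> P) \<le> a \<bullet> \<rho>"
      by (simp add: inner_diff_right)
  qed
  have "psd (adj a)" unfolding psd_iff
  proof
    fix v
    \<comment> \<open>A rank-one projection direction times any \<open>c\<close> with nonnegative
      real part is accretive. The value 1 gives nonnegativity, and the imaginary unit with both
      signs makes the imaginary part vanish.\<close>
    have "0 \<le> Re (c * sesq v (adj a) v)" if "Re c \<ge> 0" for c
      unfolding inner_outer[symmetric] using that by (intro accretive) (simp add: sesq_outer)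
    from this[of 1] this[of \<i>] this[of "-\<i>"]
    show "0 \<le> Re (sesq v (adj a) v) \<and> Im (sesq v (adj a) v) = 0" by simp
  qed
  have gV: "g \<sigma> \<le> a \<bullet> \<rho>" if "\<sigma> \<in> V" "Re (trace \<sigma>) < t" for \<sigma>
    unfolding g_def using that by (intro sep CI) auto
  have g_add: "g (\<sigma> + \<tau>) = g \<sigma> + g \<tau>" for \<sigma> \<tau>
    by (simp add: g_def kron_add_left inner_add_right)
  have g_scale: "g (cscale (of_real r) \<sigma>) = r * g \<sigma>" for r \<sigma>
    unfolding g_def kron_cscale_left by (simp flip: scaleR_eq_cscale)
  \<comment> \<open>On \<open>V\<close> the functional kills operators whose trace has real part
    zero, so it equals \<open>c\<close> times the real part of the trace; dividing by
    \<open>c\<close> normalises the dual variable.\<close>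
  define c where "c = g (mat 1) / n"
  have g_mat: "g (mat (of_real r)) = c * n * r" for r
  proof -
    have "mat (of_real r) = cscale (of_real r) (mat 1 :: 'p op)" by (simp add: op_eq_iff mat_nth)
    with \<open>n > 0\<close> show ?thesis by (simp only: g_scale) (simp add: c_def)
  qed
  have g_zero: "g \<tau> = 0" if "\<tau> \<in> V" "Re (trace \<tau>) = 0" for \<tau>
  proof (rule linear_bounded_above_zero)
    fix r
    have "g (mat (of_real ((t - 1) / n)) + cscale (of_real r) \<tau>) \<le> a \<bullet> \<rho>"
      using that \<open>n > 0\<close> by (intro gV) (auto simp: V trace_add trace_mat trace_cscale n_def)
    then show "g (mat (of_real ((t - 1) / n))) + r * g \<tau> \<le> a \<bullet> \<rho>"
      by (simp only: g_add g_scale)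
  qed
  have g_eq: "g \<sigma> = c * Re (trace \<sigma>)" if "\<sigma> \<in> V" for \<sigma>
  proof -
    let ?M = "mat (of_real (- Re (trace \<sigma>) / n))"
    have "g (\<sigma> + ?M) = 0"
      using that \<open>n > 0\<close> by (intro g_zero) (auto simp: V trace_add trace_mat n_def)
    then have "g \<sigma> + c * n * (- Re (trace \<sigma>) / n) = 0"
      by (simp only: g_add g_mat)
    with \<open>n > 0\<close> show ?thesis by simp
  qed
  have g1: "g (mat 1) = Re (trace (adj a))"
    by (simp add: g_def kron_mat_1 inner_op_trace)
  have "Re (trace (adj a)) \<noteq> 0"
  proof
    assume "Re (trace (adj a)) = 0"
    then have "adj a $ i $ j = 0" for i j
      using psd_entry_le_trace[OF \<open>psd (adj a)\<close>, of i j] by simp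
    then have "a = 0" by (simp add: op_eq_iff)
    with \<open>a \<noteq> 0\<close> show False by simp
  qed
  with psd_trace_nonneg[OF \<open>psd (adj a)\<close>] g1 \<open>n > 0\<close> have "c > 0"
    by (simp add: c_def)
  define \<alpha> where "\<alpha> = cscale (of_real (1 / c)) (adj a)"
  have tr: "trace (\<alpha> ** X) = trace (adj a ** X) / of_real c" for X
    by (simp add: \<alpha>_def trace_mult_eq_sum sum_divide_distrib)
  show ?thesis
  proof
    show "psd \<alpha>" unfolding \<alpha>_def using \<open>c > 0\<close> \<open>psd (adj a)\<close> by (intro psd_cscale) auto
  next
    fix \<sigma> assume "\<sigma> \<in> V"
    have re: "Re (trace (\<alpha> ** (\<tau> \<otimes> mat 1))) = Re (trace \<tau>)" if "\<tau> \<in> V" for \<tau>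
      using g_eq[OF that] \<open>c > 0\<close> unfolding tr g_def inner_op_trace by simp
    \<comment> \<open>The separating functional sees real parts only. Multiplying \<sigma> by minus
      the imaginary unit, which \<open>V\<close> permits, recovers the imaginary parts.\<close>
    have "trace (\<alpha> ** (cscale (- \<i>) \<sigma> \<otimes> (mat 1 :: 'q op))) = - \<i> * trace (\<alpha> ** (\<sigma> \<otimes> mat 1))"
      by (simp add: trace_mult_eq_sum sum_distrib_left sum_negf mult_ac)
    with re[of \<sigma>] re[of "cscale (- \<i>) \<sigma>"] \<open>\<sigma> \<in> V\<close>
    show "trace (\<alpha> ** (\<sigma> \<otimes> mat 1)) = trace \<sigma>"
      by (simp add: V complex_eq_iff trace_cscale)
  next
    \<comment> \<open>Membership in \<open>C\<close> demands a trace strictly below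
      \<open>t\<close>, so the bound is shown for every \<open>s < t\<close> and passes to
      \<open>t\<close> in the limit.\<close>
    have "s * c \<le> a \<bullet> \<rho>" if "s < t" for s
    proof -
      have "g (mat (of_real (s / n))) \<le> a \<bullet> \<rho>"
        using that \<open>n > 0\<close> by (intro gV) (auto simp: V trace_mat n_def)
      with \<open>n > 0\<close> show ?thesis by (simp only: g_mat) (simp add: mult.commute)
    qed
    then have "s \<le> (a \<bullet> \<rho>) / c" if "s < t" for s
      using that \<open>c > 0\<close> by (simp add: pos_le_divide_eq)
    then have "t \<le> (a \<bullet> \<rho>) / c" by (rule dense_le)
    then show "t \<le> Re (trace (\<alpha> ** \<rho>))"
      by (simp add: tr inner_op_trace)
  qed
qed

section \<open>Comparing the values of two programs\<close>

lemma feasibleI: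
  fixes \<rho> :: "('p::finite \<times> 'q::finite) op"
  assumes "psd \<rho>" "\<sigma> \<in> V" "psd (\<sigma> \<otimes> mat 1 - \<rho>)"
  shows "\<sigma> \<in> feasible V \<rho>"
  using assms psd_of_kron_mat_1[OF assms(1,3)]
  by (simp add: feasible_def loewner_le_def psd_imp_hermitian)

lemma feasibleD: "\<sigma> \<in> feasible V \<rho> \<Longrightarrow> \<sigma> \<in> V" "\<sigma> \<in> feasible V \<rho> \<Longrightarrow> psd (\<sigma> \<otimes> mat 1 - \<rho>)"
  by (simp_all add: feasible_def loewner_le_def)

text \<open>The two sets of objective values coincide, so the \<open>LEAST\<close> terms agree
  whether or not a minimum is attained.\<close>

lemma minval_eqI:
  assumes "\<And>\<sigma>. \<sigma> \<in> feasible V \<rho> \<Longrightarrow> \<exists>\<tau>\<in>feasible W \<omega>. trace \<tau> = trace \<sigma>"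
    and "\<And>\<tau>. \<tau> \<in> feasible W \<omega> \<Longrightarrow> \<exists>\<sigma>\<in>feasible V \<rho>. trace \<sigma> = trace \<tau>"
  shows "minval V \<rho> = minval W \<omega>"
proof -
  have "(\<exists>\<sigma>\<in>feasible V \<rho>. t = Re (trace \<sigma>)) \<longleftrightarrow> (\<exists>\<tau>\<in>feasible W \<omega>. t = Re (trace \<tau>))" for t
    using assms by metis
  then show ?thesis by (simp add: minval_def)
qed

lemma op_space_UNIV: "op_space UNIV"
  by (simp add: op_space_def)

lemma minval_pos:
  assumes "psd \<rho>" "0 < Re (trace \<rho>)" "op_space V"
  shows "0 < minval V \<rho>"
  using minval_attained[OF assms] by metis

lemma minval_le_scaled:
  assumes "psd \<rho>" "0 < Re (trace \<rho>)" "op_space V" "psd \<omega>" "0 < Re (trace \<omega>)" "op_space W"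
    and "\<And>\<sigma>. \<sigma> \<in> feasible V \<rho> \<Longrightarrow> \<exists>\<tau>\<in>feasible W \<omega>. Re (trace \<tau>) = c * Re (trace \<sigma>)"
  shows "minval W \<omega> \<le> c * minval V \<rho>"
proof -
  from minval_attained[OF assms(1-3)] obtain \<sigma>
    where \<sigma>: "\<sigma> \<in> feasible V \<rho>" "Re (trace \<sigma>) = minval V \<rho>" "0 < minval V \<rho>" by metis
  from minval_attained[OF assms(4-6)]
  have W: "0 < minval W \<omega>" "\<And>\<tau>. \<tau> \<in> feasible W \<omega> \<Longrightarrow> minval W \<omega> \<le> Re (trace \<tau>)" by metis+
  from assms(7)[OF \<sigma>(1)] W(2) \<sigma>(2) show "minval W \<omega> \<le> c * minval V \<rho>" by fastforce
qed

lemma neg_log_minval_le: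
  assumes "psd \<rho>" "0 < Re (trace \<rho>)" "op_space V" "psd \<omega>" "0 < Re (trace \<omega>)" "op_space W"
    and "\<And>\<sigma>. \<sigma> \<in> feasible V \<rho> \<Longrightarrow> \<exists>\<tau>\<in>feasible W \<omega>. trace \<tau> = trace \<sigma>"
  shows "- log 2 (minval V \<rho>) \<le> - log 2 (minval W \<omega>)"
proof -
  have *: "\<exists>\<tau>\<in>feasible W \<omega>. Re (trace \<tau>) = 1 * Re (trace \<sigma>)" if "\<sigma> \<in> feasible V \<rho>" for \<sigma>
    using assms(7)[OF that] by force
  from minval_le_scaled[OF assms(1-6) *] minval_pos[OF assms(1-3)] minval_pos[OF assms(4-6)] show ?thesis by simp
qed

section \<open>Completely positive maps and their Choi operators\<close>

lemma psd_outer: "psd (\<chi> i j. v $ i * cnj (v $ j))"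
  using sesq_outer[of _ 1 v] by (simp add: psd_iff del: of_real_power)

lemma block_psd_UNIV_iff: "block_psd UNIV X \<longleftrightarrow> psd (\<chi> p q. X (fst p) (fst q) $ snd p $ snd q)"
proof -
  have eq: "(\<Sum>i\<in>UNIV. \<Sum>j\<in>UNIV. sesq (v i) (X i j) (v j))
      = sesq (\<chi> p. v (fst p) $ snd p) (\<chi> p q. X (fst p) (fst q) $ snd p $ snd q)
          (\<chi> p. v (fst p) $ snd p)" for v
    unfolding sesq_def by (simp add: sum_UNIV_prod) (intro sum.cong refl, rule sum.swap)
  show ?thesis unfolding psd_def block_psd_def eq
  proof (safe)
    fix v :: "complex^('a \<times> 'b)"
    let ?X = "\<chi> p q. X (fst p) (fst q) $ snd p $ snd q"
    assume "\<forall>w. 0 \<le> sesq (\<chi> p. w (fst p) $ snd p) ?X (\<chi> p. w (fst p) $ snd p)"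
    from this[rule_format, of "\<lambda>i. \<chi> k. v $ (i, k)"] show "0 \<le> sesq v ?X v" by simp
  next
    fix v :: "'a \<Rightarrow> complex^'b"
    let ?X = "\<chi> p q. X (fst p) (fst q) $ snd p $ snd q"
    assume X: "\<forall>w. 0 \<le> sesq w ?X w"
    show "0 \<le> sesq (\<chi> p. v (fst p) $ snd p) ?X (\<chi> p. v (fst p) $ snd p)"
      by (rule X[rule_format])
  qed
qed

lemma block_psd_reindex:
  assumes "bij_betw h J I"
  shows "block_psd J (\<lambda>i j. X (h i) (h j)) \<longleftrightarrow> block_psd I X"
proof -
  have eq: "(\<Sum>i\<in>J. \<Sum>j\<in>J. sesq (v (h i)) (X (h i) (h j)) (v (h j)))
      = (\<Sum>i\<in>I. \<Sum>j\<in>I. sesq (v i) (X i j) (v j))" for v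
  proof -
    have "(\<Sum>i\<in>I. \<Sum>j\<in>I. sesq (v i) (X i j) (v j)) = (\<Sum>i\<in>J. \<Sum>j\<in>I. sesq (v (h i)) (X (h i) j) (v j))"
      by (rule sum.reindex_bij_betw[OF assms, symmetric])
    also have "\<dots> = (\<Sum>i\<in>J. \<Sum>j\<in>J. sesq (v (h i)) (X (h i) (h j)) (v (h j)))"
      by (intro sum.cong refl sum.reindex_bij_betw[OF assms, symmetric])
    finally show ?thesis ..
  qed
  have "(\<Sum>i\<in>J. \<Sum>j\<in>J. sesq (w i) (X (h i) (h j)) (w j))
      = (\<Sum>i\<in>J. \<Sum>j\<in>J. sesq (w (inv_into J h (h i))) (X (h i) (h j)) (w (inv_into J h (h j))))" for w
    using assms by (intro sum.cong refl) (simp add: bij_betw_def)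
  then have "(\<Sum>i\<in>J. \<Sum>j\<in>J. sesq (w i) (X (h i) (h j)) (w j))
      = (\<Sum>i\<in>I. \<Sum>j\<in>I. sesq ((w \<circ> inv_into J h) i) (X i j) ((w \<circ> inv_into J h) j))" for w
    using eq[of "w \<circ> inv_into J h"] by simp
  then have "block_psd J (\<lambda>i j. X (h i) (h j))" if "block_psd I X"
    using that unfolding block_psd_def by simp
  moreover have "block_psd I X" if "block_psd J (\<lambda>i j. X (h i) (h j))"
    unfolding block_psd_def eq[symmetric]
    using that unfolding block_psd_def by (intro allI) (drule spec, assumption)
  ultimately show ?thesis by blast
qed

text \<open>Complete positivity is defined through ancillas \<open>{..<n}\<close>; an enumeration of
  the type carries it over to ancillas that are themselves finite types.\<close>

lemma completely_positive_block_psd: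
  fixes X :: "'i::finite \<Rightarrow> 'i \<Rightarrow> 's::finite op"
  assumes "completely_positive \<Phi>" "block_psd UNIV X"
  shows "block_psd UNIV (\<lambda>i j. \<Phi> (X i j))"
proof -
  obtain h where h: "bij_betw h {0..<CARD('i)} (UNIV :: 'i set)"
    using ex_bij_betw_nat_finite[of "UNIV :: 'i set"] by auto
  then have h: "bij_betw h {..<CARD('i)} (UNIV :: 'i set)" by (simp add: atLeast0LessThan)
  have "block_psd {..<CARD('i)} (\<lambda>i j. X (h i) (h j))"
    using block_psd_reindex[OF h] assms(2) by blast
  then have "block_psd {..<CARD('i)} (\<lambda>i j. \<Phi> (X (h i) (h j)))"
    using assms(1) by (auto simp: completely_positive_def)
  then show ?thesis
    using block_psd_reindex[OF h, of "\<lambda>i j. \<Phi> (X i j)"] by blast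
qed

lemma op_linear_expand:
  assumes "op_linear \<Phi>"
  shows "\<Phi> X $ k $ l = (\<Sum>i\<in>UNIV. \<Sum>j\<in>UNIV. X $ i $ j * \<Phi> (munit i j) $ k $ l)"
proof -
  interpret Vector_Spaces.linear cscale cscale \<Phi>
    using assms by (simp add: op_linear_def)
  have "X = (\<Sum>i\<in>UNIV. \<Sum>j\<in>UNIV. cscale (X $ i $ j) (munit i j))"
    by (simp add: op_eq_iff sum_munit_flip)
  then have "\<Phi> X = (\<Sum>i\<in>UNIV. \<Sum>j\<in>UNIV. cscale (X $ i $ j) (\<Phi> (munit i j)))"
    by (metis (no_types, lifting) sum sum.cong scale)
  then show ?thesis by simp
qed

lemma nchoi_nth: "nchoi \<Phi> $ p $ q = \<Phi> (munit (fst p) (fst q)) $ snd p $ snd q / of_nat CARD('s)"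
  for \<Phi> :: "'s::finite op \<Rightarrow> 't::finite op"
proof -
  have "nchoi \<Phi> $ p $ q = (1 / of_nat CARD('s)) *
      (\<Sum>i\<in>UNIV. \<Sum>j\<in>UNIV. \<Phi> (munit i j) $ snd p $ snd q * munit i j $ fst p $ fst q)"
    by (simp add: nchoi_def mult.commute)
  then show ?thesis by (simp add: sum_munit_flip)
qed

lemma channel_op_linear: "channel \<Phi> \<Longrightarrow> op_linear \<Phi>"
  by (simp add: channel_def completely_positive_def)

lemma psd_nchoi:
  fixes \<Phi> :: "'s::finite op \<Rightarrow> 't::finite op"
  assumes "completely_positive \<Phi>"
  shows "psd (nchoi \<Phi>)"
proof -
  \<comment> \<open>This is the unnormalised maximally entangled vector; the blocks of its rank-one
    operator are the matrix units.\<close>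
  define v :: "complex^('s \<times> 's)" where "v = (\<chi> p. of_bool (fst p = snd p))"
  have "(\<chi> p q. munit (fst p) (fst q) $ snd p $ snd q) = (\<chi> p q. v $ p * cnj (v $ q))"
    by (auto simp: op_eq_iff munit_nth v_def)
  then have "block_psd UNIV (munit :: 's \<Rightarrow> 's \<Rightarrow> _)"
    using psd_outer[of v] unfolding block_psd_UNIV_iff by simp
  from completely_positive_block_psd[OF assms this]
  have "psd (cscale (of_real (1 / real CARD('s))) (\<chi> p q. \<Phi> (munit (fst p) (fst q)) $ snd p $ snd q))"
    unfolding block_psd_UNIV_iff by (intro psd_cscale) auto
  also have "cscale (of_real (1 / real CARD('s))) (\<chi> p q. \<Phi> (munit (fst p) (fst q)) $ snd p $ snd q)
      = nchoi \<Phi>"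
    by (simp add: op_eq_iff nchoi_nth)
  finally show ?thesis .
qed

lemma nchoi_marginal:
  fixes \<Phi> :: "'s::finite op \<Rightarrow> 't::finite op"
  assumes "trace_preserving \<Phi>"
  shows "(\<Sum>k\<in>UNIV. nchoi \<Phi> $ (i, k) $ (j, k)) = of_bool (i = j) / of_nat CARD('s)"
proof -
  have "(\<Sum>k\<in>UNIV. \<Phi> (munit i j) $ k $ k) = of_bool (i = j)"
    using assms unfolding trace_preserving_def by (simp add: trace_munit flip: trace_eq_sum)
  then show ?thesis by (simp add: nchoi_nth flip: sum_divide_distrib)
qed

lemma trace_nchoi: "trace_preserving \<Phi> \<Longrightarrow> trace (nchoi \<Phi>) = 1"
  by (simp add: trace_eq_sum sum_UNIV_prod nchoi_marginal)

section \<open>The extended min-entropy as a semidefinite program\<close>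

text \<open>The constraint \<open>\<gamma>^{A0 B0} = u \<otimes> \<gamma>^{B0}\<close> in entries.
  With the marginal of \<gamma> itself on the right it is homogeneous and cuts out a linear
  subspace.\<close>

definition marginal_space :: "(('a0::finite \<times> 'a1::finite) \<times> 'b0::finite) op set" where
  "marginal_space = {\<gamma>. \<forall>a b a' b'. (\<Sum>x\<in>UNIV. \<gamma> $ ((a, x), b) $ ((a', x), b'))
     = of_bool (a = a') * (\<Sum>p\<in>UNIV. \<gamma> $ (p, b) $ (p, b')) / of_nat CARD('a0)}"

text \<open>The tensor legs are ordered with B1 last, which gives the program the shape
  \<open>\<rho> \<preceq> \<sigma> \<otimes> mat 1\<close> required by
  \<open>feasible\<close>.\<close>

definition ext_choi ::
  "(('a0::finite \<times> 'b0::finite) op \<Rightarrow> ('a1::finite \<times> 'b1::finite) op)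
     \<Rightarrow> ((('a0 \<times> 'a1) \<times> 'b0) \<times> 'b1) op" where
  "ext_choi \<Omega> = reindex (\<lambda>(((a0, a1), b0), b1). ((a0, b0), (a1, b1))) (nchoi \<Omega>)"

lemma Hmin_eq: "Hmin \<rho> = - log 2 (minval UNIV \<rho>)"
  unfolding Hmin_def minval_def feasible_def by (auto intro!: arg_cong[where f = Least])

lemma marginal_space_iff:
  "\<gamma> \<in> marginal_space \<longleftrightarrow>
     ptrace2 (reindex (\<lambda>((a0, b0), a1). ((a0, a1), b0)) \<gamma>) = max_mixed \<otimes> ptrace1 \<gamma>"
  by (auto simp: marginal_space_def op_eq_iff max_mixed_def mat_nth)

lemma Hmin_ext_eq: "Hmin_ext \<Omega> = - log 2 (minval marginal_space (ext_choi \<Omega>))"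
proof -
  have "(\<exists>\<gamma>. hermitian \<gamma> \<and> ext_choi \<Omega> \<preceq> \<gamma> \<otimes> mat 1 \<and>
     ptrace2 (reindex (\<lambda>((a0, b0), a1). ((a0, a1), b0)) \<gamma>) = max_mixed \<otimes> ptrace1 \<gamma> \<and>
     t = Re (trace \<gamma>)) \<longleftrightarrow> (\<exists>\<gamma>\<in>feasible marginal_space (ext_choi \<Omega>). t = Re (trace \<gamma>))" for t
    unfolding marginal_space_iff[symmetric] feasible_def by auto
  then show ?thesis unfolding Hmin_ext_def minval_def ext_choi_def[symmetric] by simp
qed

lemma op_space_marginal_space: "op_space marginal_space"
proof -
  have "(mat 1 :: (('a \<times> 'b) \<times> 'c) op) \<in> marginal_space"
  proof -
    have "(\<Sum>x\<in>UNIV. (mat 1 :: (('a \<times> 'b) \<times> 'c) op) $ ((a, x), b) $ ((a', x), b'))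
        = of_bool (a = a') * of_bool (b = b') * of_nat CARD('b)" for a a' b b'
      by (auto simp: mat_nth)
    moreover have "(\<Sum>p\<in>UNIV. (mat 1 :: (('a \<times> 'b) \<times> 'c) op) $ (p, b) $ (p, b'))
        = of_bool (b = b') * (of_nat CARD('a) * of_nat CARD('b))" for b b'
      by (auto simp: mat_nth)
    ultimately show ?thesis by (simp add: marginal_space_def)
  qed
  moreover have "adj M \<in> marginal_space" if "M \<in> marginal_space" for M :: "(('a \<times> 'b) \<times> 'c) op"
    unfolding marginal_space_def
  proof (intro CollectI allI)
    fix a b a' b'
    have "(\<Sum>x\<in>UNIV. adj M $ ((a, x), b) $ ((a', x), b'))
        = cnj (\<Sum>x\<in>UNIV. M $ ((a', x), b') $ ((a, x), b))" by simp
    also have "\<dots> = of_bool (a = a') * (\<Sum>p\<in>UNIV. adj M $ (p, b) $ (p, b')) / of_nat CARD('a)"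
      using that unfolding marginal_space_def by auto
    finally show "(\<Sum>x\<in>UNIV. adj M $ ((a, x), b) $ ((a', x), b'))
        = of_bool (a = a') * (\<Sum>p\<in>UNIV. adj M $ (p, b) $ (p, b')) / of_nat CARD('a)" .
  qed
  moreover have "cscale c M \<in> marginal_space" if "M \<in> marginal_space" for c and M :: "(('a \<times> 'b) \<times> 'c) op"
    using that by (auto simp: marginal_space_def simp flip: sum_distrib_left)
  moreover have "M + N \<in> marginal_space" if "M \<in> marginal_space" "N \<in> marginal_space"
    for M N :: "(('a \<times> 'b) \<times> 'c) op"
    using that by (auto simp: marginal_space_def sum.distrib add_divide_distrib)
  ultimately show ?thesis by (simp add: op_space_def)
qed

lemma psd_ext_choi: "completely_positive \<Omega> \<Longrightarrow> psd (ext_choi \<Omega>)"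
  unfolding ext_choi_def by (intro psd_reindex psd_nchoi)

lemma bij_ext: "bij (\<lambda>(((a0, a1), b0), b1). ((a0, b0), (a1, b1)))"
  by (rule o_bij[of "\<lambda>((a0, b0), (a1, b1)). (((a0, a1), b0), b1)"]) auto

lemma trace_ext_choi: "trace_preserving \<Omega> \<Longrightarrow> trace (ext_choi \<Omega>) = 1"
  unfolding ext_choi_def by (simp add: trace_reindex bij_ext trace_nchoi)

section \<open>Replacement, product channels and bounds\<close>

text \<open>Tracing out A0 and B0 is positive and takes \<open>\<gamma> \<otimes> mat 1\<close> to
  \<open>\<sigma> \<otimes> mat 1\<close>, where \<sigma> is the marginal of \<gamma> on A1. It
  gives the upper bound and one half of the replacement case.\<close>

lemma feasible_discard_inputs:
  fixes \<Omega> :: "('a0::finite \<times> 'b0::finite) op \<Rightarrow> ('a1::finite \<times> 'b1::finite) op"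
  assumes "channel \<Omega>" "\<gamma> \<in> feasible marginal_space (ext_choi \<Omega>)"
  shows "\<exists>\<sigma>\<in>feasible UNIV (ptrace1 (nchoi \<Omega>)). trace \<sigma> = trace \<gamma>"
proof
  let ?\<sigma> = "ptrace2 (reindex (\<lambda>(x, (a, b)). ((a, x), b)) \<gamma>)"
  have "psd (\<Sum>a\<in>UNIV. \<Sum>b\<in>UNIV. reindex (\<lambda>(x, k). (((a, x), b), k)) (\<gamma> \<otimes> mat 1 - ext_choi \<Omega>))"
    by (intro psd_sum psd_reindex feasibleD(2)[OF assms(2)])
  also have "(\<Sum>a\<in>UNIV. \<Sum>b\<in>UNIV. reindex (\<lambda>(x, k). (((a, x), b), k)) (\<gamma> \<otimes> mat 1 - ext_choi \<Omega>))
      = ?\<sigma> \<otimes> mat 1 - ptrace1 (nchoi \<Omega>)"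
    by (simp add: op_eq_iff ext_choi_def sum_UNIV_prod sum_subtractf sum_distrib_right)
  finally show "?\<sigma> \<in> feasible UNIV (ptrace1 (nchoi \<Omega>))"
    using assms(1) by (intro feasibleI psd_ptrace1 psd_nchoi) (auto simp: channel_def)
  have "bij (\<lambda>(x :: 'a1, (a :: 'a0, b :: 'b0)). ((a, x), b))"
    by (rule o_bij[of "\<lambda>((a, x), b). (x, (a, b))"]) auto
  then show "trace ?\<sigma> = trace \<gamma>"
    by (simp add: trace_ptrace2 trace_reindex)
qed

lemma density_matrix_outer:
  assumes "(\<Sum>i\<in>UNIV. (cmod (v $ i))\<^sup>2) = 1"
  shows "density_matrix (\<chi> i j. v $ i * cnj (v $ j))"
proof -
  have "trace (\<chi> i j. v $ i * cnj (v $ j)) = of_real (\<Sum>i\<in>UNIV. (cmod (v $ i))\<^sup>2)"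
    by (simp add: trace_eq_sum of_real_cmod_square)
  with assms psd_outer[of v] show ?thesis by (simp add: density_matrix_def)
qed

text \<open>Polarisation: the states \<open>(|i> + c|j>)/sqrt 2\<close> with \<open>c = 1\<close> and \<open>c = \<i>\<close> isolate the
  off-diagonal matrix units.\<close>

lemma constant_on_densities:
  fixes \<Phi> :: "'s::finite op \<Rightarrow> 't::finite op"
  assumes "op_linear \<Phi>" and const: "\<And>\<rho>. density_matrix \<rho> \<Longrightarrow> \<Phi> \<rho> = W"
  shows "\<Phi> (munit i j) = (if i = j then W else 0)"
proof -
  have add: "\<Phi> (X + Y) = \<Phi> X + \<Phi> Y" and scale: "\<Phi> (cscale c X) = cscale c (\<Phi> X)" for c X Y
    using assms(1) by (auto simp: op_linear_iff)
  have diag: "\<Phi> (munit k k) = W" for k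
  proof -
    have "density_matrix (\<chi> i j. axis k 1 $ i * cnj ((axis k 1 :: complex^'s) $ j))"
    proof (rule density_matrix_outer)
      have "(\<Sum>i\<in>UNIV. (cmod ((axis k 1 :: complex^'s) $ i))\<^sup>2) = (\<Sum>i\<in>UNIV. if i = k then 1 else 0)"
        by (intro sum.cong) (auto simp: axis_def)
      then show "(\<Sum>i\<in>UNIV. (cmod ((axis k 1 :: complex^'s) $ i))\<^sup>2) = 1" by simp
    qed
    also have "(\<chi> i j. axis k 1 $ i * cnj ((axis k 1 :: complex^'s) $ j)) = munit k k"
      by (auto simp: op_eq_iff munit_nth axis_def)
    finally show ?thesis by (rule const)
  qed
  show ?thesis
  proof (cases "i = j")
    case False
    have pol: "cscale (cnj c) (\<Phi> (munit i j)) + cscale c (\<Phi> (munit j i)) = 0" if "cmod c = 1" for c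
    proof -
      have cc: "c * cnj c = 1" using that by (simp flip: complex_norm_square)
      define v :: "complex^'s" where
        "v = (\<chi> k. if k = i then of_real (sqrt (1/2)) else if k = j then c * of_real (sqrt (1/2)) else 0)"
      have r: "of_real (sqrt (1/2)) * of_real (sqrt (1/2)) = (1/2 :: complex)"
        by (simp flip: of_real_mult)
      have "density_matrix (\<chi> k l. v $ k * cnj (v $ l))"
      proof (rule density_matrix_outer)
        have "(\<Sum>k\<in>UNIV. (cmod (v $ k))\<^sup>2) = (\<Sum>k\<in>UNIV. (if k = i then 1/2 else 0) + (if k = j then 1/2 else 0))"
          using False that by (intro sum.cong) (auto simp: v_def norm_mult power_mult_distrib)
        then show "(\<Sum>k\<in>UNIV. (cmod (v $ k))\<^sup>2) = 1" by (simp add: sum.distrib)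
      qed
      from const[OF this] have "\<Phi> (\<chi> k l. v $ k * cnj (v $ l)) = W" .
      moreover have "(\<chi> k l. v $ k * cnj (v $ l)) = cscale (1/2)
         ((munit i i + munit j j) + (cscale (cnj c) (munit i j) + cscale c (munit j i)))"
        using False by (auto simp: op_eq_iff munit_nth v_def r cc mult_ac)
      ultimately have "cscale (1/2) ((W + W) + (cscale (cnj c) (\<Phi> (munit i j)) + cscale c (\<Phi> (munit j i)))) = W"
        by (simp add: add scale diag)
      then show ?thesis by (simp add: op_eq_iff field_simps)
    qed
    have "\<Phi> (munit i j) $ k $ l = 0" for k l
    proof -
      have "\<Phi> (munit i j) $ k $ l + \<Phi> (munit j i) $ k $ l = 0"
        using pol[of 1] by (simp add: op_eq_iff)
      moreover have "\<i> * (\<Phi> (munit j i) $ k $ l - \<Phi> (munit i j) $ k $ l) = 0"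
        using pol[of \<i>] by (simp add: op_eq_iff algebra_simps)
      ultimately show ?thesis by simp
    qed
    with False show ?thesis by (simp add: op_eq_iff)
  qed (simp add: diag)
qed

lemma Hmin_ext_replacement:
  fixes \<Omega> :: "('a0::finite \<times> 'b0::finite) op \<Rightarrow> ('a1::finite \<times> 'b1::finite) op"
  assumes "channel \<Omega>" "\<And>\<rho>. density_matrix \<rho> \<Longrightarrow> \<Omega> \<rho> = ptrace1 (nchoi \<Omega>)"
  shows "Hmin_ext \<Omega> = Hmin (ptrace1 (nchoi \<Omega>))"
proof -
  define \<omega> where "\<omega> = ptrace1 (nchoi \<Omega>)"
  have \<Omega>: "\<Omega> (munit i j) = (if i = j then \<omega> else 0)" for i j
    using constant_on_densities[OF channel_op_linear[OF assms(1)] assms(2)] by (simp add: \<omega>_def)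
  have "\<exists>\<gamma>\<in>feasible marginal_space (ext_choi \<Omega>). trace \<gamma> = trace \<sigma>" if "\<sigma> \<in> feasible UNIV \<omega>" for \<sigma>
  proof
    define \<mu> :: "('a0 \<times> 'b0) op" where "\<mu> = max_mixed"
    \<comment> \<open>The normalised Choi operator of a replacement channel is \<mu> tensored with
      \<omega>, so \<sigma> is lifted by tensoring with the same \<mu>. The marginal constraint
      comes from the product form.\<close>
    let ?\<gamma> = "reindex (\<lambda>((a, x), b). ((a, b), x)) (\<mu> \<otimes> \<sigma>)"
    have "psd \<mu>" using psd_mat[of "1 / real CARD('a0 \<times> 'b0)"]
      by (simp add: \<mu>_def max_mixed_def)
    then have "psd (reindex (\<lambda>(((a, x), b), k). ((a, b), (x, k))) (\<mu> \<otimes> (\<sigma> \<otimes> mat 1 - \<omega>)))"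
      by (intro psd_reindex psd_kron feasibleD(2)[OF that])
    also have "reindex (\<lambda>(((a, x), b), k). ((a, b), (x, k))) (\<mu> \<otimes> (\<sigma> \<otimes> mat 1 - \<omega>))
        = ?\<gamma> \<otimes> mat 1 - ext_choi \<Omega>"
      by (simp add: op_eq_iff ext_choi_def nchoi_nth \<Omega> \<mu>_def max_mixed_def mat_nth field_simps)
    finally show "?\<gamma> \<in> feasible marginal_space (ext_choi \<Omega>)"
      using assms(1)
      by (intro feasibleI psd_ext_choi)
        (auto simp: channel_def marginal_space_def \<mu>_def max_mixed_def mat_nth sum_UNIV_prod
          simp flip: sum_distrib_left)
    have "bij (\<lambda>((a :: 'a0, x :: 'a1), b :: 'b0). ((a, b), x))"
      by (rule o_bij[of "\<lambda>((a, b), x). ((a, x), b)"]) auto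
    then show "trace ?\<gamma> = trace \<sigma>"
      by (simp add: trace_reindex trace_kron \<mu>_def max_mixed_def trace_mat)
  qed
  then have "minval marginal_space (ext_choi \<Omega>) = minval UNIV \<omega>"
    using feasible_discard_inputs[OF assms(1), folded \<omega>_def] by (intro minval_eqI)
  then show ?thesis by (simp add: Hmin_ext_eq Hmin_eq \<omega>_def)
qed

lemma Hmin_ext_le_Hmin:
  fixes \<Omega> :: "('a0::finite \<times> 'b0::finite) op \<Rightarrow> ('a1::finite \<times> 'b1::finite) op"
  assumes "channel \<Omega>"
  shows "Hmin_ext \<Omega> \<le> Hmin (ptrace1 (nchoi \<Omega>))"
  unfolding Hmin_ext_eq Hmin_eq
  using assms feasible_discard_inputs[OF assms]
  by (intro neg_log_minval_le psd_ptrace1 psd_nchoi psd_ext_choi op_space_UNIV op_space_marginal_space)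
    (auto simp: channel_def trace_ext_choi trace_ptrace1 trace_nchoi)

text \<open>A feasible \<sigma> on B0 is padded with the identity on A0 A1, so that the identity on
  A B1 splits into the padding and the identity on B1. The padding multiplies the trace by d_A,
  whence the logarithmic correction.\<close>

lemma Hmin_ext_ge_Hmin:
  fixes \<Omega> :: "('a0::finite \<times> 'b0::finite) op \<Rightarrow> ('a1::finite \<times> 'b1::finite) op"
  assumes "channel \<Omega>"
  shows "Hmin (reindex (\<lambda>(b0, ((a0, a1), b1)). ((a0, b0), (a1, b1))) (nchoi \<Omega>))
         - log 2 (real CARD('a0) * real CARD('a1)) \<le> Hmin_ext \<Omega>"
proof -
  let ?\<rho> = "reindex (\<lambda>(b0, ((a0, a1), b1)). ((a0, b0), (a1, b1))) (nchoi \<Omega>)"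
  let ?d = "real CARD('a0) * real CARD('a1)"
  have bij: "bij (\<lambda>(b0 :: 'b0, ((a0 :: 'a0, a1 :: 'a1), b1 :: 'b1)). ((a0, b0), (a1, b1)))"
    by (rule o_bij[of "\<lambda>((a0, b0), (a1, b1)). (b0, ((a0, a1), b1))"]) auto
  have psd: "psd ?\<rho>" "psd (ext_choi \<Omega>)"
    and tr: "trace ?\<rho> = 1" "trace (ext_choi \<Omega>) = 1"
    using assms by (auto simp: channel_def trace_ext_choi trace_nchoi trace_reindex[OF bij]
        intro!: psd_reindex psd_nchoi psd_ext_choi)
  have ex: "\<exists>\<gamma>\<in>feasible marginal_space (ext_choi \<Omega>). Re (trace \<gamma>) = ?d * Re (trace \<sigma>)"
    if "\<sigma> \<in> feasible UNIV ?\<rho>" for \<sigma>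
  proof
    let ?\<gamma> = "(mat 1 :: ('a0 \<times> 'a1) op) \<otimes> \<sigma>"
    have "psd (reindex (\<lambda>((p, b), y). (b, (p, y))) (\<sigma> \<otimes> mat 1 - ?\<rho>))"
      by (intro psd_reindex feasibleD(2)[OF that])
    also have "reindex (\<lambda>((p, b), y). (b, (p, y))) (\<sigma> \<otimes> mat 1 - ?\<rho>) = ?\<gamma> \<otimes> mat 1 - ext_choi \<Omega>"
      by (simp add: op_eq_iff ext_choi_def mat_nth)
    finally show "?\<gamma> \<in> feasible marginal_space (ext_choi \<Omega>)"
      by (intro feasibleI psd) (auto simp: marginal_space_def mat_nth)
    show "Re (trace ?\<gamma>) = ?d * Re (trace \<sigma>)" by (simp add: trace_kron trace_mat)
  qed
  have pos: "0 < Re (trace ?\<rho>)" "0 < Re (trace (ext_choi \<Omega>))" by (simp_all only: tr) simp_all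
  note minval_le_scaled[OF psd(1) pos(1) op_space_UNIV psd(2) pos(2) op_space_marginal_space ex]
  moreover note ps = minval_pos[OF psd(1) pos(1) op_space_UNIV]
  moreover note minval_pos[OF psd(2) pos(2) op_space_marginal_space]
  ultimately have "log 2 (minval marginal_space (ext_choi \<Omega>)) \<le> log 2 (?d * minval UNIV ?\<rho>)"
    by simp
  also have "\<dots> = log 2 ?d + log 2 (minval UNIV ?\<rho>)"
    using ps by (intro log_mult_pos) auto
  finally show ?thesis unfolding Hmin_ext_eq Hmin_eq by linarith
qed

section \<open>Tensor products of maps\<close>

lemma tensor_map_munit: "tensor_map \<Psi> \<Phi> (munit (i, k) (j, l)) = \<Psi> (munit i j) \<otimes> \<Phi> (munit k l)"
proof -
  have m: "munit (i, k) (j, l) $ (i', k') $ (j', l') = munit i j $ i' $ j' * munit k l $ k' $ l'"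
    for i' j' k' l'
    by (simp add: munit_nth)
  show ?thesis
    unfolding tensor_map_def op_eq_iff sum_component cscale_nth m
    by (simp add: mult.assoc sum_munit flip: sum_distrib_left)
qed

lemma nchoi_tensor_map:
  "nchoi (tensor_map \<Psi> \<Phi>) $ ((a, b), (x, y)) $ ((a', b'), (x', y'))
    = nchoi \<Psi> $ (a, x) $ (a', x') * nchoi \<Phi> $ (b, y) $ (b', y')"
  by (simp add: nchoi_nth tensor_map_munit)

text \<open>The normalised Choi operator factorises. Tracing out A0 A1 works because the factor of
  \<Psi> has trace one; in the other direction, tensoring with that factor meets the marginal
  constraint because \<Psi> preserves traces.\<close>

lemma Hmin_ext_product:
  fixes \<Psi> :: "'a0::finite op \<Rightarrow> 'a1::finite op" and \<Phi> :: "'b0::finite op \<Rightarrow> 'b1::finite op"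
  assumes "channel \<Psi>" "channel \<Phi>"
  shows "Hmin_ext (tensor_map \<Psi> \<Phi>) = Hmin_ext1 \<Phi>"
proof -
  let ?\<rho> = "ext_choi (tensor_map \<Psi> \<Phi>)"
  have psd: "psd (nchoi \<Psi>)" "psd (nchoi \<Phi>)" and tr: "trace (nchoi \<Psi>) = 1"
    using assms by (auto simp: channel_def psd_nchoi trace_nchoi)
  have \<rho>: "?\<rho> = reindex (\<lambda>((p, b), y). (p, (b, y))) (nchoi \<Psi> \<otimes> nchoi \<Phi>)"
    by (simp add: op_eq_iff ext_choi_def nchoi_tensor_map)
  have sum_\<Psi>: "(\<Sum>p\<in>UNIV. nchoi \<Psi> $ p $ p) = 1"
    using tr by (simp add: trace_eq_sum)
  have "minval marginal_space ?\<rho> = minval UNIV (nchoi \<Phi>)"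
  proof (rule minval_eqI)
    fix \<gamma> assume \<gamma>: "\<gamma> \<in> feasible marginal_space ?\<rho>"
    have "psd (\<Sum>p\<in>UNIV. reindex (\<lambda>(b, y). ((p, b), y)) (\<gamma> \<otimes> mat 1 - ?\<rho>))"
      by (intro psd_sum psd_reindex feasibleD(2)[OF \<gamma>])
    also have "(\<Sum>p\<in>UNIV. reindex (\<lambda>(b, y). ((p, b), y)) (\<gamma> \<otimes> mat 1 - ?\<rho>))
        = ptrace1 \<gamma> \<otimes> mat 1 - nchoi \<Phi>"
      by (simp add: op_eq_iff \<rho> sum_subtractf sum_\<Psi> flip: sum_distrib_right)
    finally have "ptrace1 \<gamma> \<in> feasible UNIV (nchoi \<Phi>)"
      by (intro feasibleI psd) auto
    then show "\<exists>\<sigma>\<in>feasible UNIV (nchoi \<Phi>). trace \<sigma> = trace \<gamma>"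
      using trace_ptrace1 by blast
  next
    fix \<sigma> assume \<sigma>: "\<sigma> \<in> feasible UNIV (nchoi \<Phi>)"
    have "psd (reindex (\<lambda>((p, b), y). (p, (b, y))) (nchoi \<Psi> \<otimes> (\<sigma> \<otimes> mat 1 - nchoi \<Phi>)))"
      by (intro psd_reindex psd_kron psd feasibleD(2)[OF \<sigma>])
    also have "reindex (\<lambda>((p, b), y). (p, (b, y))) (nchoi \<Psi> \<otimes> (\<sigma> \<otimes> mat 1 - nchoi \<Phi>))
        = (nchoi \<Psi> \<otimes> \<sigma>) \<otimes> mat 1 - ?\<rho>"
      by (simp add: op_eq_iff \<rho> algebra_simps)
    finally have "nchoi \<Psi> \<otimes> \<sigma> \<in> feasible marginal_space ?\<rho>"
      using assms(1)
      by (intro feasibleI)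
        (auto simp: marginal_space_def \<rho> channel_def sum_\<Psi> nchoi_marginal
          intro!: psd_reindex psd_kron psd simp flip: sum_distrib_right)
    then show "\<exists>\<gamma>\<in>feasible marginal_space ?\<rho>. trace \<gamma> = trace \<sigma>"
      by (intro bexI[of _ "nchoi \<Psi> \<otimes> \<sigma>"]) (simp_all add: trace_kron tr)
  qed
  then show ?thesis by (simp add: Hmin_ext_eq Hmin_ext1_def Hmin_eq)
qed

section \<open>Relabelled systems, and a criterion for the marginal constraint\<close>

lemma nchoi_reindex_map:
  fixes \<Phi> :: "'s1::finite op \<Rightarrow> 't1::finite op" and f :: "'s2::finite \<Rightarrow> 's1" and g :: "'t2::finite \<Rightarrow> 't1"
  assumes "bij f"
  shows "nchoi (reindex_map f g \<Phi>) = reindex (map_prod f g) (nchoi \<Phi>)"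
proof -
  have "inv f i = p \<longleftrightarrow> i = f p" for i p
    using bij_inv_eq_iff[OF assms] by metis
  then have m: "reindex (inv f) (munit p q) = munit (f p) (f q)" for p q
    by (simp add: op_eq_iff munit_nth)
  have "CARD('s2) = CARD('s1)" by (rule bij_betw_same_card) fact
  then show ?thesis by (simp add: op_eq_iff nchoi_nth reindex_map_def m)
qed

text \<open>Any candidate \<open>G\<close> for the B0 marginal may be supplied: summing over A0
  shows that it is the actual one, which also settles the trace.\<close>

lemma marginal_spaceI:
  fixes \<gamma> :: "(('a0::finite \<times> 'a1::finite) \<times> 'b0::finite) op"
  assumes "\<And>a b a' b'. (\<Sum>x\<in>UNIV. \<gamma> $ ((a, x), b) $ ((a', x), b'))
    = of_bool (a = a') * G $ b $ b' / of_nat CARD('a0)"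
  shows "\<gamma> \<in> marginal_space" "trace \<gamma> = trace G"
proof -
  have "(\<Sum>p\<in>UNIV. \<gamma> $ (p, b) $ (p, b')) = G $ b $ b'" for b b'
    unfolding sum_UNIV_prod assms by simp
  then have "ptrace1 \<gamma> = G" by (simp add: op_eq_iff)
  then show "trace \<gamma> = trace G" using trace_ptrace1 by metis
  show "\<gamma> \<in> marginal_space"
    using assms \<open>ptrace1 \<gamma> = G\<close> by (auto simp: marginal_space_def)
qed

lemma marginal_spaceD:
  fixes \<gamma> :: "(('a0::finite \<times> 'a1::finite) \<times> 'b0::finite) op"
  assumes "\<gamma> \<in> marginal_space"
  shows "(\<Sum>x\<in>UNIV. \<gamma> $ ((a, x), b) $ ((a', x), b'))
    = of_bool (a = a') * ptrace1 \<gamma> $ b $ b' / of_nat CARD('a0)"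
  using assms by (auto simp: marginal_space_def)

section \<open>Conditioning\<close>

lemma bij_swap_right: "bij (\<lambda>((a, c), b). ((a, b), c))"
  by (rule o_bij[of "\<lambda>((a, b), c). ((a, c), b)"]) auto

text \<open>On Choi operators, feeding \<gamma> into the third input and discarding the third output
  is the positive map \<open>T\<close>. It leaves the B1 leg alone, so it takes
  \<open>\<sigma> \<otimes> mat 1\<close> to an operator of the same shape.\<close>

lemma Hmin_ext_conditioning:
  fixes \<Lambda> :: "(('a0::finite \<times> 'b0::finite) \<times> 'd0::finite) op
    \<Rightarrow> (('a1::finite \<times> 'b1::finite) \<times> 'd1::finite) op"
  assumes "channel \<Lambda>" "density_matrix \<gamma>"
  shows "Hmin_ext (reindex_map (\<lambda>((a, c), b). ((a, b), c)) (\<lambda>((a, c), b). ((a, b), c)) \<Lambda>)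
    \<le> Hmin_ext (\<lambda>\<rho>. ptrace2 (\<Lambda> (\<rho> \<otimes> \<gamma>)))"
proof -
  define \<Upsilon> where "\<Upsilon> = reindex_map (\<lambda>((a, c), b). ((a, b), c)) (\<lambda>((a, c), b). ((a, b), c)) \<Lambda>"
  define \<Omega> where "\<Omega> = (\<lambda>\<rho>. ptrace2 (\<Lambda> (\<rho> \<otimes> \<gamma>)))"
  define d :: complex where "d = of_nat CARD('d0)"
  have "d \<noteq> 0" by (simp add: d_def)
  have \<Lambda>: "completely_positive \<Lambda>" "trace_preserving \<Lambda>" "op_linear \<Lambda>"
    using assms(1) by (auto simp: channel_def channel_op_linear[OF assms(1)])
  have \<gamma>: "psd \<gamma>" "trace \<gamma> = 1" using assms(2) by (auto simp: density_matrix_def)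
  \<comment> \<open>The entrywise product with \<gamma>, summed over \<open>c\<close> and
    \<open>c'\<close>, inserts the state, and the sum over \<open>z\<close> discards the output. The
    factor \<open>d\<close> undoes the share of the normalisation that belongs to the closed
    input.\<close>
  define T where "T D = cscale d (\<Sum>z\<in>UNIV. \<chi> P Q. \<Sum>c\<in>UNIV. \<Sum>c'\<in>UNIV.
      (case P of (((a, x), b), y) \<Rightarrow> case Q of (((a', x'), b'), y') \<Rightarrow>
        D $ ((((a, c), (x, z)), b), y) $ ((((a', c'), (x', z)), b'), y') * \<gamma> $ c $ c'))"
    for D :: "(((('a0 \<times> 'd0) \<times> ('a1 \<times> 'd1)) \<times> 'b0) \<times> 'b1) op"
  have T_psd: "psd (T D)" if "psd D" for D
  proof -
    have "psd (\<chi> P Q. \<Sum>c\<in>UNIV. \<Sum>c'\<in>UNIV. (\<chi> R S.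
        D $ ((\<lambda>((((a, x), b), y), c). ((((a, c), (x, z)), b), y)) R)
          $ ((\<lambda>((((a, x), b), y), c). ((((a, c), (x, z)), b), y)) S)
        * \<gamma> $ snd R $ snd S) $ (P, c) $ (Q, c'))" for z
      by (intro psd_block_sum psd_hadamard_reindex that \<gamma>)
    then have "psd (cscale (of_real (real CARD('d0))) (\<Sum>z\<in>UNIV. \<chi> P Q. \<Sum>c\<in>UNIV. \<Sum>c'\<in>UNIV. (\<chi> R S.
        D $ ((\<lambda>((((a, x), b), y), c). ((((a, c), (x, z)), b), y)) R)
          $ ((\<lambda>((((a, x), b), y), c). ((((a, c), (x, z)), b), y)) S)
        * \<gamma> $ snd R $ snd S) $ (P, c) $ (Q, c')))"
      by (intro psd_cscale psd_sum) simp
    then show ?thesis by (simp add: T_def d_def split_def)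
  qed
  have \<Upsilon>: "ext_choi \<Upsilon> $ ((((a, c), (x, z)), b), y) $ ((((a', c'), (x', z')), b'), y')
      = nchoi \<Lambda> $ (((a, b), c), ((x, y), z)) $ (((a', b'), c'), ((x', y'), z'))" for a c x z b y a' c' x' z' b' y'
    by (simp add: \<Upsilon>_def ext_choi_def nchoi_reindex_map bij_swap_right)
  have \<Omega>: "ext_choi \<Omega> = T (ext_choi \<Upsilon>)"
  proof -
    have "\<Omega> (munit (a, b) (a', b')) $ (x, y) $ (x', y')
        = (\<Sum>z\<in>UNIV. \<Sum>c\<in>UNIV. \<Sum>c'\<in>UNIV. \<gamma> $ c $ c'
            * \<Lambda> (munit ((a, b), c) ((a', b'), c')) $ ((x, y), z) $ ((x', y'), z))" for a b a' b' x y x' y'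
    proof -
      have "(\<Sum>p\<in>UNIV. \<Sum>q\<in>UNIV. (munit (a, b) (a', b') \<otimes> \<gamma>) $ p $ q * F p q)
          = (\<Sum>c\<in>UNIV. \<Sum>c'\<in>UNIV. \<gamma> $ c $ c' * F ((a, b), c) ((a', b'), c'))"
        for F :: "('a0 \<times> 'b0) \<times> 'd0 \<Rightarrow> ('a0 \<times> 'b0) \<times> 'd0 \<Rightarrow> complex"
      proof -
        have "(\<Sum>p\<in>UNIV. \<Sum>q\<in>UNIV. (munit (a, b) (a', b') \<otimes> \<gamma>) $ p $ q * F p q)
          = (\<Sum>i\<in>UNIV. \<Sum>j\<in>UNIV. munit (a, b) (a', b') $ i $ j *
              (\<Sum>c\<in>UNIV. \<Sum>c'\<in>UNIV. \<gamma> $ c $ c' * F (i, c) (j, c')))"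
          unfolding sum_UNIV_prod[where 'a = "'a0 \<times> 'b0"]
          by (simp add: sum_distrib_left mult.assoc) (rule sum.cong[OF refl], rule sum.swap)
        then show ?thesis by (simp only: sum_munit)
      qed
      then show ?thesis
        by (simp add: \<Omega>_def op_linear_expand[OF \<Lambda>(3), of "_ \<otimes> _"] del: kron_nth)
    qed
    then show ?thesis
      by (simp add: op_eq_iff T_def \<Upsilon>) (simp add: ext_choi_def nchoi_nth d_def sum_divide_distrib
          sum_distrib_left mult_ac)
  qed
  have tp\<Omega>: "trace_preserving \<Omega>"
    using \<Lambda>(2) \<gamma>(2) by (simp add: trace_preserving_def \<Omega>_def trace_ptrace2 trace_kron)
  have "trace (reindex (inv (\<lambda>((a, c), b). ((a, b), c))) X) = trace X" for X :: "(('a0 \<times> 'd0) \<times> 'b0) op"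
    by (intro trace_reindex bij_imp_bij_inv bij_swap_right)
  then have tp\<Upsilon>: "trace_preserving \<Upsilon>"
    using \<Lambda>(2) by (simp add: trace_preserving_def \<Upsilon>_def reindex_map_def trace_reindex bij_swap_right)
  have psd\<Upsilon>: "psd (ext_choi \<Upsilon>)"
    unfolding ext_choi_def \<Upsilon>_def nchoi_reindex_map[OF bij_swap_right]
    by (intro psd_reindex psd_nchoi \<Lambda>)
  have "- log 2 (minval marginal_space (ext_choi \<Upsilon>)) \<le> - log 2 (minval marginal_space (ext_choi \<Omega>))"
  proof (rule neg_log_minval_le)
    fix \<sigma> assume \<sigma>: "\<sigma> \<in> feasible marginal_space (ext_choi \<Upsilon>)"
    define \<tau> :: "(('a0 \<times> 'a1) \<times> 'b0) op" where "\<tau> = (\<chi> P Q. d * (\<Sum>z\<in>UNIV. \<Sum>c\<in>UNIV. \<Sum>c'\<in>UNIV.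
      (case P of ((a, x), b) \<Rightarrow> case Q of ((a', x'), b') \<Rightarrow>
        \<sigma> $ (((a, c), (x, z)), b) $ (((a', c'), (x', z)), b') * \<gamma> $ c $ c')))"
    have \<tau>: "(\<Sum>x\<in>UNIV. \<tau> $ ((a, x), b) $ ((a', x), b'))
        = of_bool (a = a') * ptrace1 \<sigma> $ b $ b' / of_nat CARD('a0)" for a b a' b'
    proof -
      have "(\<Sum>x\<in>UNIV. \<tau> $ ((a, x), b) $ ((a', x), b'))
          = d * (\<Sum>c\<in>UNIV. \<Sum>c'\<in>UNIV. (\<Sum>p\<in>UNIV. \<sigma> $ (((a, c), p), b) $ (((a', c'), p), b')) * \<gamma> $ c $ c')"
        unfolding sum_UNIV_prod \<tau>_def sum_distrib_left sum_distrib_right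
        by simp (subst (2) sum.swap, subst (3) sum.swap, subst sum.swap, subst (2) sum.swap, rule refl)
      \<comment> \<open>The constraint on \<sigma> makes it maximally mixed on the third input as
        well: only \<open>c = c'\<close> survives, the weight \<open>1 / d\<close> cancels
        \<open>d\<close>, and the trace of \<gamma> remains.\<close>
      also have "\<dots> = (\<Sum>c\<in>UNIV. \<Sum>c'\<in>UNIV. if c = c' then
           of_bool (a = a') * ptrace1 \<sigma> $ b $ b' / of_nat CARD('a0) * \<gamma> $ c $ c else 0)"
        unfolding marginal_spaceD[OF feasibleD(1)[OF \<sigma>]] sum_distrib_left
        using \<open>d \<noteq> 0\<close> by (intro sum.cong refl) (auto simp: d_def)
      also have "\<dots> = of_bool (a = a') * ptrace1 \<sigma> $ b $ b' / of_nat CARD('a0) * trace \<gamma>"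
        by (simp add: trace_eq_sum sum_distrib_left)
      finally show ?thesis by (simp add: \<gamma>)
    qed
    have "psd (T (\<sigma> \<otimes> mat 1 - ext_choi \<Upsilon>))"
      by (intro T_psd feasibleD(2)[OF \<sigma>])
    also have "T (\<sigma> \<otimes> mat 1 - ext_choi \<Upsilon>) = \<tau> \<otimes> mat 1 - ext_choi \<Omega>"
      unfolding \<Omega>
      by (simp add: op_eq_iff T_def \<tau>_def sum_subtractf left_diff_distrib right_diff_distrib)
        (simp add: sum_distrib_left sum_distrib_right mult_ac)
    finally have "\<tau> \<in> feasible marginal_space (ext_choi \<Omega>)"
      using marginal_spaceI(1)[of \<tau>, OF \<tau>] psd\<Upsilon> by (intro feasibleI) (simp_all add: \<Omega> T_psd)
    moreover have "trace \<tau> = trace \<sigma>"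
      using marginal_spaceI(2)[of \<tau>, OF \<tau>] trace_ptrace1 by metis
    ultimately show "\<exists>\<tau>\<in>feasible marginal_space (ext_choi \<Omega>). trace \<tau> = trace \<sigma>" by blast
  qed (use psd\<Upsilon> T_psd in \<open>simp_all add: op_space_marginal_space \<Omega>[symmetric] trace_ext_choi tp\<Omega> tp\<Upsilon>, simp add: \<Omega>\<close>)
  then show ?thesis unfolding Hmin_ext_eq \<Upsilon>_def \<Omega>_def .
qed

section \<open>Additivity\<close>

lemma trace_mult_diff_right: "trace (M ** (A - B)) = trace (M ** A) - trace (M ** B)"
  for M A B :: "'s::finite op"
  by (simp add: trace_mult_eq_sum sum_subtractf right_diff_distrib)

lemma trace_mult_munit: "trace (M ** munit i j) = M $ j $ i"
proof -
  have "trace (M ** munit i j) = (\<Sum>k\<in>UNIV. \<Sum>l\<in>UNIV. munit i j $ k $ l * M $ l $ k)"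
    unfolding trace_mult_eq_sum by (subst sum.swap) (simp add: mult.commute)
  then show ?thesis by (simp add: sum_munit)
qed

lemma munit_marginal:
  "(\<Sum>x'\<in>UNIV. munit ((a, x), b) ((a', y), b') $ ((c, x'), d) $ ((c', x'), d'))
    = of_bool (x = y) * munit (a, b) (a', b') $ (c, d) $ (c', d')"
proof -
  have "(\<Sum>x'\<in>UNIV. munit ((a, x), b) ((a', y), b') $ ((c, x'), d) $ ((c', x'), d'))
     = (\<Sum>x'\<in>UNIV. if x' = x then of_bool (x = y) * munit (a, b) (a', b') $ (c, d) $ (c', d') else 0)"
    by (intro sum.cong refl) (auto simp: munit_nth)
  then show ?thesis by simp
qed

text \<open>The dual variable: on \<open>marginal_space\<close> a functional \<open>trace (m ** \<sigma>)\<close> agrees with the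
  trace iff \<open>m = \<beta> \<otimes> mat 1\<close> with the identity on \<open>A1\<close>, and the trace of \<open>\<beta>\<close> over \<open>A0\<close>
  is \<open>CARD('a0)\<close> times the identity.\<close>

definition dual_form ::
  "(('a0::finite \<times> 'a1::finite) \<times> 'b0::finite) op \<Rightarrow> ('a0 \<times> 'b0) op \<Rightarrow> bool" where
  "dual_form m \<beta> \<longleftrightarrow>
     (\<forall>a x b a' x' b'. m $ ((a, x), b) $ ((a', x'), b') = of_bool (x = x') * \<beta> $ (a, b) $ (a', b'))
     \<and> (\<forall>b b'. (\<Sum>a\<in>UNIV. \<beta> $ (a, b) $ (a, b')) = of_bool (b = b') * of_nat CARD('a0))"

text \<open>Units off-diagonal on A1, and differences of units that disagree only in a common A1
  label, have zero marginal and zero trace, so \<open>m\<close> pairs to zero with them: its A1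
  blocks are diagonal and equal. Units summed over A0 then determine the marginal of
  \<beta>.\<close>

lemma dual_form_exists:
  fixes m :: "(('a0::finite \<times> 'a1::finite) \<times> 'b0::finite) op"
  assumes m: "\<And>\<sigma>. \<sigma> \<in> marginal_space \<Longrightarrow> trace (m ** \<sigma>) = trace \<sigma>"
  shows "\<exists>\<beta>. dual_form m \<beta>"
proof -
  let ?u = "undefined :: 'a1"
  define \<beta> :: "('a0 \<times> 'b0) op" where
    "\<beta> = (\<chi> p q. m $ ((fst p, ?u), snd p) $ ((fst q, ?u), snd q))"
  have off: "m $ ((a, x), b) $ ((a', x'), b') = 0" if "x \<noteq> x'" for a x b a' x' b'
  proof -
    let ?\<sigma> = "munit ((a', x'), b') ((a, x), b)"
    have "?\<sigma> \<in> marginal_space"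
      using that by (intro marginal_spaceI(1)[where G = 0]) (simp add: munit_marginal)
    with m[of ?\<sigma>] that show ?thesis by (simp add: trace_mult_munit trace_munit)
  qed
  have diag: "m $ ((a, x), b) $ ((a', x), b') = \<beta> $ (a, b) $ (a', b')" for a x b a' b'
  proof -
    let ?\<sigma> = "munit ((a', x), b') ((a, x), b) - munit ((a', ?u), b') ((a, ?u), b)"
    have "?\<sigma> \<in> marginal_space"
      by (intro marginal_spaceI(1)[where G = 0]) (simp add: munit_marginal sum_subtractf)
    with m[of ?\<sigma>] show ?thesis
      by (simp add: trace_mult_diff_right trace_sub trace_mult_munit trace_munit \<beta>_def)
  qed
  have "(\<Sum>a\<in>UNIV. \<beta> $ (a, b) $ (a, b')) = of_bool (b = b') * of_nat CARD('a0)" for b b'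
  proof -
    let ?\<sigma> = "\<Sum>a\<in>(UNIV :: 'a0 set). munit ((a, ?u), b') ((a, ?u), b)"
    have "?\<sigma> \<in> marginal_space" "trace ?\<sigma> = trace (cscale (of_nat CARD('a0)) (munit b' b))"
    proof -
      have *: "(\<Sum>x\<in>UNIV. ?\<sigma> $ ((c, x), d) $ ((c', x), d'))
          = of_bool (c = c') * cscale (of_nat CARD('a0)) (munit b' b) $ d $ d' / of_nat CARD('a0)" for c d c' d'
      proof -
        have "(\<Sum>x\<in>UNIV. ?\<sigma> $ ((c, x), d) $ ((c', x), d')) = (\<Sum>a\<in>UNIV. munit (a, b') (a, b) $ (c, d) $ (c', d'))"
          unfolding sum_component by (subst sum.swap) (simp add: munit_marginal)
        also have "\<dots> = (\<Sum>a\<in>UNIV. if a = c then of_bool (c = c') * munit b' b $ d $ d' else 0)"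
          by (intro sum.cong refl) (auto simp: munit_nth)
        finally show ?thesis by simp
      qed
      show "?\<sigma> \<in> marginal_space" by (rule marginal_spaceI(1)[OF *])
      show "trace ?\<sigma> = trace (cscale (of_nat CARD('a0)) (munit b' b))"
        by (rule marginal_spaceI(2)[OF *])
    qed
    moreover have "trace (m ** ?\<sigma>) = (\<Sum>a\<in>UNIV. trace (m ** munit ((a, ?u), b') ((a, ?u), b)))"
    proof -
      have "trace (m ** (\<Sum>a\<in>K. X a)) = (\<Sum>a\<in>K. trace (m ** X a))" for K :: "'a0 set" and X
        by (induction K rule: infinite_finite_induct) (simp_all add: matrix_add_ldistrib trace_add trace_eq_sum[of 0])
      then show ?thesis .
    qed
    ultimately show ?thesis
      using m[of ?\<sigma>] by (auto simp: trace_mult_munit \<beta>_def trace_cscale trace_munit)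
  qed
  with off diag have "dual_form m \<beta>" by (auto simp: dual_form_def)
  then show ?thesis ..
qed

text \<open>The A1 sum brings in the marginal of \<sigma>, which forces equal A0 labels with weight
  one over the dimension of A0; the A0 trace of \<beta> cancels that weight. Through this converse,
  tensor products of dual solutions become dual solutions.\<close>

lemma dual_form_trace:
  fixes m :: "(('a0::finite \<times> 'a1::finite) \<times> 'b0::finite) op"
  assumes "dual_form m \<beta>" "\<sigma> \<in> marginal_space"
  shows "trace (m ** \<sigma>) = trace \<sigma>"
proof -
  have m: "m $ ((a, x), b) $ ((a', x'), b') = of_bool (x = x') * \<beta> $ (a, b) $ (a', b')"
    and \<beta>: "(\<Sum>a\<in>UNIV. \<beta> $ (a, b) $ (a, b')) = of_bool (b = b') * of_nat CARD('a0)" for a x b a' x' b'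
    using assms(1) by (auto simp: dual_form_def)
  have "trace (m ** \<sigma>) = (\<Sum>a\<in>UNIV. \<Sum>x\<in>UNIV. \<Sum>b\<in>UNIV. \<Sum>a'\<in>UNIV. \<Sum>x'\<in>UNIV. \<Sum>b'\<in>UNIV.
      of_bool (x = x') * \<beta> $ (a, b) $ (a', b') * \<sigma> $ ((a', x'), b') $ ((a, x), b))"
    unfolding trace_mult_eq_sum sum_UNIV_prod m ..
  also have "\<dots> = (\<Sum>a\<in>UNIV. \<Sum>x\<in>UNIV. \<Sum>b\<in>UNIV. \<Sum>a'\<in>UNIV. \<Sum>b'\<in>UNIV.
      \<beta> $ (a, b) $ (a', b') * \<sigma> $ ((a', x), b') $ ((a, x), b))"
  proof (intro sum.cong refl)
    fix a x b a'
    have "(\<Sum>x'\<in>UNIV. \<Sum>b'\<in>UNIV. of_bool (x = x') * \<beta> $ (a, b) $ (a', b') * \<sigma> $ ((a', x'), b') $ ((a, x), b))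
       = (\<Sum>x'\<in>UNIV. if x = x' then \<Sum>b'\<in>UNIV. \<beta> $ (a, b) $ (a', b') * \<sigma> $ ((a', x), b') $ ((a, x), b) else 0)"
      by (intro sum.cong refl) auto
    then show "(\<Sum>x'\<in>UNIV. \<Sum>b'\<in>UNIV. of_bool (x = x') * \<beta> $ (a, b) $ (a', b') * \<sigma> $ ((a', x'), b') $ ((a, x), b))
       = (\<Sum>b'\<in>UNIV. \<beta> $ (a, b) $ (a', b') * \<sigma> $ ((a', x), b') $ ((a, x), b))" by simp
  qed
  also have "\<dots> = (\<Sum>a\<in>UNIV. \<Sum>b\<in>UNIV. \<Sum>a'\<in>UNIV. \<Sum>b'\<in>UNIV.
      \<beta> $ (a, b) $ (a', b') * (\<Sum>x\<in>UNIV. \<sigma> $ ((a', x), b') $ ((a, x), b)))"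
    unfolding sum_distrib_left
    by (intro sum.cong refl, subst sum.swap, intro sum.cong refl, subst sum.swap, intro sum.cong refl, rule sum.swap)
  also have "\<dots> = (\<Sum>a\<in>UNIV. \<Sum>b\<in>UNIV. \<Sum>b'\<in>UNIV. \<beta> $ (a, b) $ (a, b') * ptrace1 \<sigma> $ b' $ b / of_nat CARD('a0))"
  proof (intro sum.cong refl)
    fix a b
    have "(\<Sum>a'\<in>UNIV. \<Sum>b'\<in>UNIV. \<beta> $ (a, b) $ (a', b') * (\<Sum>x\<in>UNIV. \<sigma> $ ((a', x), b') $ ((a, x), b)))
       = (\<Sum>a'\<in>UNIV. if a' = a then \<Sum>b'\<in>UNIV. \<beta> $ (a, b) $ (a, b') * ptrace1 \<sigma> $ b' $ b / of_nat CARD('a0) else 0)"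
      unfolding marginal_spaceD[OF assms(2)] by (intro sum.cong refl) auto
    then show "(\<Sum>a'\<in>UNIV. \<Sum>b'\<in>UNIV. \<beta> $ (a, b) $ (a', b') * (\<Sum>x\<in>UNIV. \<sigma> $ ((a', x), b') $ ((a, x), b)))
       = (\<Sum>b'\<in>UNIV. \<beta> $ (a, b) $ (a, b') * ptrace1 \<sigma> $ b' $ b / of_nat CARD('a0))" by simp
  qed
  also have "\<dots> = (\<Sum>b\<in>UNIV. \<Sum>b'\<in>UNIV. (\<Sum>a\<in>UNIV. \<beta> $ (a, b) $ (a, b')) * ptrace1 \<sigma> $ b' $ b / of_nat CARD('a0))"
    unfolding sum_distrib_right sum_divide_distrib
    by (subst sum.swap, intro sum.cong refl, rule sum.swap)
  also have "\<dots> = (\<Sum>b\<in>UNIV. \<Sum>b'\<in>UNIV. if b = b' then ptrace1 \<sigma> $ b $ b else 0)"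
    unfolding \<beta> by (intro sum.cong refl) auto
  also have "\<dots> = trace (ptrace1 \<sigma>)" by (simp add: trace_eq_sum)
  finally show ?thesis by (simp only: trace_ptrace1)
qed

text \<open>\<open>ptrace2\<close> is the adjoint of tensoring with the identity, so dual
  feasibility concerns only the marginal of \<alpha>.\<close>

lemma trace_mult_kron_mat_1: "trace (\<alpha> ** (\<sigma> \<otimes> mat 1)) = trace (ptrace2 \<alpha> ** \<sigma>)"
proof -
  have "(\<Sum>j\<in>UNIV. \<alpha> $ p $ j * (\<sigma> \<otimes> mat 1) $ j $ p) = (\<Sum>j\<in>UNIV. \<alpha> $ p $ (j, snd p) * \<sigma> $ j $ fst p)" for p
  proof -
    have "(\<Sum>j\<in>UNIV. \<alpha> $ p $ j * (\<sigma> \<otimes> mat 1) $ j $ p)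
        = (\<Sum>j\<in>UNIV. \<Sum>k\<in>UNIV. if k = snd p then \<alpha> $ p $ (j, snd p) * \<sigma> $ j $ fst p else 0)"
      unfolding sum_UNIV_prod by (intro sum.cong refl) (auto simp: mat_nth)
    then show ?thesis by simp
  qed
  then have "trace (\<alpha> ** (\<sigma> \<otimes> mat 1))
      = (\<Sum>i\<in>UNIV. \<Sum>k\<in>UNIV. \<Sum>j\<in>UNIV. \<alpha> $ (i, k) $ (j, k) * \<sigma> $ j $ i)"
    by (simp add: trace_mult_eq_sum sum_UNIV_prod)
  also have "\<dots> = trace (ptrace2 \<alpha> ** \<sigma>)"
    unfolding trace_mult_eq_sum ptrace2_nth sum_distrib_right by (intro sum.cong refl, rule sum.swap)
  finally show ?thesis .
qed

lemma trace_mult_kron: "trace ((A \<otimes> A') ** (B \<otimes> B')) = trace (A ** B) * trace (A' ** B')"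
proof -
  have "trace ((A \<otimes> A') ** (B \<otimes> B'))
      = (\<Sum>i\<in>UNIV. \<Sum>k\<in>UNIV. \<Sum>j\<in>UNIV. \<Sum>l\<in>UNIV. (A $ i $ j * B $ j $ i) * (A' $ k $ l * B' $ l $ k))"
    by (simp add: trace_mult_eq_sum sum_UNIV_prod mult_ac)
  also have "\<dots> = (\<Sum>i\<in>UNIV. \<Sum>k\<in>UNIV. (\<Sum>j\<in>UNIV. A $ i $ j * B $ j $ i) * (\<Sum>l\<in>UNIV. A' $ k $ l * B' $ l $ k))"
    by (simp only: sum_product)
  finally show ?thesis by (simp only: sum_product trace_mult_eq_sum)
qed

lemma trace_mult_reindex:
  assumes "bij f"
  shows "trace (reindex f A ** reindex f B) = trace (A ** B)"
proof -
  have "trace (reindex f A ** reindex f B) = (\<Sum>i\<in>UNIV. \<Sum>j\<in>UNIV. A $ f i $ j * B $ j $ f i)"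
    unfolding trace_mult_eq_sum reindex_nth
    by (intro sum.cong refl) (rule sum.reindex_bij_betw[OF assms])
  also have "\<dots> = trace (A ** B)"
    unfolding trace_mult_eq_sum by (rule sum.reindex_bij_betw[OF assms])
  finally show ?thesis .
qed

lemma ext_choi_dual:
  assumes "channel \<Omega>"
  obtains \<alpha> \<beta> where "psd \<alpha>" "dual_form (ptrace2 \<alpha>) \<beta>"
    "minval marginal_space (ext_choi \<Omega>) \<le> Re (trace (\<alpha> ** ext_choi \<Omega>))"
proof -
  have psd: "psd (ext_choi \<Omega>)" and tr: "trace (ext_choi \<Omega>) = 1"
    using assms by (auto simp: channel_def psd_ext_choi trace_ext_choi)
  then have "0 < Re (trace (ext_choi \<Omega>))" by simp
  from minval_attained[OF psd this op_space_marginal_space]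
  have "\<And>\<tau>. \<tau> \<in> feasible marginal_space (ext_choi \<Omega>) \<Longrightarrow>
      minval marginal_space (ext_choi \<Omega>) \<le> Re (trace \<tau>)" by metis
  from strong_duality[OF psd_imp_hermitian[OF psd] op_space_marginal_space this] obtain \<alpha>
    where \<alpha>: "psd \<alpha>" "\<And>\<sigma>. \<sigma> \<in> marginal_space \<Longrightarrow> trace (\<alpha> ** (\<sigma> \<otimes> mat 1)) = trace \<sigma>"
      "minval marginal_space (ext_choi \<Omega>) \<le> Re (trace (\<alpha> ** ext_choi \<Omega>))" by blast
  from \<alpha>(2) have "\<exists>\<beta>. dual_form (ptrace2 \<alpha>) \<beta>"
    by (intro dual_form_exists) (simp add: trace_mult_kron_mat_1)
  with \<alpha> that show ?thesis by blast
qed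

lemma Hmin_ext_additive:
  fixes \<Omega> :: "('a0::finite \<times> 'b0::finite) op \<Rightarrow> ('a1::finite \<times> 'b1::finite) op"
    and \<Gamma> :: "('a2::finite \<times> 'b2::finite) op \<Rightarrow> ('a3::finite \<times> 'b3::finite) op"
  assumes "channel \<Omega>" "channel \<Gamma>"
  shows "Hmin_ext (bipartite_tensor \<Omega> \<Gamma>) = Hmin_ext \<Omega> + Hmin_ext \<Gamma>"
proof -
  let ?m = "\<lambda>\<Phi>. minval marginal_space (ext_choi \<Phi>)"
  define F where "F = (\<lambda>((((a :: 'a0, c :: 'a2), (x :: 'a1, z :: 'a3)), (b :: 'b0, d :: 'b2)), (y :: 'b1, w :: 'b3)).
    ((((a, x), b), y), (((c, z), d), w)))"
  define G where "G = (\<lambda>(((a :: 'a0, c :: 'a2), (x :: 'a1, z :: 'a3)), (b :: 'b0, d :: 'b2)).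
    (((a, x), b), ((c, z), d)))"
  have bijF: "bij F" unfolding F_def
    by (rule o_bij[of "\<lambda>((((a, x), b), y), (((c, z), d), w)). ((((a, c), (x, z)), (b, d)), (y, w))"]) auto
  have bijG: "bij G" unfolding G_def
    by (rule o_bij[of "\<lambda>(((a, x), b), ((c, z), d)). (((a, c), (x, z)), (b, d))"]) auto
  have bij: "bij (\<lambda>((a :: 'a, c :: 'c), (b :: 'b, d :: 'd)). ((a, b), (c, d)))"
    by (rule o_bij[of "\<lambda>((a, b), (c, d)). ((a, c), (b, d))"]) auto
  have psd: "psd (ext_choi \<Omega>)" "psd (ext_choi \<Gamma>)"
    and tr: "trace (ext_choi \<Omega>) = 1" "trace (ext_choi \<Gamma>) = 1"
    using assms by (auto simp: channel_def psd_ext_choi trace_ext_choi)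
  have ext: "ext_choi (bipartite_tensor \<Omega> \<Gamma>) = reindex F (ext_choi \<Omega> \<otimes> ext_choi \<Gamma>)"
    by (simp add: op_eq_iff ext_choi_def bipartite_tensor_def nchoi_reindex_map bij nchoi_tensor_map F_def)
  have psd': "psd (ext_choi (bipartite_tensor \<Omega> \<Gamma>))"
    unfolding ext by (intro psd_reindex psd_kron psd)
  have tr': "trace (ext_choi (bipartite_tensor \<Omega> \<Gamma>)) = 1"
    unfolding ext by (simp add: trace_reindex bijF trace_kron tr)
  have pos: "0 < Re (trace (ext_choi \<Omega>))" "0 < Re (trace (ext_choi \<Gamma>))"
    "0 < Re (trace (ext_choi (bipartite_tensor \<Omega> \<Gamma>)))" using tr tr' by simp_all
  note att = minval_attained[OF psd(1) pos(1) op_space_marginal_space]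
    minval_attained[OF psd(2) pos(2) op_space_marginal_space]
    minval_attained[OF psd' pos(3) op_space_marginal_space]
  have mpos: "0 < ?m \<Omega>" "0 < ?m \<Gamma>"
    using att(1,2) by metis+
  have le: "?m (bipartite_tensor \<Omega> \<Gamma>) \<le> ?m \<Omega> * ?m \<Gamma>"
  proof -
    obtain \<sigma> where \<sigma>: "\<sigma> \<in> feasible marginal_space (ext_choi \<Omega>)" "Re (trace \<sigma>) = ?m \<Omega>"
      using att(1) by metis
    obtain \<tau> where \<tau>: "\<tau> \<in> feasible marginal_space (ext_choi \<Gamma>)" "Re (trace \<tau>) = ?m \<Gamma>"
      using att(2) by metis
    let ?\<gamma> = "reindex G (\<sigma> \<otimes> \<tau>)"
    have psd\<tau>: "psd \<sigma>" "psd \<tau>" using \<sigma> \<tau> feasible_psd psd by blast+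
    have "psd (mat 1 :: 'b3 op)" using psd_mat[of 1] by simp
    \<comment> \<open>Telescoping: \<open>S \<otimes> S' - R \<otimes> R' = (S - R) \<otimes> S' + R
      \<otimes> (S' - R')\<close>, a sum of tensor products of positive operators.\<close>
    then have "psd (reindex F ((\<sigma> \<otimes> mat 1 - ext_choi \<Omega>) \<otimes> (\<tau> \<otimes> mat 1)
        + ext_choi \<Omega> \<otimes> (\<tau> \<otimes> mat 1 - ext_choi \<Gamma>)))"
      by (intro psd_reindex psd_add psd_kron feasibleD(2)[OF \<sigma>(1)] feasibleD(2)[OF \<tau>(1)] psd psd\<tau>)
    also have "reindex F ((\<sigma> \<otimes> mat 1 - ext_choi \<Omega>) \<otimes> (\<tau> \<otimes> mat 1)
        + ext_choi \<Omega> \<otimes> (\<tau> \<otimes> mat 1 - ext_choi \<Gamma>)) = ?\<gamma> \<otimes> mat 1 - ext_choi (bipartite_tensor \<Omega> \<Gamma>)"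
      unfolding ext by (simp add: op_eq_iff F_def G_def mat_nth algebra_simps)
    finally have "?\<gamma> \<in> feasible marginal_space (ext_choi (bipartite_tensor \<Omega> \<Gamma>))"
    proof (intro feasibleI psd')
      have "(\<Sum>p\<in>UNIV. ?\<gamma> $ (((a, c), p), (b, d)) $ (((a', c'), p), (b', d')))
          = of_bool ((a, c) = (a', c')) * (ptrace1 \<sigma> \<otimes> ptrace1 \<tau>) $ (b, d) $ (b', d') / of_nat CARD('a0 \<times> 'a2)"
        for a c b d a' c' b' d'
      proof -
        have "(\<Sum>p\<in>UNIV. ?\<gamma> $ (((a, c), p), (b, d)) $ (((a', c'), p), (b', d')))
          = (\<Sum>x\<in>UNIV. \<sigma> $ ((a, x), b) $ ((a', x), b')) * (\<Sum>z\<in>UNIV. \<tau> $ ((c, z), d) $ ((c', z), d'))"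
          by (simp add: sum_UNIV_prod G_def sum_product)
        then show ?thesis
          unfolding marginal_spaceD[OF feasibleD(1)[OF \<sigma>(1)]] marginal_spaceD[OF feasibleD(1)[OF \<tau>(1)]]
          by simp
      qed
      from this[of "fst i" "snd i" "fst k" "snd k" "fst j" "snd j" "fst l" "snd l" for i j k l]
      show "?\<gamma> \<in> marginal_space"
        by (intro marginal_spaceI(1)[of _ "ptrace1 \<sigma> \<otimes> ptrace1 \<tau>"]) (simp only: prod.collapse)
    qed
    then have "?m (bipartite_tensor \<Omega> \<Gamma>) \<le> Re (trace ?\<gamma>)"
      using att(3) by metis
    also have "Re (trace ?\<gamma>) = ?m \<Omega> * ?m \<Gamma>"
    proof -
      \<comment> \<open>Real parts multiply once one of the two traces is real.\<close>
      have "Im (trace \<sigma>) = 0"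
        using trace_mult_psd_nonneg(2)[OF psd\<tau>(1), of "mat 1"] psd_mat[of 1] by simp
      then show ?thesis using \<sigma> \<tau> by (simp add: trace_reindex bijG trace_kron)
    qed
    finally show ?thesis .
  qed
  \<comment> \<open>Weak duality: dual solutions reaching the two minima tensor to a feasible dual
    point of the joint program, whose value bounds the joint minimum from below.\<close>
  have ge: "?m \<Omega> * ?m \<Gamma> \<le> ?m (bipartite_tensor \<Omega> \<Gamma>)"
  proof -
    obtain \<alpha> \<beta> where \<alpha>: "psd \<alpha>" "dual_form (ptrace2 \<alpha>) \<beta>" "?m \<Omega> \<le> Re (trace (\<alpha> ** ext_choi \<Omega>))"
      using ext_choi_dual[OF assms(1)] by blast
    obtain \<alpha>' \<beta>' where \<alpha>': "psd \<alpha>'" "dual_form (ptrace2 \<alpha>') \<beta>'" "?m \<Gamma> \<le> Re (trace (\<alpha>' ** ext_choi \<Gamma>))"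
      using ext_choi_dual[OF assms(2)] by blast
    define \<alpha>2 where "\<alpha>2 = reindex F (\<alpha> \<otimes> \<alpha>')"
    have psd2: "psd \<alpha>2" unfolding \<alpha>2_def by (intro psd_reindex psd_kron \<alpha> \<alpha>')
    have "ptrace2 \<alpha>2 = reindex G (ptrace2 \<alpha> \<otimes> ptrace2 \<alpha>')"
      by (simp add: op_eq_iff \<alpha>2_def F_def G_def sum_UNIV_prod sum_product)
    moreover have "dual_form (reindex G (ptrace2 \<alpha> \<otimes> ptrace2 \<alpha>')) (reindex (\<lambda>((a, c), (b, d)). ((a, b), (c, d))) (\<beta> \<otimes> \<beta>'))"
      using \<alpha>(2) \<alpha>'(2) unfolding dual_form_def
      by (auto simp: G_def sum_UNIV_prod simp del: ptrace2_nth simp flip: sum_product)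
    ultimately have dual2: "trace (\<alpha>2 ** (\<gamma> \<otimes> mat 1)) = trace \<gamma>" if "\<gamma> \<in> marginal_space" for \<gamma>
      using dual_form_trace that by (simp add: trace_mult_kron_mat_1)
    obtain \<gamma> where \<gamma>: "\<gamma> \<in> feasible marginal_space (ext_choi (bipartite_tensor \<Omega> \<Gamma>))"
        "Re (trace \<gamma>) = ?m (bipartite_tensor \<Omega> \<Gamma>)"
      using att(3) by metis
    have "?m \<Omega> * ?m \<Gamma> \<le> Re (trace (\<alpha> ** ext_choi \<Omega>)) * Re (trace (\<alpha>' ** ext_choi \<Gamma>))"
      using \<alpha>(3) \<alpha>'(3) mpos by (intro mult_mono) auto
    also have "\<dots> = Re (trace (\<alpha>2 ** ext_choi (bipartite_tensor \<Omega> \<Gamma>)))"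
      using trace_mult_psd_nonneg(2)[OF \<alpha>(1) psd(1)]
      by (simp add: \<alpha>2_def ext trace_mult_reindex bijF trace_mult_kron)
    also have "\<dots> \<le> Re (trace (\<alpha>2 ** (\<gamma> \<otimes> mat 1)))"
      using trace_mult_psd_nonneg(1)[OF psd2 feasibleD(2)[OF \<gamma>(1)]]
      by (simp add: trace_mult_diff_right)
    also have "\<dots> = ?m (bipartite_tensor \<Omega> \<Gamma>)"
      using dual2[OF feasibleD(1)[OF \<gamma>(1)]] \<gamma>(2) by simp
    finally show ?thesis .
  qed
  from le ge have "?m (bipartite_tensor \<Omega> \<Gamma>) = ?m \<Omega> * ?m \<Gamma>" by simp
  with mpos show ?thesis by (simp add: Hmin_ext_eq log_mult_pos)
qed

section \<open>Superchannels\<close>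

text \<open>The map from A0 to A1 whose unnormalised Choi operator is the block of \<gamma> at row
  \<open>i\<close> and column \<open>j\<close> of B0. A single slice is in general neither positive
  nor trace-preserving.\<close>

definition choi_slice ::
  "(('a0::finite \<times> 'a1::finite) \<times> 'b0::finite) op \<Rightarrow> 'b0 \<Rightarrow> 'b0 \<Rightarrow> 'a0 op \<Rightarrow> 'a1 op" where
  "choi_slice \<gamma> i j X = (\<chi> a a'. \<Sum>p\<in>UNIV. \<Sum>q\<in>UNIV. X $ p $ q * \<gamma> $ ((p, a), i) $ ((q, a'), j))"

definition choi_component ::
  "((('a0::finite \<times> 'a1::finite) \<times> 'b0::finite) \<times> 'b1::finite) op
     \<Rightarrow> 'b0 \<Rightarrow> 'b0 \<Rightarrow> 'b1 \<Rightarrow> 'b1 \<Rightarrow> 'a0 op \<Rightarrow> 'a1 op" where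
  "choi_component D i j k l X =
     (\<chi> a a'. \<Sum>p\<in>UNIV. \<Sum>q\<in>UNIV. X $ p $ q * D $ (((p, a), i), k) $ (((q, a'), j), l))"

text \<open>The action of \<open>\<Theta>\<close> tensored with the identity, on unnormalised Choi operators.\<close>

definition super_slice ::
  "(('a0::finite op \<Rightarrow> 'a1::finite op) \<Rightarrow> ('c0::finite op \<Rightarrow> 'c1::finite op))
     \<Rightarrow> (('a0 \<times> 'a1) \<times> 'b0::finite) op \<Rightarrow> (('c0 \<times> 'c1) \<times> 'b0) op" where
  "super_slice \<Theta> \<gamma> = (\<chi> P Q. \<Theta> (choi_slice \<gamma> (snd P) (snd Q)) (munit (fst (fst P)) (fst (fst Q)))
     $ snd (fst P) $ snd (fst Q))"

definition super_choi ::
  "(('a0::finite op \<Rightarrow> 'a1::finite op) \<Rightarrow> ('c0::finite op \<Rightarrow> 'c1::finite op))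
     \<Rightarrow> ((('a0 \<times> 'a1) \<times> 'b0::finite) \<times> 'b1::finite) op \<Rightarrow> ((('c0 \<times> 'c1) \<times> 'b0) \<times> 'b1) op" where
  "super_choi \<Theta> D = (\<chi> P Q. \<Theta> (choi_component D (snd (fst P)) (snd (fst Q)) (snd P) (snd Q))
     (munit (fst (fst (fst P))) (fst (fst (fst Q)))) $ snd (fst (fst P)) $ snd (fst (fst Q)))"

lemma super_slice_nth: "super_slice \<Theta> \<gamma> $ ((c, u), i) $ ((c', u'), j)
    = \<Theta> (choi_slice \<gamma> i j) (munit c c') $ u $ u'"
  by (simp add: super_slice_def)

lemma super_choi_nth: "super_choi \<Theta> D $ (((c, u), i), k) $ (((c', u'), j), l)
    = \<Theta> (choi_component D i j k l) (munit c c') $ u $ u'"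
  by (simp add: super_choi_def)

lemma op_linear_choi_slice: "op_linear (choi_slice \<gamma> i j)"
  by (simp add: op_linear_iff op_eq_iff choi_slice_def algebra_simps sum.distrib sum_distrib_left)

lemma op_linear_choi_component: "op_linear (choi_component D i j k l)"
  by (simp add: op_linear_iff op_eq_iff choi_component_def algebra_simps sum.distrib sum_distrib_left)

lemma cscale_0 [simp]: "cscale 0 M = 0"
  by (simp add: op_eq_iff)

lemma supermap_linearD:
  assumes "supermap_linear \<Theta>" "op_linear \<Phi>"
  shows "op_linear (\<Theta> \<Phi>)" "\<Theta> (\<lambda>X. cscale c (\<Phi> X)) = (\<lambda>X. cscale c (\<Theta> \<Phi> X))"
    "op_linear \<Psi> \<Longrightarrow> \<Theta> (\<lambda>X. \<Phi> X + \<Psi> X) = (\<lambda>X. \<Theta> \<Phi> X + \<Theta> \<Psi> X)"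
  using assms unfolding supermap_linear_def by blast+

lemma supermap_linear_zero: "supermap_linear \<Theta> \<Longrightarrow> \<Theta> (\<lambda>X. 0) = (\<lambda>X. 0)"
proof -
  assume \<Theta>: "supermap_linear \<Theta>"
  have "op_linear (\<lambda>X. 0)" by (simp add: op_linear_iff op_eq_iff)
  then have "\<Theta> (\<lambda>X. cscale 0 0) = (\<lambda>X. cscale 0 (\<Theta> (\<lambda>X. 0) X))"
    using \<Theta> unfolding supermap_linear_def by blast
  then show ?thesis by simp
qed

lemma op_linear_sum: "(\<And>k. k \<in> K \<Longrightarrow> op_linear (F k)) \<Longrightarrow> op_linear (\<lambda>X. \<Sum>k\<in>K. F k X)"
  by (simp add: op_linear_iff sum.distrib) (simp add: op_eq_iff sum_distrib_left)

lemma supermap_linear_sum: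
  assumes "supermap_linear \<Theta>" "finite K" "\<And>k. k \<in> K \<Longrightarrow> op_linear (F k)"
  shows "\<Theta> (\<lambda>X. \<Sum>k\<in>K. F k X) = (\<lambda>Y. \<Sum>k\<in>K. \<Theta> (F k) Y)"
  using assms(2,3)
proof (induction K rule: finite_induct)
  case (insert x K)
  then have "op_linear (F x)" "op_linear (\<lambda>X. \<Sum>k\<in>K. F k X)" by (simp_all add: op_linear_sum)
  then have "\<Theta> (\<lambda>X. F x X + (\<Sum>k\<in>K. F k X)) = (\<lambda>Y. \<Theta> (F x) Y + \<Theta> (\<lambda>X. \<Sum>k\<in>K. F k X) Y)"
    using assms(1) unfolding supermap_linear_def by blast
  with insert show ?case by simp
qed (simp add: supermap_linear_zero[OF assms(1)])

text \<open>Adding \<open>1 - c\<close> times a fixed trace-preserving map makes \<Phi>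
  trace-preserving, so the axiom applies, and linearity removes the correction afterwards. Dividing
  \<Phi> by \<open>c\<close> would break down at \<open>c = 0\<close>.\<close>

lemma superchannel_scaled_trace:
  fixes \<Theta> :: "('a0::finite op \<Rightarrow> 'a1::finite op) \<Rightarrow> ('c0::finite op \<Rightarrow> 'c1::finite op)"
  assumes "superchannel \<Theta>" "op_linear \<Phi>" "\<And>X. trace (\<Phi> X) = c * trace X"
  shows "trace (\<Theta> \<Phi> Y) = c * trace Y"
proof -
  have \<Theta>: "supermap_linear \<Theta>" and tp: "\<And>\<Phi>. op_linear \<Phi> \<Longrightarrow> trace_preserving \<Phi> \<Longrightarrow> trace_preserving (\<Theta> \<Phi>)"
    using assms(1) by (auto simp: superchannel_def)
  define T :: "'a0 op \<Rightarrow> 'a1 op" where "T X = cscale (trace X) (munit undefined undefined)" for X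
  have T: "op_linear T" "trace_preserving T"
    by (simp_all add: T_def op_linear_iff op_eq_iff trace_add trace_cscale trace_preserving_def
        trace_munit algebra_simps)
  have cT: "op_linear (\<lambda>X. cscale (1 - c) (T X))"
    using T(1) by (simp add: op_linear_iff) (simp add: op_eq_iff algebra_simps)
  have "op_linear (\<lambda>X. \<Phi> X + cscale (1 - c) (T X))"
    using assms(2) cT by (simp add: op_linear_iff) (simp add: op_eq_iff algebra_simps)
  moreover have "trace_preserving (\<lambda>X. \<Phi> X + cscale (1 - c) (T X))"
    using T(2) by (simp add: trace_preserving_def trace_add trace_cscale assms(3) algebra_simps)
  ultimately have "trace (\<Theta> (\<lambda>X. \<Phi> X + cscale (1 - c) (T X)) Y) = trace Y"
    using tp by (simp add: trace_preserving_def)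
  moreover have "\<Theta> (\<lambda>X. \<Phi> X + cscale (1 - c) (T X)) = (\<lambda>X. \<Theta> \<Phi> X + cscale (1 - c) (\<Theta> T X))"
    by (simp only: supermap_linearD[OF \<Theta>] assms(2) T(1) cT)
  moreover have "trace (\<Theta> T Y) = trace Y"
    using tp[OF T] by (simp add: trace_preserving_def)
  ultimately show ?thesis by (simp add: trace_add trace_cscale algebra_simps)
qed

text \<open>By the marginal constraint the slice at \<open>i\<close>, \<open>j\<close> multiplies
  traces by an entry of the B0 marginal divided by the dimension of A0, and \<Theta> retains this
  factor. The prefactor exchanges the dimension of A0 for that of the new input.\<close>

lemma super_slice_marginal:
  fixes \<Theta> :: "('a0::finite op \<Rightarrow> 'a1::finite op) \<Rightarrow> ('c0::finite op \<Rightarrow> 'c1::finite op)"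
    and \<gamma> :: "(('a0 \<times> 'a1) \<times> 'b0::finite) op"
  assumes "superchannel \<Theta>" "\<gamma> \<in> marginal_space"
  shows "cscale (of_nat CARD('a0) / of_nat CARD('c0)) (super_slice \<Theta> \<gamma>) \<in> marginal_space" (is "?\<tau> \<in> _")
    and "trace (cscale (of_nat CARD('a0) / of_nat CARD('c0)) (super_slice \<Theta> \<gamma>)) = trace \<gamma>"
proof -
  have tr: "trace (choi_slice \<gamma> i j X) = ptrace1 \<gamma> $ i $ j / of_nat CARD('a0) * trace X" for i j X
  proof -
    have "trace (choi_slice \<gamma> i j X)
        = (\<Sum>p\<in>UNIV. \<Sum>q\<in>UNIV. X $ p $ q * (\<Sum>a\<in>UNIV. \<gamma> $ ((p, a), i) $ ((q, a), j)))"
      unfolding trace_eq_sum choi_slice_def sum_distrib_left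
      by simp (subst sum.swap, intro sum.cong refl, rule sum.swap)
    also have "\<dots> = (\<Sum>p\<in>UNIV. \<Sum>q\<in>UNIV. if p = q then X $ p $ p * (ptrace1 \<gamma> $ i $ j / of_nat CARD('a0)) else 0)"
      unfolding marginal_spaceD[OF assms(2)] by (intro sum.cong refl) auto
    also have "\<dots> = trace X * (ptrace1 \<gamma> $ i $ j / of_nat CARD('a0))"
      unfolding trace_eq_sum sum_distrib_right by (simp del: ptrace1_nth)
    finally show ?thesis by (simp only: mult.commute)
  qed
  have *: "(\<Sum>u\<in>UNIV. ?\<tau> $ ((c, u), i) $ ((c', u), j)) = of_bool (c = c') * ptrace1 \<gamma> $ i $ j / of_nat CARD('c0)"
    for c i c' j
  proof -
    have "(\<Sum>u\<in>UNIV. super_slice \<Theta> \<gamma> $ ((c, u), i) $ ((c', u), j))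
        = trace (\<Theta> (choi_slice \<gamma> i j) (munit c c'))"
      by (simp add: super_slice_nth trace_eq_sum)
    also have "\<dots> = ptrace1 \<gamma> $ i $ j / of_nat CARD('a0) * of_bool (c = c')"
      using superchannel_scaled_trace[OF assms(1) op_linear_choi_slice tr] by (simp only: trace_munit)
    finally show ?thesis
      unfolding cscale_nth sum_distrib_left[symmetric] by (simp del: ptrace1_nth)
  qed
  show "?\<tau> \<in> marginal_space" by (rule marginal_spaceI(1)[OF *])
  show "trace ?\<tau> = trace \<gamma>" using marginal_spaceI(2)[OF *] by (simp only: trace_ptrace1)
qed

section \<open>The induced positive map on Choi operators\<close>

lemma super_choi_diff:
  assumes "supermap_linear \<Theta>"
  shows "super_choi \<Theta> (D - E) = super_choi \<Theta> D - super_choi \<Theta> E"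
proof -
  have "\<Theta> (choi_component (D - E) i j k l)
      = (\<lambda>X. \<Theta> (choi_component D i j k l) X + cscale (- 1) (\<Theta> (choi_component E i j k l) X))" for i j k l
  proof -
    have "choi_component (D - E) i j k l
        = (\<lambda>X. choi_component D i j k l X + cscale (- 1) (choi_component E i j k l X))"
      by (intro ext) (simp add: op_eq_iff choi_component_def right_diff_distrib sum_subtractf)
    moreover have "op_linear (\<lambda>X. cscale (- 1) (choi_component E i j k l X))"
      using op_linear_choi_component[of E i j k l] by (simp add: op_linear_iff) (simp add: op_eq_iff)
    ultimately show ?thesis
      by (simp only: supermap_linearD[OF assms] op_linear_choi_component)
  qed
  then show ?thesis by (simp add: op_eq_iff super_choi_nth)
qed

lemma super_choi_kron_mat_1:
  fixes \<Theta> :: "('a0::finite op \<Rightarrow> 'a1::finite op) \<Rightarrow> ('c0::finite op \<Rightarrow> 'c1::finite op)"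
    and \<gamma> :: "(('a0 \<times> 'a1) \<times> 'b0::finite) op"
  assumes "supermap_linear \<Theta>"
  shows "super_choi \<Theta> (\<gamma> \<otimes> (mat 1 :: 'b1::finite op)) = super_slice \<Theta> \<gamma> \<otimes> mat 1"
proof -
  have "choi_component (\<gamma> \<otimes> (mat 1 :: 'b1 op)) i j k l = (if k = l then choi_slice \<gamma> i j else (\<lambda>X. 0))" for i j k l
    by (intro ext) (auto simp: op_eq_iff choi_component_def choi_slice_def mat_nth)
  then show ?thesis
    by (auto simp: op_eq_iff super_choi_nth super_slice_nth mat_nth supermap_linear_zero[OF assms])
qed

text \<open>Tracing out B1 leads back to slices. For the Choi operator of a channel, whose marginal
  meets the constraint, this yields the unit trace of the transformed Choi operator.\<close>

lemma ptrace2_super_choi: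
  assumes "supermap_linear \<Theta>"
  shows "ptrace2 (super_choi \<Theta> D) = super_slice \<Theta> (ptrace2 D)"
proof -
  have "choi_slice (ptrace2 D) i j = (\<lambda>X. \<Sum>k\<in>UNIV. choi_component D i j k k X)" for i j
    by (intro ext) (simp add: op_eq_iff choi_component_def choi_slice_def sum_distrib_left,
        subst sum.swap, intro allI sum.cong refl, rule sum.swap)
  then show ?thesis
    by (simp add: op_eq_iff super_choi_nth super_slice_nth supermap_linear_sum[OF assms] op_linear_choi_component)
qed

lemma sum_times: "(\<Sum>R\<in>A \<times> B. F R) = (\<Sum>r\<in>A. \<Sum>i\<in>B. F (r, i))"
  by (simp add: sum.cartesian_product)

lemma sum_shuffle:
  "(\<Sum>r\<in>A. \<Sum>k\<in>B. \<Sum>s\<in>A. \<Sum>l\<in>B. \<Sum>i\<in>C. \<Sum>j\<in>C. F r k s l i j)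
    = (\<Sum>r\<in>A. \<Sum>i\<in>C. \<Sum>s\<in>A. \<Sum>j\<in>C. \<Sum>k\<in>B. \<Sum>l\<in>B. F r k s l i j)"
  unfolding sum.cartesian_product
  by (rule sum.reindex_bij_witness[where i = "\<lambda>(r, i, s, j, k, l). (r, k, s, l, i, j)"
        and j = "\<lambda>(r, k, s, l, i, j). (r, i, s, j, k, l)"]) auto

lemma sesq_sum_left: "sesq (\<Sum>k\<in>K. u k) M v = (\<Sum>k\<in>K. sesq (u k) M v)"
  by (induction K rule: infinite_finite_induct) (simp_all add: sesq_add_left, simp_all add: sesq_def)

lemma sesq_sum_right: "sesq u M (\<Sum>k\<in>K. v k) = (\<Sum>k\<in>K. sesq u M (v k))"
  by (induction K rule: infinite_finite_induct) (simp_all add: sesq_add_right, simp_all add: sesq_def)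

text \<open>A Gram decomposition of \<open>D\<close> yields Kraus operators of the maps \<open>choi_component D\<close>.\<close>

lemma family_completely_positive_choi_component:
  assumes "psd D"
  shows "family_completely_positive m n (\<lambda>i j k l. choi_component D (e i) (e j) (f k) (f l))"
  unfolding family_completely_positive_def
proof (intro conjI allI impI op_linear_choi_component)
  fix d :: nat and X :: "nat \<times> nat \<Rightarrow> nat \<times> nat \<Rightarrow> 'a op"
  assume X: "block_psd ({..<d} \<times> {..<m}) X"
  obtain N :: nat and w where w: "\<And>i j. D $ i $ j = (\<Sum>t<N. w t $ i * cnj (w t $ j))"
    using psd_gram[OF assms] by blast
  \<comment> \<open>\<open>y t i k\<close> is the adjoint of the Kraus operator read off from the
    Gram vector \<open>w t\<close>.\<close>
  define y where "y t i k v = (\<chi> p. \<Sum>a\<in>UNIV. cnj (w t $ (((p, a), e i), f k)) * v $ a)" for t i k v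
  have kraus: "sesq u (choi_component D (e i) (e j) (f k) (f l) Z) v = (\<Sum>t<N. sesq (y t i k u) Z (y t j l v))"
    for i j k l Z u v
  proof -
    have "sesq u (choi_component D (e i) (e j) (f k) (f l) Z) v
       = (\<Sum>a\<in>UNIV. \<Sum>a'\<in>UNIV. \<Sum>p\<in>UNIV. \<Sum>q\<in>UNIV. \<Sum>t<N. cnj (u $ a) * Z $ p $ q * w t $ (((p, a), e i), f k)
           * cnj (w t $ (((q, a'), e j), f l)) * v $ a')"
      by (simp add: sesq_def choi_component_def w sum_distrib_left sum_distrib_right mult_ac)
    also have "\<dots> = (\<Sum>t<N. \<Sum>p\<in>UNIV. \<Sum>q\<in>UNIV. \<Sum>a\<in>UNIV. \<Sum>a'\<in>UNIV.
         cnj (u $ a) * Z $ p $ q * w t $ (((p, a), e i), f k) * cnj (w t $ (((q, a'), e j), f l)) * v $ a')"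
      unfolding sum.cartesian_product
      by (rule sum.reindex_bij_witness[where i = "\<lambda>(t, p, q, a, a'). (a, a', p, q, t)"
            and j = "\<lambda>(a, a', p, q, t). (t, p, q, a, a')"]) auto
    also have "\<dots> = (\<Sum>t<N. sesq (y t i k u) Z (y t j l v))"
      by (simp add: sesq_def y_def sum_distrib_left sum_distrib_right mult_ac)
    finally show ?thesis .
  qed
  \<comment> \<open>Collecting the output labels \<open>k\<close> into one test vector per input
    label reduces the claim to block positivity of \<open>X\<close>.\<close>
  define Y where "Y t R v = (\<Sum>k<n. y t (snd R) k (v (fst R, k)))" for t and R :: "nat \<times> nat" and v
  show "block_psd ({..<d} \<times> {..<n})
     (\<lambda>(r, k) (s, l). \<Sum>i<m. \<Sum>j<m. choi_component D (e i) (e j) (f k) (f l) (X (r, i) (s, j)))"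
    unfolding block_psd_def
  proof
    fix v :: "nat \<times> nat \<Rightarrow> complex^'b"
    have "(\<Sum>R\<in>{..<d} \<times> {..<n}. \<Sum>S\<in>{..<d} \<times> {..<n}. sesq (v R)
        ((case R of (r, k) \<Rightarrow> \<lambda>(s, l). \<Sum>i<m. \<Sum>j<m. choi_component D (e i) (e j) (f k) (f l) (X (r, i) (s, j))) S) (v S))
      = (\<Sum>r<d. \<Sum>k<n. \<Sum>s<d. \<Sum>l<n. \<Sum>i<m. \<Sum>j<m. \<Sum>t<N.
          sesq (y t i k (v (r, k))) (X (r, i) (s, j)) (y t j l (v (s, l))))"
      by (simp add: sum_times sesq_sum kraus)
    also have "\<dots> = (\<Sum>r<d. \<Sum>i<m. \<Sum>s<d. \<Sum>j<m. \<Sum>k<n. \<Sum>l<n. \<Sum>t<N.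
          sesq (y t i k (v (r, k))) (X (r, i) (s, j)) (y t j l (v (s, l))))"
      by (rule sum_shuffle)
    also have "\<dots> = (\<Sum>t<N. \<Sum>r<d. \<Sum>i<m. \<Sum>s<d. \<Sum>j<m. \<Sum>k<n. \<Sum>l<n.
          sesq (y t i k (v (r, k))) (X (r, i) (s, j)) (y t j l (v (s, l))))"
      unfolding sum.cartesian_product
      by (rule sum.reindex_bij_witness[where i = "\<lambda>(t, r, i, s, j, k, l). (r, i, s, j, k, l, t)"
            and j = "\<lambda>(r, i, s, j, k, l, t). (t, r, i, s, j, k, l)"]) auto
    also have "\<dots> = (\<Sum>t<N. \<Sum>R\<in>{..<d} \<times> {..<m}. \<Sum>S\<in>{..<d} \<times> {..<m}. sesq (Y t R v) (X R S) (Y t S v))"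
      unfolding sum_times Y_def fst_conv snd_conv unfolding sesq_sum_left unfolding sesq_sum_right ..
    also have "0 \<le> \<dots>"
      using X[unfolded block_psd_def, rule_format, of "\<lambda>R. Y t R v" for t] by (rule sum_nonneg)
    finally show "0 \<le> (\<Sum>R\<in>{..<d} \<times> {..<n}. \<Sum>S\<in>{..<d} \<times> {..<n}. sesq (v R)
        ((case R of (r, k) \<Rightarrow> \<lambda>(s, l). \<Sum>i<m. \<Sum>j<m. choi_component D (e i) (e j) (f k) (f l) (X (r, i) (s, j))) S) (v S))" .
  qed
qed

text \<open>The form is the squared modulus of a single linear functional of the block vector, i.e.
  the operator has rank at most one.\<close>

lemma block_psd_munit:
  "block_psd I (\<lambda>i j. cscale (cnj (g i) * g j) (munit (x i) (x j)))"
  unfolding block_psd_def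
proof
  fix v :: "'a \<Rightarrow> complex^'b"
  have "sesq u (munit a b) w = cnj (u $ a) * w $ b" for u w :: "complex^'b" and a b
  proof -
    have "sesq u (munit a b) w = (\<Sum>i\<in>UNIV. \<Sum>j\<in>UNIV. munit a b $ i $ j * (cnj (u $ i) * w $ j))"
      by (simp add: sesq_def mult_ac)
    then show ?thesis by (simp only: sum_munit)
  qed
  then have "(\<Sum>i\<in>I. \<Sum>j\<in>I. sesq (v i) (cscale (cnj (g i) * g j) (munit (x i) (x j))) (v j))
      = cnj (\<Sum>i\<in>I. g i * v i $ x i) * (\<Sum>j\<in>I. g j * v j $ x j)"
    unfolding cnj_sum sum_product by (simp add: sesq_cscale mult_ac)
  also have "\<dots> = of_real ((cmod (\<Sum>j\<in>I. g j * v j $ x j))\<^sup>2)"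
    by (simp only: complex_norm_square mult.commute)
  also have "0 \<le> \<dots>" by (simp add: less_eq_complex_def del: of_real_power)
  finally show "0 \<le> (\<Sum>i\<in>I. \<Sum>j\<in>I. sesq (v i) (cscale (cnj (g i) * g j) (munit (x i) (x j))) (v j))" .
qed

text \<open>A Choi operator is the image of a maximally entangled operator, here between C0 B0 and
  an ancilla of the same dimension. The transformed family is completely positive, and this one
  input suffices.\<close>

lemma psd_super_choi:
  fixes \<Theta> :: "('a0::finite op \<Rightarrow> 'a1::finite op) \<Rightarrow> ('c0::finite op \<Rightarrow> 'c1::finite op)"
    and D :: "((('a0 \<times> 'a1) \<times> 'b0::finite) \<times> 'b1::finite) op"
  assumes "superchannel \<Theta>" "psd D"
  shows "psd (super_choi \<Theta> D)"
proof -
  have bij: "\<exists>h. bij_betw h {..<CARD('t)} (UNIV :: 't::finite set)"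
    using ex_bij_betw_nat_finite[of "UNIV :: 't set"] by (simp add: atLeast0LessThan)
  obtain e where e: "bij_betw e {..<CARD('b0)} (UNIV :: 'b0 set)" using bij by blast
  obtain f where f: "bij_betw f {..<CARD('b1)} (UNIV :: 'b1 set)" using bij by blast
  obtain h where h: "bij_betw h {..<CARD('c0 \<times> 'b0)} (UNIV :: ('c0 \<times> 'b0) set)" using bij by blast
  define m n d where "m = CARD('b0)" and "n = CARD('b1)" and "d = CARD('c0 \<times> 'b0)"
  note e = e[folded m_def] and f = f[folded n_def] and h = h[folded d_def]
  let ?N = "\<lambda>i j k l. \<Theta> (choi_component D (e i) (e j) (f k) (f l))"
  have lin: "op_linear (\<Theta> (choi_component D i j k l))" for i j k l
    using assms(1) by (simp add: superchannel_def supermap_linearD(1)[where \<Theta> = \<Theta>] op_linear_choi_component)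
  have "family_completely_positive m n ?N"
    using assms(1) family_completely_positive_choi_component[OF assms(2), of m n e f]
    by (simp add: superchannel_def)
  then have cp: "block_psd ({..<d} \<times> {..<n}) (\<lambda>(r, k) (s, l). \<Sum>i<m. \<Sum>j<m. ?N i j k l (X (r, i) (s, j)))"
    if "block_psd ({..<d} \<times> {..<m}) X" for X
    using that unfolding family_completely_positive_def by blast
  \<comment> \<open>Through \<open>h\<close> the ancilla label encodes a pair of labels of C0 and
    B0. \<open>g\<close> picks out the B0 label and the matrix unit in \<open>X\<close> the C0
    label, so the double sum over \<open>i\<close>, \<open>j\<close> collapses to one term.\<close>
  define g where "g R = (of_bool (snd (h (fst R)) = e (snd R)) :: complex)" for R
  have cnj_of_bool: "cnj (of_bool b) = of_bool b" for b by (cases b) auto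
  define X where "X R S = cscale (cnj (g R) * g S) (munit (fst (h (fst R))) (fst (h (fst S))))" for R S
  have "block_psd ({..<d} \<times> {..<m}) X" unfolding X_def by (rule block_psd_munit)
  note cp[OF this]
  moreover have "(\<Sum>i<m. \<Sum>j<m. ?N i j k l (X (r, i) (s, j)))
      = \<Theta> (choi_component D (snd (h r)) (snd (h s)) (f k) (f l)) (munit (fst (h r)) (fst (h s)))" for r s k l
  proof -
    have "(\<Sum>i<m. \<Sum>j<m. ?N i j k l (X (r, i) (s, j)))
       = (\<Sum>i<m. \<Sum>j<m. cscale (of_bool (snd (h r) = e i) * of_bool (snd (h s) = e j))
            (?N i j k l (munit (fst (h r)) (fst (h s)))))"
      using lin cnj_of_bool by (simp add: X_def g_def op_linear_iff)
    also have "\<dots> = (\<Sum>i\<in>UNIV. \<Sum>j\<in>UNIV. cscale (of_bool (snd (h r) = i) * of_bool (snd (h s) = j))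
            (\<Theta> (choi_component D i j (f k) (f l)) (munit (fst (h r)) (fst (h s)))))"
      by (simp only: sum.reindex_bij_betw[OF e, of "\<lambda>j. cscale (of_bool (snd (h r) = _) * of_bool (snd (h s) = j))
            (\<Theta> (choi_component D _ j (f k) (f l)) (munit (fst (h r)) (fst (h s))))"]
          sum.reindex_bij_betw[OF e, of "\<lambda>i. \<Sum>j\<in>UNIV. cscale (of_bool (snd (h r) = i) * of_bool (snd (h s) = j))
            (\<Theta> (choi_component D i j (f k) (f l)) (munit (fst (h r)) (fst (h s))))"])
    also have "\<dots> = (\<Sum>i\<in>UNIV. if i = snd (h r) then \<Sum>j\<in>UNIV. if j = snd (h s) then
         \<Theta> (choi_component D (snd (h r)) (snd (h s)) (f k) (f l)) (munit (fst (h r)) (fst (h s))) else 0 else 0)"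
      by (intro sum.cong refl) (auto simp: op_eq_iff intro!: sum.cong sum.neutral)
    finally show ?thesis by simp
  qed
  ultimately have "block_psd ({..<d} \<times> {..<n}) (\<lambda>R S.
      (\<lambda>P Q. \<Theta> (choi_component D (snd (fst P)) (snd (fst Q)) (snd P) (snd Q)) (munit (fst (fst P)) (fst (fst Q))))
        (map_prod h f R) (map_prod h f S))"
    by (simp add: split_def)
  moreover have "bij_betw (map_prod h f) ({..<d} \<times> {..<n}) UNIV"
    using h f unfolding bij_betw_def
    by (auto simp: map_prod_inj_on map_prod_image simp flip: UNIV_Times_UNIV)
  ultimately have "block_psd UNIV (\<lambda>P Q. \<Theta> (choi_component D (snd (fst P)) (snd (fst Q)) (snd P) (snd Q))
      (munit (fst (fst P)) (fst (fst Q))))"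
    using block_psd_reindex by blast
  then have "psd (reindex (\<lambda>(((c, u), i), k). (((c, i), k), u)) (\<chi> p q. (\<lambda>P Q.
      \<Theta> (choi_component D (snd (fst P)) (snd (fst Q)) (snd P) (snd Q)) (munit (fst (fst P)) (fst (fst Q))))
        (fst p) (fst q) $ snd p $ snd q))"
    unfolding block_psd_UNIV_iff by (rule psd_reindex)
  also have "reindex (\<lambda>(((c, u), i), k). (((c, i), k), u)) (\<chi> p q. (\<lambda>P Q.
      \<Theta> (choi_component D (snd (fst P)) (snd (fst Q)) (snd P) (snd Q)) (munit (fst (fst P)) (fst (fst Q))))
        (fst p) (fst q) $ snd p $ snd q) = super_choi \<Theta> D"
    by (simp add: op_eq_iff super_choi_nth)
  finally show ?thesis .
qed

text \<open>\<open>component \<Omega>\<close> carries d_A0 d_B0 times the normalised Choi operator,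
  and the new normalisation divides by d_C0 d_B0; the prefactor is the quotient.\<close>

lemma ext_choi_super_tensor_id:
  fixes \<Theta> :: "('a0::finite op \<Rightarrow> 'a1::finite op) \<Rightarrow> ('c0::finite op \<Rightarrow> 'c1::finite op)"
    and \<Omega> :: "('a0 \<times> 'b0::finite) op \<Rightarrow> ('a1 \<times> 'b1::finite) op"
  assumes "supermap_linear \<Theta>" "op_linear \<Omega>"
  shows "ext_choi (super_tensor_id \<Theta> \<Omega>)
    = cscale (of_nat CARD('a0) / of_nat CARD('c0)) (super_choi \<Theta> (ext_choi \<Omega>))"
proof -
  have zero: "\<Theta> \<Phi> 0 = 0" if "op_linear \<Phi>" for \<Phi>
  proof -
    have "op_linear (\<Theta> \<Phi>)" using assms(1) that by (simp add: supermap_linear_def)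
    then have "\<Theta> \<Phi> (cscale 0 0) = cscale 0 (\<Theta> \<Phi> 0)" unfolding op_linear_iff by blast
    then show ?thesis by simp
  qed
  have comp: "component \<Omega> i j k l
      = (\<lambda>X. cscale (of_nat (CARD('a0) * CARD('b0))) (choi_component (ext_choi \<Omega>) i j k l X))" for i j k l
  proof -
    have "(\<Sum>P\<in>UNIV. \<Sum>Q\<in>UNIV. (X \<otimes> munit i j) $ P $ Q * F P Q)
        = (\<Sum>p\<in>UNIV. \<Sum>q\<in>UNIV. X $ p $ q * F (p, i) (q, j))"
      for X and F :: "'a0 \<times> 'b0 \<Rightarrow> 'a0 \<times> 'b0 \<Rightarrow> complex"
    proof -
      have "(\<Sum>P\<in>UNIV. \<Sum>Q\<in>UNIV. (X \<otimes> munit i j) $ P $ Q * F P Q)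
        = (\<Sum>p\<in>UNIV. \<Sum>q\<in>UNIV. \<Sum>b\<in>UNIV. \<Sum>b'\<in>UNIV. munit i j $ b $ b' * (X $ p $ q * F (p, b) (q, b')))"
        unfolding sum_UNIV_prod[where 'a = 'a0]
        by (simp add: mult_ac) (rule sum.cong[OF refl], rule sum.swap)
      then show ?thesis by (simp only: sum_munit)
    qed
    then show ?thesis
      by (intro ext) (simp add: op_eq_iff component_def op_linear_expand[OF assms(2), of "_ \<otimes> _"]
          choi_component_def ext_choi_def nchoi_nth sum_distrib_left del: kron_nth)
  qed
  have lin: "op_linear (component \<Omega> i j k l)" for i j k l
    unfolding comp using op_linear_choi_component[of "ext_choi \<Omega>" i j k l]
    by (simp add: op_linear_iff) (simp add: op_eq_iff algebra_simps)
  have "super_tensor_id \<Theta> \<Omega> (munit (c, i) (c', j)) $ (u, k) $ (u', l)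
      = of_nat (CARD('a0) * CARD('b0)) * super_choi \<Theta> (ext_choi \<Omega>) $ (((c, u), i), k) $ (((c', u'), j), l)"
    for c i c' j u k u' l
  proof -
    have blk: "(\<chi> x x'. munit (c, i) (c', j) $ (x, b) $ (x', b')) = (if b = i \<and> b' = j then munit c c' else 0)"
      for b b' by (auto simp: op_eq_iff munit_nth)
    have "(\<Sum>b\<in>UNIV. \<Sum>b'\<in>UNIV. \<Theta> (component \<Omega> b b' k l) (\<chi> x x'. munit (c, i) (c', j) $ (x, b) $ (x', b')))
        = (\<Sum>b\<in>UNIV. if b = i then \<Theta> (component \<Omega> i j k l) (munit c c') else 0)"
    proof (rule sum.cong[OF refl])
      fix b
      have "(\<Sum>b'\<in>UNIV. \<Theta> (component \<Omega> b b' k l) (if b = i \<and> b' = j then munit c c' else 0))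
          = (\<Sum>b'\<in>UNIV. if b' = j then (if b = i then \<Theta> (component \<Omega> i j k l) (munit c c') else 0) else 0)"
        by (intro sum.cong refl) (auto simp: zero[OF lin])
      then show "(\<Sum>b'\<in>UNIV. \<Theta> (component \<Omega> b b' k l) (\<chi> x x'. munit (c, i) (c', j) $ (x, b) $ (x', b')))
          = (if b = i then \<Theta> (component \<Omega> i j k l) (munit c c') else 0)"
        unfolding blk by simp
    qed
    also have "\<dots> = \<Theta> (component \<Omega> i j k l) (munit c c')" by simp
    also have "\<dots> = cscale (of_nat (CARD('a0) * CARD('b0))) (\<Theta> (choi_component (ext_choi \<Omega>) i j k l) (munit c c'))"
      unfolding comp by (simp only: supermap_linearD[OF assms(1)] op_linear_choi_component)
    finally show ?thesis
      by (auto simp: super_tensor_id_def super_choi_nth dest: arg_cong[where f = "\<lambda>M. M $ u $ u'"])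
  qed
  then show ?thesis
    by (simp add: op_eq_iff ext_choi_def[of "super_tensor_id \<Theta> \<Omega>"] nchoi_nth)
qed

text \<open>The induced positive map carries the certificate
  \<open>\<sigma> \<otimes> mat 1 - ext_choi \<Omega>\<close> to one of the same shape for the
  transformed map, with the trace of the feasible point unchanged.\<close>

lemma Hmin_ext_superchannel:
  fixes \<Theta> :: "('a0::finite op \<Rightarrow> 'a1::finite op) \<Rightarrow> ('c0::finite op \<Rightarrow> 'c1::finite op)"
    and \<Omega> :: "('a0 \<times> 'b0::finite) op \<Rightarrow> ('a1 \<times> 'b1::finite) op"
  assumes "superchannel \<Theta>" "channel \<Omega>"
  shows "Hmin_ext \<Omega> \<le> Hmin_ext (super_tensor_id \<Theta> \<Omega>)"
proof -
  let ?r = "of_nat CARD('a0) / of_nat CARD('c0) :: complex"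
  have \<Theta>: "supermap_linear \<Theta>" using assms(1) by (simp add: superchannel_def)
  have \<Omega>: "psd (ext_choi \<Omega>)" "trace (ext_choi \<Omega>) = 1"
    using assms(2) by (auto simp: channel_def psd_ext_choi trace_ext_choi)
  note eq = ext_choi_super_tensor_id[OF \<Theta> channel_op_linear[OF assms(2)]]
  have psd_r: "psd (cscale ?r (super_choi \<Theta> D))" if "psd D" for D :: "((('a0 \<times> 'a1) \<times> 'b0) \<times> 'b1) op"
    using psd_cscale[OF _ psd_super_choi[OF assms(1) that], of "real CARD('a0) / real CARD('c0)"] by simp
  have "ptrace2 (ext_choi \<Omega>) \<in> marginal_space"
  proof (rule marginal_spaceI(1))
    fix a a' :: 'a0 and b b' :: 'b0
    have "(\<Sum>x\<in>UNIV. ptrace2 (ext_choi \<Omega>) $ ((a, x), b) $ ((a', x), b'))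
        = (\<Sum>k\<in>UNIV. nchoi \<Omega> $ ((a, b), k) $ ((a', b'), k))"
      by (simp add: ext_choi_def sum_UNIV_prod)
    also have "\<dots> = of_bool (a = a') * (mat (1 / of_nat CARD('b0)) :: 'b0 op) $ b $ b' / of_nat CARD('a0)"
      using assms(2) by (simp add: channel_def nchoi_marginal mat_nth)
    finally show "(\<Sum>x\<in>UNIV. ptrace2 (ext_choi \<Omega>) $ ((a, x), b) $ ((a', x), b'))
        = of_bool (a = a') * (mat (1 / of_nat CARD('b0)) :: 'b0 op) $ b $ b' / of_nat CARD('a0)" .
  qed
  from super_slice_marginal(2)[OF assms(1) this]
  have tr: "trace (ext_choi (super_tensor_id \<Theta> \<Omega>)) = 1"
    unfolding eq by (simp add: trace_cscale trace_ptrace2 \<Omega> flip: ptrace2_super_choi[OF \<Theta>])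
  have "- log 2 (minval marginal_space (ext_choi \<Omega>))
      \<le> - log 2 (minval marginal_space (ext_choi (super_tensor_id \<Theta> \<Omega>)))"
  proof (rule neg_log_minval_le)
    fix \<sigma> assume \<sigma>: "\<sigma> \<in> feasible marginal_space (ext_choi \<Omega>)"
    let ?\<tau> = "cscale ?r (super_slice \<Theta> \<sigma>)"
    have "psd (cscale ?r (super_choi \<Theta> (\<sigma> \<otimes> mat 1 - ext_choi \<Omega>)))"
      by (intro psd_r feasibleD(2)[OF \<sigma>])
    also have "cscale ?r (super_choi \<Theta> (\<sigma> \<otimes> mat 1 - ext_choi \<Omega>))
        = ?\<tau> \<otimes> mat 1 - ext_choi (super_tensor_id \<Theta> \<Omega>)"
      unfolding eq super_choi_diff[OF \<Theta>] super_choi_kron_mat_1[OF \<Theta>]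
      by (simp add: op_eq_iff right_diff_distrib)
    finally have "?\<tau> \<in> feasible marginal_space (ext_choi (super_tensor_id \<Theta> \<Omega>))"
      by (intro feasibleI super_slice_marginal(1)[OF assms(1) feasibleD(1)[OF \<sigma>]])
        (simp_all add: eq psd_r \<Omega>)
    with super_slice_marginal(2)[OF assms(1) feasibleD(1)[OF \<sigma>]]
    show "\<exists>\<tau>\<in>feasible marginal_space (ext_choi (super_tensor_id \<Theta> \<Omega>)). trace \<tau> = trace \<sigma>" by blast
  qed (simp_all add: op_space_marginal_space \<Omega> tr, simp add: eq psd_r \<Omega>)
  then show ?thesis unfolding Hmin_ext_eq .
qed

theorem theorem5:
  fixes \<Omega> :: "('a0::finite \<times> 'b0::finite) op \<Rightarrow> ('a1::finite \<times> 'b1::finite) op"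
  assumes "channel \<Omega>"
  shows
    "((\<forall>\<rho>. density_matrix \<rho> \<longrightarrow> \<Omega> \<rho> = ptrace1 (nchoi \<Omega>)) \<longrightarrow>
        Hmin_ext \<Omega> = Hmin (ptrace1 (nchoi \<Omega>)))
     \<and>
     (\<forall>(\<Psi> :: 'a0 op \<Rightarrow> 'a1 op) (\<Phi> :: 'b0 op \<Rightarrow> 'b1 op).
        channel \<Psi> \<longrightarrow> channel \<Phi> \<longrightarrow> \<Omega> = tensor_map \<Psi> \<Phi> \<longrightarrow>
        Hmin_ext \<Omega> = Hmin_ext1 \<Phi> \<and>
        (\<forall>\<Psi>' :: 'a0 op \<Rightarrow> 'a1 op. channel \<Psi>' \<longrightarrow> Hmin_ext (tensor_map \<Psi>' \<Phi>) = Hmin_ext \<Omega>))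
     \<and>
     (\<forall>\<Gamma> :: ('a2::finite \<times> 'b2::finite) op \<Rightarrow> ('a3::finite \<times> 'b3::finite) op.
        channel \<Gamma> \<longrightarrow>
        Hmin_ext (bipartite_tensor \<Omega> \<Gamma>) = Hmin_ext \<Omega> + Hmin_ext \<Gamma>)
     \<and>
     (\<forall>\<Theta> :: ('a0 op \<Rightarrow> 'a1 op) \<Rightarrow> ('c0::finite op \<Rightarrow> 'c1::finite op).
        superchannel \<Theta> \<longrightarrow> Hmin_ext \<Omega> \<le> Hmin_ext (super_tensor_id \<Theta> \<Omega>))
     \<and>
     (\<forall>(\<Lambda> :: (('a0 \<times> 'b0) \<times> 'd0::finite) op \<Rightarrow> (('a1 \<times> 'b1) \<times> 'd1::finite) op)
        (\<gamma> :: 'd0 op).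
        channel \<Lambda> \<longrightarrow> density_matrix \<gamma> \<longrightarrow>
        Hmin_ext (reindex_map (\<lambda>((a, c), b). ((a, b), c)) (\<lambda>((a, c), b). ((a, b), c)) \<Lambda>)
          \<le> Hmin_ext (\<lambda>\<rho>. ptrace2 (\<Lambda> (\<rho> \<otimes> \<gamma>))))
     \<and>
     Hmin (reindex (\<lambda>(b0, ((a0, a1), b1)). ((a0, b0), (a1, b1))) (nchoi \<Omega>))
         - log 2 (real CARD('a0) * real CARD('a1)) \<le> Hmin_ext \<Omega>
     \<and>
     Hmin_ext \<Omega> \<le> Hmin (ptrace1 (nchoi \<Omega>))"
proof (intro conjI allI impI)
  assume "\<forall>\<rho>. density_matrix \<rho> \<longrightarrow> \<Omega> \<rho> = ptrace1 (nchoi \<Omega>)"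
  with assms show "Hmin_ext \<Omega> = Hmin (ptrace1 (nchoi \<Omega>))"
    by (intro Hmin_ext_replacement) auto
qed (use assms in \<open>simp_all add: Hmin_ext_product Hmin_ext_additive Hmin_ext_superchannel
  Hmin_ext_conditioning Hmin_ext_ge_Hmin Hmin_ext_le_Hmin\<close>)

end
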